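(* Let $t$ be an injective-reachable seed such that $t'=t[1]=\boldsymbol\mu t$ is similar to $t$ up to the permutation $\sigma$ of $I_{\mathrm{uf}}$. (1) There exists a twist automorphism $\mathrm{tw}^A_t$ on $\mathcal U^A(t)$ of Donaldson--Thomas type. (2) There exists a twist automorphism $\mathrm{tw}^X_t$ on $\mathcal U^X(t)$ of Donaldson--Thomas type. (3) One can choose $\mathrm{tw}^A_t$ and $\mathrm{tw}^X_t$ in (1)--(2) such that $p^*\mathrm{tw}^X_t=\mathrm{tw}^A_tp^*$ (as maps on $\mathcal U^X(t)$). These statements hold both in the classical case and in the quantum case (the latter with a chosen compatible Poisson structure on $t$).
   Context: Seeds. Fix a finite set $I=I_{\mathrm{uf}}\sqcup I_{\mathrm f}$ (unfrozen, frozen) and integers $d_i>0$. A seed $t$ consists of indeterminates $(A_i)_{i\in I}$, $(X_i)_{i\in I}$ and an integer matrix $B(t)=(b_{ij})_{i,j\in I}$ with $\frac1{d_i}b_{ij}=-\frac1{d_j}b_{ji}$. $N(t)=\mathbb{Z}^I$ has basis $\mathbf e_i$, $\mathbf f_i=\frac1{d_i}\mathbf e_i^*$ ($\mathbf e_i^*$ dual basis), $M^\circ(t)=\bigoplus_i\mathbb{Z}\mathbf f_i$, $M^\circ_{\mathrm f}(t)=\bigoplus_{j\in I_{\mathrm f}}\mathbb{Z}\mathbf f_j$. $p^*:N(t)\to M^\circ(t)$, $p^*\mathbf e_j=\sum_ib_{ij}\mathbf f_i$. $\omega$ is the skew form on $N(t)$ with $\omega(\mathbf e_i,\mathbf e_j)=\frac1{d_j}b_{ji}$.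 A compatible Poisson structure on $t$ is a $\mathbb{Q}$-valued skew-symmetric form $\lambda$ on $M^\circ(t)$ with $\lambda(\mathbf f_i,p^*\mathbf e_k)=-\delta_{ik}\frac1{d_k}$ for $i\in I$, $k\in I_{\mathrm{uf}}$. Objects of $t'$ carry a prime. Base ring. Classical case: $\Bbbk=\mathbb{Z}$, $v=1$. Quantum case: $\Bbbk=\mathbb{Z}[v^{\pm1/d'}]$ with $d'$ sufficiently divisible, and $t$ has a chosen compatible Poisson structure $\lambda$. $\mathcal{LP}^A(t)=\Bbbk[A_i^{\pm1}]$, $\mathcal{LP}^X(t)=\Bbbk[X_i^{\pm1}]$ are $\Bbbk$-algebras with product $A^m*A^{m'}=v^{\lambda(m,m')}A^{m+m'}$ (the usual product if $v=1$), $X^n*X^{n'}=v^{-\omega(n,n')}X^{n+n'}$; $\cdot$ is the commutative product; $\mathcal F^\bullet(t)$ is the (skew-)field of fractions. Mutation. For $k\in I_{\mathrm{uf}}$, $\mu_kt$ has matrix $b'_{ij}=-b_{ij}$ if $k\in\{i,j\}$, $b'_{ij}=b_{ij}+b_{ik}[b_{kj}]_++[-b_{ik}]_+b_{kj}$ otherwise ($[x]_+=\max(x,0)$); the form $\lambda$ is transported by the linear isomorphism $M^\circ(\mu_kt)\to M^\circ(t)$, $\mathbf f'_i\mapsto\mathbf f_i$ ($i\ne k$), $\mathbf f'_k\mapsto-\mathbf f_k+\sum_j[-b_{jk}]_+\mathbf f_j$. The isomorphisms $\mu_k^*:\mathcal F^\bullet(\mu_kt)\to\mathcal F^\bullet(t)$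 are: $A'_i\mapsto A_i$ ($i\ne k$), $A'_k\mapsto A^{-\mathbf f_k+\sum_j[-b_{jk}]_+\mathbf f_j}+A^{-\mathbf f_k+\sum_j[b_{jk}]_+\mathbf f_j}$; $X'_k\mapsto X_k^{-1}$, and for $i\ne k$, $X_i'\mapsto\sum_{s=0}^{-b_{ki}}\binom{-b_{ki}}{s}_{v_k}X_i\cdot X_k^s$ if $b_{ki}\le0$, $X'_i\mapsto\big(\sum_{s=0}^{b_{ki}}\binom{b_{ki}}{s}_{v_k}X_i^{-1}\cdot X_k^{s-b_{ki}}\big)^{-1}$ if $b_{ki}>0$, where $v_k=v^{1/d_k}$ and $\binom ab_q$ is the symmetric quantum binomial built from $[a]_q=\frac{q^a-q^{-a}}{q-q^{-1}}$ (ordinary binomial if $v=1$). For $\boldsymbol\mu=\mu_{k_l}\cdots\mu_{k_1}$: $\boldsymbol\mu^*=\mu_{k_1}^*\cdots\mu_{k_l}^*$. $\mathcal U^\bullet(t)=\bigcap_{\boldsymbol\nu}\boldsymbol\nu^*\mathcal{LP}^\bullet(\boldsymbol\nu t)\subset\mathcal F^\bullet(t)$ over all mutation sequences $\boldsymbol\nu$. The $\Bbbk$-linear map $p^*:\mathcal{LP}^X(t)\to\mathcal{LP}^A(t)$, $X^n\mapsto A^{p^*n}$, restricts to $\mathcal U^X(t)\to\mathcal U^A(t)$. Injective-reachable. For $t'=\boldsymbol\mu t$ each $\boldsymbol\mu^*X_i(t')$ can be written as $X(t)^{n_i}*P*Q^{-1}$ with $P,Q$ polynomials in $X_k(t)$,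 $k\in I_{\mathrm{uf}}$, with constant term $1$, for a unique $n_i\in N(t)$. The seed $t$ is injective-reachable if there are $t[1]=\boldsymbol\mu t$ and a permutation $\sigma$ of $I_{\mathrm{uf}}$ such that $n_{\sigma k}=-\mathbf e_k(t)$ for all $k\in I_{\mathrm{uf}}$. Similar up to $\sigma$: $b_{ij}(t)=b_{\sigma i,\sigma j}(t')$, $d_i=d_{\sigma i}$ for $i,j\in I_{\mathrm{uf}}$. Variation maps from $t$ to $t'$ (integral). Linear $M$-variation map: linear $\mathrm{var}^M_t:M^\circ(t)\to M^\circ(t')$ with $\mathrm{var}^M_t(\mathbf f_k)\in\mathbf f'_{\sigma k}+M^\circ_{\mathrm f}(t')$, $\mathrm{var}^M_t(\mathbf f_j)\in M^\circ_{\mathrm f}(t')$, $\mathrm{var}^M_t(p^*\mathbf e_k)=p^*\mathbf e'_{\sigma k}$ for $k\in I_{\mathrm{uf}}$, $j\in I_{\mathrm f}$. Linear $N$-variation map: linear $\mathrm{var}^N_t:N(t)\to N(t')$ with $\mathrm{var}^N_t(\mathbf e_k)=\mathbf e'_{\sigma k}$ and $\omega(\mathrm{var}^N_t\mathbf e_i,\mathrm{var}^N_t\mathbf e_k)=\omega(\mathbf e_i,\mathbf e_k)$ for $i\in I$, $k\in I_{\mathrm{uf}}$. Variation maps $\mathrm{var}^A_t:\mathcal{LP}^A(t)\to\mathcal{LP}^A(t')$, $\mathrm{var}^X_t:\mathcal{LP}^X(t)\to\mathcal{LP}^X(t')$ are the associated monomial maps $A^m\mapsto(A')^{\mathrm{var}^M_t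 m}$, $X^n\mapsto(X')^{\mathrm{var}^N_tn}$, required to be $\Bbbk$-algebra homomorphisms for $*$. A twist automorphism of $\mathcal U^\bullet(t)$ passing through $t'=\boldsymbol\mu t$ is $\mathrm{tw}^\bullet_t=\boldsymbol\mu^*\circ\mathrm{var}^\bullet_t$ with $\mathrm{var}^\bullet_t$ an invertible variation map; it is of Donaldson--Thomas type if $t'=t[1]$. *)

theory Defs
  imports Complex_Main "HOL-Library.Poly_Mapping" "HOL-Combinatorics.Permutations"
begin

section \<open>Seeds\<close>

text \<open>
  The index set \<open>I\<close> is the finite type \<open>'i\<close>, and \<open>I_f\<close> is the complement of the field \<open>unfrozen\<close>.
  Both \<open>N(t)\<close> and \<open>M\<degree>(t)\<close> are the free abelian group on \<open>'i\<close>, written in the bases \<open>(e_i)\<close> and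
  \<open>(f_i)\<close> respectively; \<open>frag_of i\<close> stands for \<open>e_i\<close> or \<open>f_i\<close> according to the context.
  The numbers \<open>d_i\<close> are the values of the field \<open>mult\<close>. The field \<open>pois\<close> carries the chosen Poisson form on \<open>M\<degree>(t)\<close> in the quantum case; in the classical
  case there is no such choice and the field is the zero form.
\<close>

type_synonym 'i lattice = "'i \<Rightarrow>\<^sub>0 int"

record 'i seed =
  unfrozen :: "'i set"
  mult :: "'i \<Rightarrow> int"
  bmat :: "'i \<Rightarrow> 'i \<Rightarrow> int"
  pois :: "'i lattice \<Rightarrow> 'i lattice \<Rightarrow> rat"

definition is_seed :: "'i::finite seed \<Rightarrow> bool" where
  "is_seed t \<longleftrightarrow> (\<forall>i. mult t i > 0) \<and>
     (\<forall>i j. of_int (bmat t i j) / (of_int (mult t i) :: rat)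
            = - (of_int (bmat t j i) / of_int (mult t j)))"

definition frozen_sublattice :: "'i::finite seed \<Rightarrow> 'i lattice set" where
  "frozen_sublattice t = {m. \<forall>i\<in>unfrozen t. Poly_Mapping.lookup m i = 0}"

definition p_star :: "'i::finite seed \<Rightarrow> 'i lattice \<Rightarrow> 'i lattice" where
  "p_star t = frag_extend (\<lambda>j. \<Sum>i\<in>UNIV. frag_cmul (bmat t i j) (frag_of i))"

definition omega :: "'i::finite seed \<Rightarrow> 'i lattice \<Rightarrow> 'i lattice \<Rightarrow> rat" where
  "omega t n n' = (\<Sum>i\<in>UNIV. \<Sum>j\<in>UNIV.
     of_int (Poly_Mapping.lookup n i) * of_int (Poly_Mapping.lookup n' j)
       * (of_int (bmat t j i) / of_int (mult t j)))"

definition compatible_poisson :: "'i::finite seed \<Rightarrow> bool" where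
  "compatible_poisson t \<longleftrightarrow>
     (\<forall>m m' m''. pois t (m + m') m'' = pois t m m'' + pois t m' m'') \<and>
     (\<forall>m m'. pois t m m' = - pois t m' m) \<and>
     (\<forall>i. \<forall>k\<in>unfrozen t. pois t (frag_of i) (p_star t (frag_of k))
                          = (if i = k then - (1 / of_int (mult t k)) else 0))"

text \<open>The linear isomorphism \<open>M\<degree>(\<mu>_k t) \<rightarrow> M\<degree>(t)\<close> along which the Poisson form is transported.\<close>

definition transport_M :: "'i::finite seed \<Rightarrow> 'i \<Rightarrow> 'i lattice \<Rightarrow> 'i lattice" where
  "transport_M t k = frag_extend (\<lambda>i. if i = k
     then - frag_of k + (\<Sum>j\<in>UNIV. frag_cmul (max (- bmat t j k) 0) (frag_of j))
     else frag_of i)"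

definition mutate :: "'i::finite \<Rightarrow> 'i seed \<Rightarrow> 'i seed" where
  "mutate k t = t\<lparr>
     bmat := (\<lambda>i j. if i = k \<or> j = k then - bmat t i j
                    else bmat t i j + bmat t i k * max (bmat t k j) 0
                                    + max (- bmat t i k) 0 * bmat t k j),
     pois := (\<lambda>m m'. pois t (transport_M t k m) (transport_M t k m'))\<rparr>"

text \<open>The list \<open>[k_1, \<dots>, k_l]\<close> encodes the mutation sequence \<open>\<mu>_{k_l} \<cdots> \<mu>_{k_1}\<close>.\<close>

definition mutates :: "'i::finite list \<Rightarrow> 'i seed \<Rightarrow> 'i seed" where
  "mutates ks t = fold mutate ks t"

section \<open>Base ring\<close>

text \<open>
  The base ring is a type \<open>'k\<close> together with a function \<open>v\<close>, where \<open>v q\<close> denotes the power \<open>v^q\<close>.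
  In the classical case \<open>'k\<close> is the ring of integers; in the quantum case it is \<open>\<int>[v^{\<plusminus>1/d'}]\<close>,
  that is, the group ring \<open>int \<Rightarrow>\<^sub>0 int\<close> with \<open>v^{a/d'}\<close> corresponding to the group element \<open>a\<close>.
  The values of \<open>v\<close> outside \<open>(1/d')\<int>\<close> are irrelevant.
\<close>

definition classical_case :: "(rat \<Rightarrow> 'k::idom) \<Rightarrow> 'i::finite seed \<Rightarrow> bool" where
  "classical_case v t \<longleftrightarrow>
     bij (of_int :: int \<Rightarrow> 'k) \<and> (\<forall>q. v q = 1) \<and> (\<forall>m m'. pois t m m' = 0)"

definition quantum_base :: "int \<Rightarrow> (rat \<Rightarrow> 'k::idom) \<Rightarrow> bool" where
  "quantum_base d' v \<longleftrightarrow>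
     (\<exists>h :: (int \<Rightarrow>\<^sub>0 int) \<Rightarrow> 'k. bij h \<and> h 1 = 1 \<and>
        (\<forall>x y. h (x + y) = h x + h y) \<and> (\<forall>x y. h (x * y) = h x * h y) \<and>
        (\<forall>a. h (Poly_Mapping.single a 1) = v (of_int a / of_int d')))"

text \<open>
  ``Sufficiently divisible'': all exponents of \<open>v\<close> that occur lie in \<open>(1/d')\<int>\<close>. As transport of the
  Poisson form is integral, it is enough to ask this at the seed \<open>t\<close>.
\<close>

definition quantum_case :: "int \<Rightarrow> (rat \<Rightarrow> 'k::idom) \<Rightarrow> 'i::finite seed \<Rightarrow> bool" where
  "quantum_case d' v t \<longleftrightarrow>
     d' > 0 \<and> (\<forall>i. mult t i dvd d') \<and> (\<forall>m m'. of_int d' * pois t m m' \<in> \<int>) \<and>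
     quantum_base d' v \<and> compatible_poisson t"

section \<open>Quantum tori and their skew-fields of fractions\<close>

text \<open>
  Both \<open>LP^A(t)\<close> and \<open>LP^X(t)\<close> have the underlying \<open>'k\<close>-module below, the monomial with exponent
  \<open>m\<close> being \<open>Poly_Mapping.single m 1\<close>. The type class multiplication is the commutative product;
  the product \<open>*\<close> of the paper is \<open>A_mult\<close> and \<open>X_mult\<close>.
\<close>

type_synonym ('i, 'k) LP = "'i lattice \<Rightarrow>\<^sub>0 'k"

definition twisted_mult ::
  "(rat \<Rightarrow> 'k::idom) \<Rightarrow> ('i lattice \<Rightarrow> 'i lattice \<Rightarrow> rat)
     \<Rightarrow> ('i::finite, 'k) LP \<Rightarrow> ('i, 'k) LP \<Rightarrow> ('i, 'k) LP" where
  "twisted_mult v form a b = (\<Sum>m\<in>Poly_Mapping.keys a. \<Sum>n\<in>Poly_Mapping.keys b.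
     Poly_Mapping.single (m + n)
       (v (form m n) * Poly_Mapping.lookup a m * Poly_Mapping.lookup b n))"

definition A_mult ::
  "(rat \<Rightarrow> 'k::idom) \<Rightarrow> 'i::finite seed \<Rightarrow> ('i, 'k) LP \<Rightarrow> ('i, 'k) LP \<Rightarrow> ('i, 'k) LP" where
  "A_mult v t = twisted_mult v (pois t)"

definition X_mult ::
  "(rat \<Rightarrow> 'k::idom) \<Rightarrow> 'i::finite seed \<Rightarrow> ('i, 'k) LP \<Rightarrow> ('i, 'k) LP \<Rightarrow> ('i, 'k) LP" where
  "X_mult v t = twisted_mult v (\<lambda>n n'. - omega t n n')"

definition skew_field_of_fractions ::
  "(('i::finite, 'k::idom) LP \<Rightarrow> ('i, 'k) LP \<Rightarrow> ('i, 'k) LP)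
     \<Rightarrow> (('i, 'k) LP \<Rightarrow> 'f::division_ring) \<Rightarrow> bool" where
  "skew_field_of_fractions mul \<iota> \<longleftrightarrow>
     inj \<iota> \<and> \<iota> 1 = 1 \<and> (\<forall>a b. \<iota> (a + b) = \<iota> a + \<iota> b) \<and> (\<forall>a b. \<iota> (mul a b) = \<iota> a * \<iota> b) \<and>
     (\<forall>x. \<exists>a b. b \<noteq> 0 \<and> x = \<iota> a * inverse (\<iota> b))"

section \<open>Mutation isomorphisms\<close>

text \<open>
  Symmetric quantum numbers. The argument \<open>q\<close> is the function \<open>n \<mapsto> q^n\<close>. The sum is the quotient
  \<open>(q^a - q^{-a}) / (q - q^{-1})\<close>, written so that it also makes sense for \<open>q = 1\<close>, where the
  binomial below becomes the ordinary one.
\<close>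

definition q_int :: "(int \<Rightarrow> 'k::idom) \<Rightarrow> nat \<Rightarrow> 'k" where
  "q_int q a = (\<Sum>r<a. q (int a - 1 - 2 * int r))"

definition q_fact :: "(int \<Rightarrow> 'k::idom) \<Rightarrow> nat \<Rightarrow> 'k" where
  "q_fact q a = (\<Prod>r=1..a. q_int q r)"

definition q_binom :: "(int \<Rightarrow> 'k::idom) \<Rightarrow> nat \<Rightarrow> nat \<Rightarrow> 'k" where
  "q_binom q a s = (THE c. c * (q_fact q s * q_fact q (a - s)) = q_fact q a)"

definition v_sub :: "(rat \<Rightarrow> 'k::idom) \<Rightarrow> 'i::finite seed \<Rightarrow> 'i \<Rightarrow> int \<Rightarrow> 'k" where
  "v_sub v t k n = v (of_int n / of_int (mult t k))"

definition algebra_iso ::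
  "(('i::finite, 'k::idom) LP \<Rightarrow> 'f::division_ring) \<Rightarrow> (('i, 'k) LP \<Rightarrow> 'f) \<Rightarrow> ('f \<Rightarrow> 'f) \<Rightarrow> bool"
where
  "algebra_iso \<iota>' \<iota> h \<longleftrightarrow>
     bij h \<and> (\<forall>x y. h (x + y) = h x + h y) \<and> (\<forall>x y. h (x * y) = h x * h y) \<and>
     (\<forall>c. h (\<iota>' (Poly_Mapping.single 0 c)) = \<iota> (Poly_Mapping.single 0 c))"

text \<open>
  \<open>is_A_mutation t k \<iota>' \<iota> h\<close> and \<open>is_X_mutation v t k \<iota>' \<iota> h\<close> say that \<open>h\<close> is the isomorphism
  \<open>\<mu>_k^*\<close> from the fractions of \<open>\<mu>_k t\<close> (embedding \<open>\<iota>'\<close>) to those of \<open>t\<close> (embedding \<open>\<iota>\<close>). As the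
  variables generate the skew-field, there is at most one such \<open>h\<close>.
\<close>

definition is_A_mutation ::
  "'i::finite seed \<Rightarrow> 'i \<Rightarrow> (('i, 'k::idom) LP \<Rightarrow> 'f::division_ring)
     \<Rightarrow> (('i, 'k) LP \<Rightarrow> 'f) \<Rightarrow> ('f \<Rightarrow> 'f) \<Rightarrow> bool" where
  "is_A_mutation t k \<iota>' \<iota> h \<longleftrightarrow> algebra_iso \<iota>' \<iota> h \<and>
     (\<forall>i. i \<noteq> k \<longrightarrow> h (\<iota>' (Poly_Mapping.single (frag_of i) 1))
                        = \<iota> (Poly_Mapping.single (frag_of i) 1)) \<and>
     h (\<iota>' (Poly_Mapping.single (frag_of k) 1)) =
       \<iota> (Poly_Mapping.single
            (- frag_of k + (\<Sum>j\<in>UNIV. frag_cmul (max (- bmat t j k) 0) (frag_of j))) 1)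
       + \<iota> (Poly_Mapping.single
            (- frag_of k + (\<Sum>j\<in>UNIV. frag_cmul (max (bmat t j k) 0) (frag_of j))) 1)"

definition is_X_mutation ::
  "(rat \<Rightarrow> 'k::idom) \<Rightarrow> 'i::finite seed \<Rightarrow> 'i \<Rightarrow> (('i, 'k) LP \<Rightarrow> 'f::division_ring)
     \<Rightarrow> (('i, 'k) LP \<Rightarrow> 'f) \<Rightarrow> ('f \<Rightarrow> 'f) \<Rightarrow> bool" where
  "is_X_mutation v t k \<iota>' \<iota> h \<longleftrightarrow> algebra_iso \<iota>' \<iota> h \<and>
     h (\<iota>' (Poly_Mapping.single (frag_of k) 1))
       = inverse (\<iota> (Poly_Mapping.single (frag_of k) 1)) \<and>
     (\<forall>i. i \<noteq> k \<longrightarrow> bmat t k i \<le> 0 \<longrightarrow>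
        h (\<iota>' (Poly_Mapping.single (frag_of i) 1)) =
          (\<Sum>s = 0..nat (- bmat t k i).
             \<iota> (Poly_Mapping.single (frag_of i + frag_cmul (int s) (frag_of k))
                  (q_binom (v_sub v t k) (nat (- bmat t k i)) s)))) \<and>
     (\<forall>i. i \<noteq> k \<longrightarrow> bmat t k i > 0 \<longrightarrow>
        h (\<iota>' (Poly_Mapping.single (frag_of i) 1)) =
          inverse (\<Sum>s = 0..nat (bmat t k i).
             \<iota> (Poly_Mapping.single (- frag_of i + frag_cmul (int s - bmat t k i) (frag_of k))
                  (q_binom (v_sub v t k) (nat (bmat t k i)) s))))"

text \<open>
  A realization chooses, for every seed \<open>s\<close> in the mutation class of \<open>t\<close>, the skew-field of fractions
  of \<open>LP(s)\<close> (embedding \<open>\<iota> s\<close>) and, for unfrozen \<open>k\<close>, the mutation isomorphism \<open>\<mu>_k^*\<close> from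
  the fractions of \<open>\<mu>_k s\<close> to those of \<open>s\<close> (the map \<open>mu s k\<close>). Such data are unique up to unique
  isomorphism. Since all these skew-fields are isomorphic, they may share the carrier \<open>'f\<close>; they
  are distinguished by the embeddings.
\<close>

definition A_realization ::
  "(rat \<Rightarrow> 'k::idom) \<Rightarrow> 'i::finite seed \<Rightarrow> ('i seed \<Rightarrow> ('i, 'k) LP \<Rightarrow> 'f::division_ring)
     \<Rightarrow> ('i seed \<Rightarrow> 'i \<Rightarrow> 'f \<Rightarrow> 'f) \<Rightarrow> bool" where
  "A_realization v t \<iota> mu \<longleftrightarrow> (\<forall>ks s. set ks \<subseteq> unfrozen t \<and> s = mutates ks t \<longrightarrow>
     skew_field_of_fractions (A_mult v s) (\<iota> s) \<and>
     (\<forall>k\<in>unfrozen t. is_A_mutation s k (\<iota> (mutate k s)) (\<iota> s) (mu s k)))"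

definition X_realization ::
  "(rat \<Rightarrow> 'k::idom) \<Rightarrow> 'i::finite seed \<Rightarrow> ('i seed \<Rightarrow> ('i, 'k) LP \<Rightarrow> 'f::division_ring)
     \<Rightarrow> ('i seed \<Rightarrow> 'i \<Rightarrow> 'f \<Rightarrow> 'f) \<Rightarrow> bool" where
  "X_realization v t \<iota> mu \<longleftrightarrow> (\<forall>ks s. set ks \<subseteq> unfrozen t \<and> s = mutates ks t \<longrightarrow>
     skew_field_of_fractions (X_mult v s) (\<iota> s) \<and>
     (\<forall>k\<in>unfrozen t. is_X_mutation v s k (\<iota> (mutate k s)) (\<iota> s) (mu s k)))"

primrec mu_star ::
  "('i::finite seed \<Rightarrow> 'i \<Rightarrow> 'f \<Rightarrow> 'f) \<Rightarrow> 'i list \<Rightarrow> 'i seed \<Rightarrow> 'f \<Rightarrow> 'f" where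
  "mu_star mu [] t = id"
| "mu_star mu (k # ks) t = mu t k \<circ> mu_star mu ks (mutate k t)"

definition upper_cluster_algebra ::
  "('i::finite seed \<Rightarrow> ('i, 'k::idom) LP \<Rightarrow> 'f::division_ring)
     \<Rightarrow> ('i seed \<Rightarrow> 'i \<Rightarrow> 'f \<Rightarrow> 'f) \<Rightarrow> 'i seed \<Rightarrow> 'f set" where
  "upper_cluster_algebra \<iota> mu t =
     (\<Inter>ks \<in> {ks. set ks \<subseteq> unfrozen t}. mu_star mu ks t ` range (\<iota> (mutates ks t)))"

section \<open>Injective-reachability and similarity\<close>

definition pointed_poly :: "'i::finite seed \<Rightarrow> ('i, 'k::idom) LP \<Rightarrow> bool" where
  "pointed_poly t P \<longleftrightarrow>
     (\<forall>n\<in>Poly_Mapping.keys P.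
        (\<forall>i. Poly_Mapping.lookup n i \<ge> 0) \<and> (\<forall>i. i \<notin> unfrozen t \<longrightarrow> Poly_Mapping.lookup n i = 0)) \<and>
     Poly_Mapping.lookup P 0 = 1"

text \<open>
  \<open>x = X^n * P * Q^{-1}\<close> with \<open>P\<close>, \<open>Q\<close> polynomials in the unfrozen variables with constant term \<open>1\<close>;
  such an \<open>n\<close> is unique when it exists.
\<close>

definition has_X_degree ::
  "'i::finite seed \<Rightarrow> (('i, 'k::idom) LP \<Rightarrow> 'f::division_ring) \<Rightarrow> 'f \<Rightarrow> 'i lattice \<Rightarrow> bool" where
  "has_X_degree t \<iota> x n \<longleftrightarrow> (\<exists>P Q. pointed_poly t P \<and> pointed_poly t Q \<and>
     x = \<iota> (Poly_Mapping.single n 1) * \<iota> P * inverse (\<iota> Q))"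

text \<open>The seed \<open>t\<close> is injective-reachable, with \<open>t[1] = mutates ks t\<close> and permutation \<open>\<sigma>\<close>.\<close>

definition injective_reachable_via ::
  "('i::finite seed \<Rightarrow> ('i, 'k::idom) LP \<Rightarrow> 'f::division_ring) \<Rightarrow> ('i seed \<Rightarrow> 'i \<Rightarrow> 'f \<Rightarrow> 'f)
     \<Rightarrow> 'i seed \<Rightarrow> 'i list \<Rightarrow> ('i \<Rightarrow> 'i) \<Rightarrow> bool" where
  "injective_reachable_via \<iota> mu t ks \<sigma> \<longleftrightarrow>
     set ks \<subseteq> unfrozen t \<and> \<sigma> permutes unfrozen t \<and>
     (\<forall>k\<in>unfrozen t. has_X_degree t (\<iota> t)
        (mu_star mu ks t (\<iota> (mutates ks t) (Poly_Mapping.single (frag_of (\<sigma> k)) 1)))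
        (- frag_of k))"

definition similar_seeds :: "('i \<Rightarrow> 'i) \<Rightarrow> 'i::finite seed \<Rightarrow> 'i seed \<Rightarrow> bool" where
  "similar_seeds \<sigma> t t' \<longleftrightarrow>
     (\<forall>i\<in>unfrozen t. \<forall>j\<in>unfrozen t. bmat t i j = bmat t' (\<sigma> i) (\<sigma> j)) \<and>
     (\<forall>i\<in>unfrozen t. mult t i = mult t' (\<sigma> i))"

section \<open>Variation maps and twist automorphisms\<close>

definition linear_M_variation ::
  "'i::finite seed \<Rightarrow> 'i seed \<Rightarrow> ('i \<Rightarrow> 'i) \<Rightarrow> ('i lattice \<Rightarrow> 'i lattice) \<Rightarrow> bool" where
  "linear_M_variation t t' \<sigma> f \<longleftrightarrow>
     (\<forall>m m'. f (m + m') = f m + f m') \<and>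
     (\<forall>k\<in>unfrozen t. f (frag_of k) - frag_of (\<sigma> k) \<in> frozen_sublattice t') \<and>
     (\<forall>j. j \<notin> unfrozen t \<longrightarrow> f (frag_of j) \<in> frozen_sublattice t') \<and>
     (\<forall>k\<in>unfrozen t. f (p_star t (frag_of k)) = p_star t' (frag_of (\<sigma> k)))"

definition linear_N_variation ::
  "'i::finite seed \<Rightarrow> 'i seed \<Rightarrow> ('i \<Rightarrow> 'i) \<Rightarrow> ('i lattice \<Rightarrow> 'i lattice) \<Rightarrow> bool" where
  "linear_N_variation t t' \<sigma> f \<longleftrightarrow>
     (\<forall>n n'. f (n + n') = f n + f n') \<and>
     (\<forall>k\<in>unfrozen t. f (frag_of k) = frag_of (\<sigma> k)) \<and>
     (\<forall>i. \<forall>k\<in>unfrozen t. omega t' (f (frag_of i)) (f (frag_of k)) = omega t (frag_of i) (frag_of k))"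

text \<open>The \<open>'k\<close>-linear map sending the monomial with exponent \<open>m\<close> to the one with exponent \<open>f m\<close>.\<close>

definition monomial_map ::
  "('i lattice \<Rightarrow> 'i lattice) \<Rightarrow> ('i::finite, 'k::idom) LP \<Rightarrow> ('i, 'k) LP" where
  "monomial_map f a =
     (\<Sum>m\<in>Poly_Mapping.keys a. Poly_Mapping.single (f m) (Poly_Mapping.lookup a m))"

definition A_variation ::
  "(rat \<Rightarrow> 'k::idom) \<Rightarrow> 'i::finite seed \<Rightarrow> 'i seed \<Rightarrow> ('i \<Rightarrow> 'i)
     \<Rightarrow> (('i, 'k) LP \<Rightarrow> ('i, 'k) LP) \<Rightarrow> bool" where
  "A_variation v t t' \<sigma> V \<longleftrightarrow>
     (\<exists>f. linear_M_variation t t' \<sigma> f \<and> V = monomial_map f) \<and>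
     (\<forall>a b. V (A_mult v t a b) = A_mult v t' (V a) (V b))"

definition X_variation ::
  "(rat \<Rightarrow> 'k::idom) \<Rightarrow> 'i::finite seed \<Rightarrow> 'i seed \<Rightarrow> ('i \<Rightarrow> 'i)
     \<Rightarrow> (('i, 'k) LP \<Rightarrow> ('i, 'k) LP) \<Rightarrow> bool" where
  "X_variation v t t' \<sigma> V \<longleftrightarrow>
     (\<exists>f. linear_N_variation t t' \<sigma> f \<and> V = monomial_map f) \<and>
     (\<forall>a b. V (X_mult v t a b) = X_mult v t' (V a) (V b))"

definition algebra_automorphism_on ::
  "(('i::finite, 'k::idom) LP \<Rightarrow> 'f::division_ring) \<Rightarrow> 'f set \<Rightarrow> ('f \<Rightarrow> 'f) \<Rightarrow> bool" where
  "algebra_automorphism_on \<iota> U h \<longleftrightarrow>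
     bij_betw h U U \<and>
     (\<forall>x\<in>U. \<forall>y\<in>U. h (x + y) = h x + h y) \<and> (\<forall>x\<in>U. \<forall>y\<in>U. h (x * y) = h x * h y) \<and>
     (\<forall>c. h (\<iota> (Poly_Mapping.single 0 c)) = \<iota> (Poly_Mapping.single 0 c))"

text \<open>
  Twist automorphisms passing through \<open>mutates ks t\<close>. A twist is the composite of the variation
  map and \<open>\<mu>^*\<close> on (the image of) \<open>LP(t)\<close>, which contains the upper cluster algebra, and it restricts
  to an algebra automorphism of the latter. It is of Donaldson--Thomas type when
  \<open>mutates ks t = t[1]\<close>, that is, under \<open>injective_reachable_via\<close> for the same \<open>ks\<close> and \<open>\<sigma>\<close>.
\<close>

definition A_twist_automorphism ::
  "(rat \<Rightarrow> 'k::idom) \<Rightarrow> ('i::finite seed \<Rightarrow> ('i, 'k) LP \<Rightarrow> 'f::division_ring)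
     \<Rightarrow> ('i seed \<Rightarrow> 'i \<Rightarrow> 'f \<Rightarrow> 'f) \<Rightarrow> 'i seed \<Rightarrow> 'i list \<Rightarrow> ('i \<Rightarrow> 'i) \<Rightarrow> ('f \<Rightarrow> 'f) \<Rightarrow> bool" where
  "A_twist_automorphism v \<iota> mu t ks \<sigma> tw \<longleftrightarrow>
     (\<exists>V. A_variation v t (mutates ks t) \<sigma> V \<and> bij V \<and>
          (\<forall>a. tw (\<iota> t a) = mu_star mu ks t (\<iota> (mutates ks t) (V a)))) \<and>
     algebra_automorphism_on (\<iota> t) (upper_cluster_algebra \<iota> mu t) tw"

definition X_twist_automorphism ::
  "(rat \<Rightarrow> 'k::idom) \<Rightarrow> ('i::finite seed \<Rightarrow> ('i, 'k) LP \<Rightarrow> 'f::division_ring)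
     \<Rightarrow> ('i seed \<Rightarrow> 'i \<Rightarrow> 'f \<Rightarrow> 'f) \<Rightarrow> 'i seed \<Rightarrow> 'i list \<Rightarrow> ('i \<Rightarrow> 'i) \<Rightarrow> ('f \<Rightarrow> 'f) \<Rightarrow> bool" where
  "X_twist_automorphism v \<iota> mu t ks \<sigma> tw \<longleftrightarrow>
     (\<exists>V. X_variation v t (mutates ks t) \<sigma> V \<and> bij V \<and>
          (\<forall>a. tw (\<iota> t a) = mu_star mu ks t (\<iota> (mutates ks t) (V a)))) \<and>
     algebra_automorphism_on (\<iota> t) (upper_cluster_algebra \<iota> mu t) tw"

text \<open>The map \<open>p^* : LP^X(t) \<rightarrow> LP^A(t)\<close>, on the images of these algebras in the skew-fields.\<close>

definition p_star_alg ::
  "'i::finite seed \<Rightarrow> (('i, 'k::idom) LP \<Rightarrow> 'x::division_ring)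
     \<Rightarrow> (('i, 'k) LP \<Rightarrow> 'a::division_ring) \<Rightarrow> 'x \<Rightarrow> 'a" where
  "p_star_alg t \<iota>X \<iota>A x = \<iota>A (monomial_map (p_star t) (the_inv \<iota>X x))"

end

theory Submission
  imports Defs "HOL-Computational_Algebra.Polynomial"
begin

text \<open>
  Fix a total order on \<open>N(t)\<close> in which all \<open>e_i\<close> are positive. Lowest terms define a valuation on the
  skew-field of fractions of \<open>LP\<^sup>X(t)\<close>, and at each step of \<open>\<mu>\<^sup>*\<close> the lowest term of \<open>\<mu>_k\<^sup>* X'^n\<close> is
  given by one of the two linear tropical mutations, the sign being that of the degree of \<open>X_k\<close>.
  Composing these yields an isomorphism \<open>\<psi> : N(t') \<rightarrow> N(t)\<close> preserving \<open>\<omega>\<close>, with contragredient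
  \<open>\<phi> : M\<degree>(t') \<rightarrow> M\<degree>(t)\<close> preserving \<open>\<lambda>\<close> and intertwining \<open>p\<^sup>*\<close>. The degree of \<open>\<mu>\<^sup>* X'_{\<sigma> k}\<close> gives
  \<open>\<psi> e'_{\<sigma> k} = - e_k\<close>, so \<open>- \<psi>\<^sup>-\<^sup>1\<close> and \<open>- \<phi>\<^sup>-\<^sup>1\<close> are invertible variation maps.

  Such maps extend to the skew-fields and commute with mutations at \<open>k\<close> and \<open>\<sigma> k\<close>, because on
  arbitrary monomials both cluster mutations are given by one formula that involves only the forms
  and a linear functional. Together with the involutivity of mutations this shows that the twists
  preserve the upper cluster algebras.
\<close>

text \<open>Reading the map off the mutations avoids this, as each tropical step is an involution of
  the lattice. The sign in \<open>- \<psi>\<^sup>-\<^sup>1\<close> turns -e_k into e_k and is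
  invisible to the bilinear forms \<omega> and \<lambda>.

  In the quantum case compatibility fixes \<lambda>(m, p^* n) only for n in the span of the unfrozen
  e_k, so p^* is not an algebra map in general; it need not be injective either, so it does not
  extend to the skew-fields. The identity is therefore proved one mutation at a time, on elements
  that are Laurent at every seed passed, which is what membership in the upper cluster algebra
  provides.\<close>

abbreviation "keys \<equiv> Poly_Mapping.keys"
abbreviation "single \<equiv> Poly_Mapping.single"
abbreviation "lookup \<equiv> Poly_Mapping.lookup"

section \<open>Symmetric quantum binomials\<close>

text \<open>\<open>q n\<close> plays the role of the n-th power of a unit. Nonvanishing of
  \<open>q_int\<close> makes the q-factorials cancellable, so that the division in
  \<open>q_binom\<close> has at most one result; the last condition keeps sums of q-binomials
  nonzero when all monomials of such a sum coincide.\<close>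

locale quantum_parameter =
  fixes q :: "int \<Rightarrow> 'k::idom"
  assumes q_zero [simp]: "q 0 = 1"
    and q_add: "q (a + b) = q a * q b"
    and q_int_nonzero: "n > 0 \<Longrightarrow> q_int q n \<noteq> 0"
    and one_plus_q_nonzero: "1 + q a \<noteq> 0"
begin

lemma q_nonzero: "q a \<noteq> 0"
  using q_add[of a "- a"] by auto

text \<open>The progression of exponents is cut after its first c terms: these sum to q^a [c], the
  remaining ones to q^(-c) [a].\<close>

lemma q_int_add: "q_int q (a + c) = q (- int c) * q_int q a + q (int a) * q_int q c"
proof -
  have "q_int q (a + c) = (\<Sum>r<c. q (int (a + c) - 1 - 2 * int r)) +
      (\<Sum>r<a. q (int (a + c) - 1 - 2 * int (r + c)))"
    unfolding q_int_def
    using sum.atLeastLessThan_concat[of 0 c "a + c" "\<lambda>r. q (int (a + c) - 1 - 2 * int r)"]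
      sum.shift_bounds_nat_ivl[of "\<lambda>r. q (int (a + c) - 1 - 2 * int r)" 0 c a]
    by (simp add: lessThan_atLeast0)
  also have "(\<Sum>r<c. q (int (a + c) - 1 - 2 * int r)) = q (int a) * q_int q c"
    unfolding q_int_def sum_distrib_left
    by (intro sum.cong refl) (simp add: q_add [symmetric] algebra_simps)
  also have "(\<Sum>r<a. q (int (a + c) - 1 - 2 * int (r + c))) = q (- int c) * q_int q a"
    unfolding q_int_def sum_distrib_left
    by (intro sum.cong refl) (simp add: q_add [symmetric] algebra_simps)
  finally show ?thesis by (simp add: add.commute)
qed

lemma q_fact_nonzero: "q_fact q a \<noteq> 0"
  unfolding q_fact_def by (auto simp: q_int_nonzero)

lemma q_fact_Suc: "q_fact q (Suc a) = q_fact q a * q_int q (Suc a)"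
  by (simp add: q_fact_def)

text \<open>The \<open>q\<close>-Vandermonde identity expresses a factorization of \<open>gauss_poly (b + b')\<close>.\<close>

definition gauss_poly :: "nat \<Rightarrow> 'k poly" where
  "gauss_poly b = (\<Prod>j<b. [:1, q (2 * int j + 1 - int b):])"

definition scale_arg :: "int \<Rightarrow> 'k poly \<Rightarrow> 'k poly" where
  "scale_arg a p = pcompose p [:0, q a:]"

lemma coeff_scale_arg: "coeff (scale_arg a p) r = q a ^ r * coeff p r"
proof (induction p arbitrary: r)
  case 0
  then show ?case by (simp add: scale_arg_def)
next
  case (pCons c p)
  then show ?case
    by (cases r) (auto simp: scale_arg_def pcompose_pCons coeff_pCons mult_ac)
qed

lemma q_power: "q a ^ r = q (a * int r)"
  by (induction r) (simp_all add: q_add [symmetric] algebra_simps)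

lemma scale_arg_gauss_poly:
  "scale_arg a (gauss_poly b) = (\<Prod>j<b. [:1, q (a + 2 * int j + 1 - int b):])"
  by (simp add: scale_arg_def gauss_poly_def pcompose_prod pcompose_pCons q_add [symmetric]
      algebra_simps)

text \<open>The exponents in \<open>gauss_poly (b + b')\<close> form a progression of step 2 centred
  at 0. Its first b terms are the progression for b shifted by -b', its last b' terms the one for b'
  shifted by b.\<close>

lemma gauss_poly_add:
  "gauss_poly (b + b') = scale_arg (- int b') (gauss_poly b) * scale_arg (int b) (gauss_poly b')"
proof -
  let ?f = "\<lambda>j. [:1, q (2 * int j + 1 - int (b + b')):]"
  have "gauss_poly (b + b') = (\<Prod>j<b. ?f j) * (\<Prod>j<b'. ?f (j + b))"
    unfolding gauss_poly_def
    using prod.atLeastLessThan_concat[of 0 b "b + b'" ?f]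
      prod.shift_bounds_nat_ivl[of ?f 0 b b']
    by (simp add: lessThan_atLeast0 add.commute)
  then show ?thesis
    by (simp add: scale_arg_gauss_poly algebra_simps)
qed

text \<open>The q-Pascal rule, obtained by splitting off the last linear factor.\<close>

lemma coeff_gauss_poly_Suc:
  "coeff (gauss_poly (Suc b)) r =
     q (- int r) * coeff (gauss_poly b) r +
     (if r = 0 then 0 else q (int b + 1 - int r) * coeff (gauss_poly b) (r - 1))"
proof -
  have "gauss_poly (Suc b) = scale_arg (- 1) (gauss_poly b) * [:1, q (int b):]"
    using gauss_poly_add[of b 1] by (simp add: scale_arg_gauss_poly)
  moreover have "coeff (p * [:1, c:]) r = coeff p r + (if r = 0 then 0 else c * coeff p (r - 1))"
    for p :: "'k poly" and c
    by (cases r) (simp_all add: mult.commute[of p])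
  ultimately show ?thesis
    by (cases r) (simp_all add: coeff_scale_arg q_power mult.assoc [symmetric] q_add [symmetric]
        algebra_simps)
qed

lemma degree_gauss_poly_le: "degree (gauss_poly b) \<le> b"
proof -
  have "degree (gauss_poly b) \<le> (\<Sum>j<b. 1)"
    unfolding gauss_poly_def
    by (rule order_trans[OF degree_prod_sum_le]) (simp_all add: sum_mono del: sum_constant)
  then show ?thesis by simp
qed

text \<open>The q-binomial theorem without division: by the q-Pascal rule and
  \<open>q_int_add\<close>, the coefficients satisfy the equation that defines
  \<open>q_binom\<close>.\<close>

lemma coeff_gauss_poly_fact:
  "s \<le> b \<Longrightarrow> coeff (gauss_poly b) s * (q_fact q s * q_fact q (b - s)) = q_fact q b"
proof (induction b arbitrary: s)
  case 0
  then show ?case by (simp add: gauss_poly_def q_fact_def)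
next
  case (Suc b)
  let ?G = "\<lambda>b s. coeff (gauss_poly b) s"
  \<comment> \<open>This includes s = b + 1: the coefficient vanishes beyond the degree, and the
    quantum integer of 0 is 0.\<close>
  have A: "?G b s * (q_fact q s * q_fact q (Suc b - s)) = q_fact q b * q_int q (Suc b - s)"
  proof (cases "s \<le> b")
    case True
    then have "?G b s * (q_fact q s * q_fact q (Suc b - s)) =
        ?G b s * (q_fact q s * q_fact q (b - s)) * q_int q (Suc b - s)"
      by (simp add: Suc_diff_le q_fact_Suc mult.assoc)
    then show ?thesis using Suc.IH[OF True] by simp
  next
    case False
    then have "s = Suc b" using Suc.prems by simp
    then show ?thesis
      using degree_gauss_poly_le[of b] by (simp add: coeff_eq_0 q_int_def)
  qed
  show ?case
  proof (cases s)
    case 0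
    then show ?thesis using A by (simp add: coeff_gauss_poly_Suc q_fact_Suc)
  next
    case (Suc s')
    have B: "?G b s' * (q_fact q s * q_fact q (Suc b - s)) = q_fact q b * q_int q s"
      using Suc.IH[of s'] Suc Suc.prems
      by (simp add: q_fact_Suc)
    have "q_int q (Suc b) = q (- int s) * q_int q (Suc b - s) + q (int b + 1 - int s) * q_int q s"
      using q_int_add[of "Suc b - s" s] Suc.prems by (simp add: of_nat_diff algebra_simps)
    moreover have "?G (Suc b) s * (q_fact q s * q_fact q (Suc b - s)) =
        q (- int s) * (?G b s * (q_fact q s * q_fact q (Suc b - s))) +
        q (int b + 1 - int s) * (?G b s' * (q_fact q s * q_fact q (Suc b - s)))"
      using Suc by (simp add: coeff_gauss_poly_Suc algebra_simps)
    ultimately show ?thesis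
      unfolding A B by (simp add: q_fact_Suc algebra_simps)
  qed
qed

lemma q_binom_eq_coeff:
  assumes "s \<le> b"
  shows "q_binom q b s = coeff (gauss_poly b) s"
  unfolding q_binom_def
proof (rule the_equality)
  fix c assume "c * (q_fact q s * q_fact q (b - s)) = q_fact q b"
  then show "c = coeff (gauss_poly b) s"
    using coeff_gauss_poly_fact[OF assms] q_fact_nonzero by (metis mult_cancel_right mult_eq_0_iff)
qed (rule coeff_gauss_poly_fact[OF assms])

lemma q_binom_0 [simp]: "q_binom q b 0 = 1"
  by (simp add: q_binom_eq_coeff gauss_poly_def poly_0_coeff_0 [symmetric] poly_prod)

lemma q_binom_symmetric:
  assumes "s \<le> b"
  shows "q_binom q b (b - s) = q_binom q b s"
  using assms unfolding q_binom_def by (simp add: mult.commute)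

lemma q_binom_self [simp]: "q_binom q b b = 1"
  using q_binom_symmetric[of 0 b] by simp

text \<open>Comparison of coefficients in \<open>gauss_poly_add\<close>. The range of s is cut down
  because \<open>q_binom q b s\<close> carries no meaning for s > b, where b - s truncates, whereas
  the coefficients vanish there.\<close>

lemma q_Vandermonde:
  assumes "r \<le> b + b'"
  shows "q_binom q (b + b') r =
    (\<Sum>s\<in>{s. s \<le> b \<and> s \<le> r \<and> r - s \<le> b'}.
       q_binom q b s * q_binom q b' (r - s) * q (int b * int (r - s) - int b' * int s))"
proof -
  let ?g = "\<lambda>s. coeff (gauss_poly b) s * coeff (gauss_poly b') (r - s) *
      q (int b * int (r - s) - int b' * int s)"
  have "q_binom q (b + b') r = (\<Sum>s\<le>r. ?g s)"
    using assms
    by (simp add: q_binom_eq_coeff gauss_poly_add coeff_mult coeff_scale_arg q_power)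
       (intro sum.cong refl, simp add: diff_conv_add_uminus q_add mult_ac del: add_uminus_conv_diff)
  also have "\<dots> = (\<Sum>s\<in>{s. s \<le> b \<and> s \<le> r \<and> r - s \<le> b'}. ?g s)"
  proof (rule sum.mono_neutral_right)
    show "\<forall>i\<in>{..r} - {s. s \<le> b \<and> s \<le> r \<and> r - s \<le> b'}. ?g i = 0"
    proof
      fix i assume "i \<in> {..r} - {s. s \<le> b \<and> s \<le> r \<and> r - s \<le> b'}"
      then have "b < i \<or> b' < r - i" by auto
      then have "coeff (gauss_poly b) i = 0 \<or> coeff (gauss_poly b') (r - i) = 0"
        using degree_gauss_poly_le by (meson coeff_eq_0 le_less_trans)
      then show "?g i = 0" by auto
    qed
  qed auto
  also have "\<dots> = (\<Sum>s\<in>{s. s \<le> b \<and> s \<le> r \<and> r - s \<le> b'}.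
       q_binom q b s * q_binom q b' (r - s) * q (int b * int (r - s) - int b' * int s))"
    by (intro sum.cong refl) (auto simp: q_binom_eq_coeff)
  finally show ?thesis .
qed

text \<open>The sum is the value of \<open>gauss_poly\<close> at 1, a product of factors 1 + q^a. It
  is needed for the direction y = 0, which can occur on the A-side when column k of the exchange
  matrix is zero.\<close>

lemma sum_q_binom_nonzero: "(\<Sum>s\<le>b. q_binom q b s) \<noteq> 0"
proof -
  have "(\<Sum>s\<le>b. q_binom q b s) = (\<Sum>s\<le>b. coeff (gauss_poly b) s * 1 ^ s)"
    by (simp add: q_binom_eq_coeff)
  also have "\<dots> = poly (gauss_poly b) 1"
    by (simp add: poly_altdef, intro sum.mono_neutral_right)
       (use degree_gauss_poly_le[of b] in \<open>auto simp: coeff_eq_0\<close>)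
  also have "\<dots> = (\<Prod>j<b. 1 + q (2 * int j + 1 - int b))"
    by (simp add: gauss_poly_def poly_prod)
  also have "\<dots> \<noteq> 0"
    using one_plus_q_nonzero by simp
  finally show ?thesis .
qed

end

section \<open>Quantum tori inside their skew-fields of fractions\<close>

definition ring_iso :: "('f::division_ring \<Rightarrow> 'g::division_ring) \<Rightarrow> bool" where
  "ring_iso h \<longleftrightarrow>
     bij h \<and> (\<forall>x y. h (x + y) = h x + h y) \<and> (\<forall>x y. h (x * y) = h x * h y)"

lemma ring_iso_id: "ring_iso id"
  by (simp add: ring_iso_def)

lemma ring_iso_comp: "ring_iso g \<Longrightarrow> ring_iso h \<Longrightarrow> ring_iso (g \<circ> h)"
  by (auto simp: ring_iso_def intro: bij_comp)

context
  fixes h :: "'f::division_ring \<Rightarrow> 'g::division_ring"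
  assumes h: "ring_iso h"
begin

lemma ring_iso_bij: "bij h"
  and ring_iso_add: "h (x + y) = h x + h y"
  and ring_iso_mult: "h (x * y) = h x * h y"
  using h by (auto simp: ring_iso_def)

lemma ring_iso_inj: "h x = h y \<longleftrightarrow> x = y"
  using ring_iso_bij by (simp add: bij_is_inj inj_eq)

lemma ring_iso_0: "h 0 = 0"
  using ring_iso_add[of 0 0] by simp

lemma ring_iso_eq_0: "h x = 0 \<longleftrightarrow> x = 0"
  using ring_iso_inj[of x 0] ring_iso_0 by simp

lemma ring_iso_1: "h 1 = 1"
proof -
  have "h 1 * h 1 = h 1 * 1" using ring_iso_mult[of 1 1] by simp
  then show ?thesis using ring_iso_eq_0[of 1] by (simp only: mult_cancel_left) simp
qed

lemma ring_iso_sum: "h (sum f A) = (\<Sum>x\<in>A. h (f x))"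
  by (induction A rule: infinite_finite_induct) (simp_all add: ring_iso_0 ring_iso_add)

lemma ring_iso_inverse: "h (inverse x) = inverse (h x)"
proof (cases "x = 0")
  case False
  have "h (inverse x) * h x = 1"
    using False by (simp flip: ring_iso_mult add: ring_iso_1)
  then show ?thesis by (metis inverse_unique inverse_inverse_eq)
qed (simp add: ring_iso_0)

lemma ring_iso_inv: "ring_iso (inv h)"
  unfolding ring_iso_def
proof (intro conjI allI)
  have surj: "h (inv h x) = x" for x
    using ring_iso_bij by (simp add: bij_is_surj surj_f_inv_f)
  show "bij (inv h)" by (rule bij_imp_bij_inv[OF ring_iso_bij])
  fix x y
  show "inv h (x + y) = inv h x + inv h y"
    by (rule ring_iso_inj[THEN iffD1]) (simp add: ring_iso_add surj)
  show "inv h (x * y) = inv h x * inv h y"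
    by (rule ring_iso_inj[THEN iffD1]) (simp add: ring_iso_mult surj)
qed

end

lemma algebra_iso_imp_ring_iso: "algebra_iso \<iota>' \<iota> h \<Longrightarrow> ring_iso h"
  by (simp add: algebra_iso_def ring_iso_def)

lemma twisted_mult_single:
  "twisted_mult v form (single m c) (single n d) =
     single (m + n) (v (form m n) * c * d)"
  by (auto simp: twisted_mult_def)

lemma single_sum:
  "single m (sum f A) = (\<Sum>x\<in>A. single m (f x :: 'a::comm_monoid_add))"
  by (induction A rule: infinite_finite_induct) (simp_all add: single_add)

lemma poly_mapping_sum_single:
  assumes "finite A" "keys a \<subseteq> A"
  shows "(\<Sum>m\<in>A. single m (lookup a m)) = a"
proof (rule poly_mapping_eqI)
  fix k
  show "lookup (\<Sum>m\<in>A. single m (lookup a m)) k =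
      lookup a k"
    using assms by (auto simp: lookup_sum lookup_single when_def in_keys_iff)
qed

lemma twisted_mult_superset:
  assumes "finite A" "keys a \<subseteq> A" "finite B" "keys b \<subseteq> B"
  shows "twisted_mult v form a b = (\<Sum>m\<in>A. \<Sum>n\<in>B. single (m + n)
     (v (form m n) * lookup a m * lookup b n))"
proof -
  have "twisted_mult v form a b = (\<Sum>m\<in>keys a. \<Sum>n\<in>B. single (m + n)
     (v (form m n) * lookup a m * lookup b n))"
    unfolding twisted_mult_def
    by (intro sum.cong refl sum.mono_neutral_left) (use assms in \<open>auto simp: in_keys_iff\<close>)
  also have "\<dots> = (\<Sum>m\<in>A. \<Sum>n\<in>B. single (m + n)
     (v (form m n) * lookup a m * lookup b n))"
    by (intro sum.mono_neutral_left) (use assms in \<open>auto simp: in_keys_iff\<close>)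
  finally show ?thesis .
qed

lemma additive_minus:
  fixes f :: "'a::ab_group_add \<Rightarrow> 'b::ab_group_add"
  assumes "\<And>a b. f (a + b) = f a + f b"
  shows "f 0 = 0" "f (- a) = - f a" "f (a - b) = f a - f b"
proof -
  show 0: "f 0 = 0" using assms[of 0 0] by simp
  show m: "f (- a) = - f a" for a using assms[of a "- a"] 0 by (simp add: add_eq_0_iff)
  show "f (a - b) = f a - f b" using assms[of a "- b"] by (simp add: m)
qed

lemma additive_frag_cmul:
  assumes add: "\<And>a b. f (a + b) = f a + f b"
  shows "f (frag_cmul c a) = frag_cmul c (f a)"
proof -
  have nat: "f (frag_cmul (int n) a) = frag_cmul (int n) (f a)" for n
    by (induction n) (simp_all add: frag_cmul_distrib add additive_minus[of f, OF add])
  show ?thesis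
    using nat[of "nat c"] nat[of "nat (- c)"]
    by (cases "c \<ge> 0") (auto simp flip: minus_frag_cmul simp: additive_minus[of f, OF add])
qed

text \<open>Only the scalars \<open>v (form a b)\<close> enter the product, so bilinearity and
  alternation are imposed after applying \<open>v\<close>. This tolerates arbitrary values of
  \<open>v\<close> at exponents that never occur, and covers v = 1.\<close>

locale quantum_torus =
  fixes v :: "rat \<Rightarrow> 'k::idom"
    and form :: "'i::finite lattice \<Rightarrow> 'i lattice \<Rightarrow> rat"
    and \<iota> :: "('i, 'k) LP \<Rightarrow> 'f::division_ring"
  assumes v_form_add_left: "v (form (a + b) c) = v (form a c) * v (form b c)"
    and v_form_add_right: "v (form a (b + c)) = v (form a b) * v (form a c)"
    and v_form_self: "v (form a a) = 1"
    and fractions: "skew_field_of_fractions (twisted_mult v form) \<iota>"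
begin

definition Z :: "'i lattice \<Rightarrow> 'f" where
  "Z m = \<iota> (single m 1)"

definition K :: "'k \<Rightarrow> 'f" where
  "K c = \<iota> (single 0 c)"

text \<open>Polarization of the alternating condition; it makes all these scalars units.\<close>

lemma v_form_swap: "v (form a b) * v (form b a) = 1"
proof -
  have "v (form (a + b) (a + b)) = v (form a b) * v (form b a)"
    by (simp only: v_form_add_left v_form_add_right) (simp add: v_form_self)
  then show ?thesis by (simp add: v_form_self)
qed

lemma v_form_nonzero: "v (form a b) \<noteq> 0"
  using v_form_swap[of a b] by auto

lemma v_form_0 [simp]: "v (form 0 b) = 1" "v (form b 0) = 1"
  using v_form_add_left[of 0 0 b] v_form_add_right[of b 0 0] v_form_nonzero[of 0 b]
    v_form_nonzero[of b 0] by auto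

lemma v_form_minus_right: "v (form a (- b)) * v (form a b) = 1"
  using v_form_add_right[of a "- b" b] by simp

lemma v_form_minus_left: "v (form (- a) b) * v (form a b) = 1"
  using v_form_add_left[of "- a" a b] by simp

lemma v_form_minus_self [simp]: "v (form a (- a)) = 1" "v (form (- a) a) = 1"
  using v_form_minus_right[of a a] v_form_minus_left[of a a] by (simp_all add: v_form_self)

lemma inj_\<iota>: "inj \<iota>"
  and \<iota>_1: "\<iota> 1 = 1"
  and \<iota>_add: "\<iota> (a + b) = \<iota> a + \<iota> b"
  and \<iota>_mult: "\<iota> (twisted_mult v form a b) = \<iota> a * \<iota> b"
  using fractions by (auto simp: skew_field_of_fractions_def)

lemma fractionE:
  obtains a b where "b \<noteq> 0" "x = \<iota> a * inverse (\<iota> b)"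
  using fractions unfolding skew_field_of_fractions_def by blast

lemma \<iota>_0: "\<iota> 0 = 0"
  using \<iota>_add[of 0 0] by simp

lemma \<iota>_eq_iff: "\<iota> a = \<iota> b \<longleftrightarrow> a = b"
  using inj_\<iota> by (simp add: inj_eq)

lemma \<iota>_eq_0: "\<iota> a = 0 \<longleftrightarrow> a = 0"
  using \<iota>_eq_iff[of a 0] by (simp add: \<iota>_0)

lemma \<iota>_sum: "\<iota> (sum f A) = (\<Sum>x\<in>A. \<iota> (f x))"
  by (induction A rule: infinite_finite_induct) (simp_all add: \<iota>_0 \<iota>_add)

lemma \<iota>_single: "\<iota> (single m c) = K c * Z m"
  by (simp add: K_def Z_def twisted_mult_single flip: \<iota>_mult)

lemma \<iota>_expand_superset:
  assumes "finite A" "keys a \<subseteq> A"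
  shows "\<iota> a = (\<Sum>m\<in>A. K (lookup a m) * Z m)"
  by (subst poly_mapping_sum_single[OF assms, symmetric]) (simp add: \<iota>_sum \<iota>_single)

lemma \<iota>_expand: "\<iota> a = (\<Sum>m\<in>keys a. K (lookup a m) * Z m)"
  by (rule \<iota>_expand_superset) auto

lemma K_0 [simp]: "K 0 = 0"
  by (simp add: K_def \<iota>_0)

lemma K_1 [simp]: "K 1 = 1"
  by (simp add: K_def \<iota>_1)

lemma K_add: "K (c + d) = K c + K d"
  by (simp add: K_def single_add \<iota>_add)

lemma K_mult: "K (c * d) = K c * K d"
  by (simp add: K_def twisted_mult_single flip: \<iota>_mult)

lemma K_sum: "K (sum f A) = (\<Sum>x\<in>A. K (f x))"
  by (induction A rule: infinite_finite_induct) (simp_all add: K_add)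

lemma K_eq_0 [simp]: "K c = 0 \<longleftrightarrow> c = 0"
  by (simp add: K_def \<iota>_eq_0) (metis lookup_single_eq lookup_zero single_zero)

lemma Z_mult: "Z m * Z n = K (v (form m n)) * Z (m + n)"
  unfolding \<iota>_single [symmetric] by (simp add: Z_def twisted_mult_single flip: \<iota>_mult)

lemma Z_0 [simp]: "Z 0 = 1"
  using \<iota>_1 by (simp add: Z_def)

lemma Z_minus: "Z (- m) = inverse (Z m)"
proof -
  have "Z m * Z (- m) = 1" by (simp add: Z_mult)
  then show ?thesis by (metis inverse_unique)
qed

lemma Z_nonzero [simp]: "Z m \<noteq> 0"
  by (simp add: Z_def \<iota>_eq_0) (metis lookup_single_eq lookup_zero zero_neq_one)

lemma K_Z_commute: "K c * Z m = Z m * K c"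
  using twisted_mult_single[of v form 0 c m 1] twisted_mult_single[of v form m 1 0 c]
  by (simp add: K_def Z_def flip: \<iota>_mult)

text \<open>Scalars commute with monomials because the exponent 0 pairs trivially, hence with
  Laurent polynomials; conjugation by a denominator extends this to fractions.\<close>

lemma K_commute: "K c * x = x * K c"
proof -
  have *: "K c * \<iota> a = \<iota> a * K c" for a
  proof -
    have "K c * (K d * Z m) = K d * Z m * K c" for d m
    proof -
      have "K c * (K d * Z m) = K (d * c) * Z m"
        by (simp add: K_mult [symmetric] mult.assoc [symmetric] mult.commute)
      also have "\<dots> = K d * (Z m * K c)"
        by (simp add: K_mult mult.assoc K_Z_commute)
      finally show ?thesis by (simp add: mult.assoc)
    qed
    then show ?thesis
      unfolding \<iota>_expand[of a] by (simp add: sum_distrib_left sum_distrib_right)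
  qed
  obtain a b where b: "b \<noteq> 0" "x = \<iota> a * inverse (\<iota> b)" by (rule fractionE)
  have "K c * inverse (\<iota> b) = inverse (\<iota> b) * K c"
  proof -
    have "K c * inverse (\<iota> b) = inverse (\<iota> b) * (\<iota> b * K c) * inverse (\<iota> b)"
      using b(1) by (simp add: \<iota>_eq_0 flip: mult.assoc)
    also have "\<dots> = inverse (\<iota> b) * (K c * \<iota> b) * inverse (\<iota> b)"
      by (simp only: *)
    also have "\<dots> = inverse (\<iota> b) * K c"
      using b(1) by (simp add: \<iota>_eq_0 mult.assoc)
    finally show ?thesis .
  qed
  then show ?thesis
    unfolding b(2) mult.assoc [symmetric] * by (simp add: mult.assoc)
qed

lemma K_left_commute: "x * (K c * z) = K c * (x * z)"
  by (simp only: mult.assoc [symmetric] K_commute [of c x])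

lemma Z_add: "Z (m + n) = K (v (form n m)) * Z m * Z n"
proof -
  have "K (v (form n m)) * Z m * Z n = K (v (form n m) * v (form m n)) * Z (m + n)"
    by (simp add: mult.assoc Z_mult K_mult)
  then show ?thesis by (simp add: v_form_swap)
qed

lemma v_form_cmul_left: "v (form (frag_cmul (int s) a) b) = v (form a b) ^ s"
  by (induction s) (simp_all add: frag_cmul_distrib v_form_add_left)

lemma v_form_cmul_right: "v (form a (frag_cmul (int s) b)) = v (form a b) ^ s"
  by (induction s) (simp_all add: frag_cmul_distrib v_form_add_right)

end

section \<open>The generic form of a cluster mutation\<close>

text \<open>
  Both cluster mutations send \<open>Z'^m\<close> to \<open>mut_elem (\<tau> m)\<close> for a linear isomorphism \<open>\<tau>\<close>. On the
  \<open>A\<close>-side the direction \<open>y\<close> is \<open>p\<^sup>* e_k\<close> and \<open>c\<close> is the \<open>k\<close>-th coordinate; on the \<open>X\<close>-side \<open>y = e_k\<close>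
  and \<open>c n = d_k \<omega>(n, e_k)\<close>.
\<close>

locale mutation_direction = quantum_torus v form \<iota> + quantum_parameter q
  for v :: "rat \<Rightarrow> 'k::idom"
    and form :: "'i::finite lattice \<Rightarrow> 'i lattice \<Rightarrow> rat"
    and \<iota> :: "('i, 'k) LP \<Rightarrow> 'f::division_ring"
    and q :: "int \<Rightarrow> 'k" +
  fixes y :: "'i lattice" and c :: "'i lattice \<Rightarrow> int"
  assumes c_add: "c (m + n) = c m + c n"
    and c_y: "c y = 0"
    and v_form_y: "v (form m y) = q (- c m)"
begin

text \<open>The normally ordered quantum analogue of Z^m (1 + Z^y)^b.\<close>

definition binom_sum :: "'i lattice \<Rightarrow> nat \<Rightarrow> ('i, 'k) LP" where
  "binom_sum m b = (\<Sum>s\<le>b. single (m + frag_cmul (int s) y) (q_binom q b s))"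

text \<open>At v = 1 this is Z^m (1 + Z^y)^(- c m); in general it is the effect on Z^m of
  conjugation by a quantum dilogarithm in Z^y. For c m > 0 a denominator appears, and the element is
  defined as the inverse of the one at -m.\<close>

definition mut_elem :: "'i lattice \<Rightarrow> 'f" where
  "mut_elem m = (if c m \<le> 0 then \<iota> (binom_sum m (nat (- c m)))
                 else inverse (\<iota> (binom_sum (- m) (nat (c m)))))"

lemma c_0: "c 0 = 0" and c_minus: "c (- m) = - c m" and c_diff: "c (m - n) = c m - c n"
  using additive_minus[of c, OF c_add] by auto

lemma c_cmul_y: "c (frag_cmul s y) = 0"
proof -
  have "c (frag_cmul (int n) y) = 0" for n
    by (induction n) (simp_all add: c_0 c_add c_y frag_cmul_distrib)
  from this[of "nat s"] this[of "nat (- s)"] show ?thesis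
    by (cases "s \<ge> 0") (auto simp flip: minus_frag_cmul simp: c_minus)
qed

lemma v_form_y_left: "v (form y m) = q (c m)"
proof -
  have "v (form y m) * q (- c m) = q (c m) * q (- c m)"
    using v_form_swap[of y m] by (simp add: v_form_y flip: q_add)
  then show ?thesis using q_nonzero by simp
qed

text \<open>For y \<noteq> 0 the term s = 0 is the only one with exponent m, and its coefficient is
  1. For y = 0 all terms fall together and \<open>sum_q_binom_nonzero\<close> takes over.\<close>

lemma binom_sum_nonzero: "binom_sum m b \<noteq> 0"
proof
  assume 0: "binom_sum m b = 0"
  show False
  proof (cases "y = 0")
    case True
    have "binom_sum m b = single m (\<Sum>s\<le>b. q_binom q b s)"
      unfolding binom_sum_def single_sum by (simp add: True)
    then show False
      using 0 sum_q_binom_nonzero[of b] by (metis lookup_single_eq lookup_zero)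
  next
    case False
    then have "lookup (binom_sum m b) m = (\<Sum>s\<le>b. if s = 0 then 1 else 0)"
      unfolding binom_sum_def lookup_sum
      by (intro sum.cong refl) (auto simp: lookup_single when_def)
    then show False using 0 by simp
  qed
qed

lemma \<iota>_binom_sum:
  "\<iota> (binom_sum m b) = (\<Sum>s\<le>b. K (q_binom q b s) * Z (m + frag_cmul (int s) y))"
  by (simp add: binom_sum_def \<iota>_sum \<iota>_single)

text \<open>The twist between the s-th and the s'-th term is \<open>v (form m m')\<close> times q^(b
  s' - b' s), exactly the weight in \<open>q_Vandermonde\<close>.\<close>

lemma binom_sum_mult:
  assumes "c m = - int b" "c m' = - int b'"
  shows "\<iota> (binom_sum m b) * \<iota> (binom_sum m' b') = K (v (form m m')) * \<iota> (binom_sum (m + m') (b + b'))"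
proof -
  let ?G = "q_binom q"
  have w: "v (form (m + frag_cmul (int s) y) (m' + frag_cmul (int s') y)) =
      v (form m m') * q (int b * int s' - int b' * int s)" for s s'
  proof -
    have "v (form (m + frag_cmul (int s) y) (m' + frag_cmul (int s') y)) =
        v (form m m') * (q (int b * int s') * q (- (int b' * int s)))"
      using assms
      by (simp add: v_form_add_left v_form_add_right v_form_cmul_left v_form_cmul_right v_form_y
          v_form_y_left c_add c_cmul_y q_power)
    then show ?thesis by (simp flip: q_add)
  qed
  have "\<iota> (binom_sum m b) * \<iota> (binom_sum m' b') =
      (\<Sum>s\<le>b. \<Sum>s'\<le>b'. K (v (form m m') * (?G b s * ?G b' s' * q (int b * int s' - int b' * int s)))
         * Z (m + m' + frag_cmul (int (s + s')) y))" (is "_ = (\<Sum>s\<le>b. \<Sum>s'\<le>b'. ?t s s')")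
  proof -
    have "K (?G b s) * Z (m + frag_cmul (int s) y) * (K (?G b' s') * Z (m' + frag_cmul (int s') y)) =
       ?t s s'" for s s'
    proof -
      have "K (?G b s) * Z (m + frag_cmul (int s) y) * (K (?G b' s') * Z (m' + frag_cmul (int s') y)) =
         K (?G b s) * K (?G b' s') * (Z (m + frag_cmul (int s) y) * Z (m' + frag_cmul (int s') y))"
        by (simp only: mult.assoc K_left_commute[of "Z (m + frag_cmul (int s) y)"])
      also have "\<dots> = ?t s s'"
        unfolding Z_mult w K_mult [symmetric] mult.assoc [symmetric]
        by (simp add: frag_cmul_distrib add_ac mult.assoc) (simp add: mult_ac)
      finally show ?thesis .
    qed
    then show ?thesis by (simp add: \<iota>_binom_sum sum_product)
  qed
  also have "\<dots> = (\<Sum>(s, s')\<in>{..b} \<times> {..b'}. ?t s s')"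
    by (simp add: sum.cartesian_product)
  \<comment> \<open>Terms are grouped by the total power r = s + s' of the direction; the fibre over
    r is the summation range of \<open>q_Vandermonde\<close>.\<close>
  also have "\<dots> = (\<Sum>(r, s)\<in>(SIGMA r:{..b + b'}. {s. s \<le> b \<and> s \<le> r \<and> r - s \<le> b'}). ?t s (r - s))"
    by (rule sum.reindex_bij_witness[of _ "\<lambda>(r, s). (s, r - s)" "\<lambda>(s, s'). (s + s', s)"]) auto
  also have "\<dots> = (\<Sum>r\<le>b + b'. \<Sum>s\<in>{s. s \<le> b \<and> s \<le> r \<and> r - s \<le> b'}. ?t s (r - s))"
    by (rule sum.Sigma [symmetric]) auto
  also have "\<dots> = (\<Sum>r\<le>b + b'. K (v (form m m')) * (K (?G (b + b') r) * Z (m + m' + frag_cmul (int r) y)))"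
  proof (rule sum.cong[OF refl])
    fix r assume "r \<in> {..b + b'}"
    then have "r \<le> b + b'" by simp
    have "(\<Sum>s\<in>{s. s \<le> b \<and> s \<le> r \<and> r - s \<le> b'}. ?t s (r - s)) =
        K (v (form m m') * ?G (b + b') r) * Z (m + m' + frag_cmul (int r) y)"
      unfolding q_Vandermonde[OF \<open>r \<le> b + b'\<close>] sum_distrib_left K_sum sum_distrib_right
      by (intro sum.cong refl) auto
    then show "(\<Sum>s\<in>{s. s \<le> b \<and> s \<le> r \<and> r - s \<le> b'}. ?t s (r - s)) =
        K (v (form m m')) * (K (?G (b + b') r) * Z (m + m' + frag_cmul (int r) y))"
      by (simp add: K_mult mult.assoc)
  qed
  finally show ?thesis by (simp add: \<iota>_binom_sum sum_distrib_left)
qed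

lemma mut_elem_nonzero: "mut_elem m \<noteq> 0"
  by (simp add: mut_elem_def \<iota>_eq_0 binom_sum_nonzero)

lemma binom_sum_0: "\<iota> (binom_sum m 0) = Z m"
  by (simp add: \<iota>_binom_sum)

lemma mut_elem_c_0: "c m = 0 \<Longrightarrow> mut_elem m = Z m"
  by (simp add: mut_elem_def binom_sum_0)

lemma mut_elem_minus: "mut_elem (- m) = inverse (mut_elem m)"
  by (cases "c m" "0 :: int" rule: linorder_cases)
     (simp_all add: mut_elem_c_0 c_minus Z_minus, simp_all add: mut_elem_def c_minus)

text \<open>\<open>binom_sum_mult\<close> settles the case where c is nonpositive on both arguments.
  The other sign patterns reduce to it by moving an inverse to the other side.\<close>

lemma mut_elem_mult: "mut_elem m * mut_elem n = K (v (form m n)) * mut_elem (m + n)"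
proof -
  have nonpos: "mut_elem m * mut_elem n = K (v (form m n)) * mut_elem (m + n)"
    if "c m \<le> 0" "c n \<le> 0" for m n
    using binom_sum_mult[of m "nat (- c m)" n "nat (- c n)"] that
    by (simp add: mut_elem_def c_add flip: nat_add_distrib)
  have inv_cancel: "x * inverse y = z" if "y \<noteq> 0" "z * y = x" for x y z :: 'f
    using that by (simp add: mult.assoc flip: that(2))
  have inv_cancel': "inverse y * x = z" if "y \<noteq> 0" "y * z = x" for x y z :: 'f
    using that by (simp flip: that(2) mult.assoc)
  \<comment> \<open>Here m = (m + n) + (-n) is a sum of two exponents with nonpositive c, and
    \<open>mut_elem (- n)\<close> is the inverse of \<open>mut_elem n\<close>.\<close>
  have right: "mut_elem m * mut_elem n = K (v (form m n)) * mut_elem (m + n)"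
    if "c m \<le> 0" "c n > 0" "c m + c n \<le> 0" for m n
  proof -
    have "mut_elem (m + n) * mut_elem (- n) = K (v (form (m + n) (- n))) * mut_elem m"
      using nonpos[of "m + n" "- n"] that by (simp add: c_add c_minus)
    then have "K (v (form m n)) * mut_elem (m + n) * mut_elem (- n) =
        K (v (form m n) * v (form (m + n) (- n))) * mut_elem m"
      by (simp add: K_mult mult.assoc)
    also have "v (form m n) * v (form (m + n) (- n)) = 1"
      using v_form_minus_right[of m n] by (simp add: v_form_add_left mult.commute)
    finally have "K (v (form m n)) * mut_elem (m + n) * mut_elem (- n) = mut_elem m" by simp
    then show ?thesis
      using inv_cancel[OF mut_elem_nonzero, of "K (v (form m n)) * mut_elem (m + n)" "- n"]
        mut_elem_minus[of "- n"] by simp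
  qed
  have left: "mut_elem m * mut_elem n = K (v (form m n)) * mut_elem (m + n)"
    if "c m > 0" "c n \<le> 0" "c m + c n \<le> 0" for m n
  proof -
    have "mut_elem (- m) * mut_elem (m + n) = K (v (form (- m) (m + n))) * mut_elem n"
      using nonpos[of "- m" "m + n"] that by (simp add: c_add c_minus)
    then have "mut_elem (- m) * (K (v (form m n)) * mut_elem (m + n)) =
        K (v (form m n) * v (form (- m) (m + n))) * mut_elem n"
      by (simp add: K_left_commute[of "mut_elem (- m)"] K_mult mult.assoc)
    also have "v (form m n) * v (form (- m) (m + n)) = 1"
      using v_form_minus_left[of m n] by (simp add: v_form_add_right mult.commute)
    finally have "mut_elem (- m) * (K (v (form m n)) * mut_elem (m + n)) = mut_elem n" by simp
    then show ?thesis
      using inv_cancel'[OF mut_elem_nonzero, of "- m" "K (v (form m n)) * mut_elem (m + n)"]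
        mut_elem_minus[of "- m"] by simp
  qed
  have base: "mut_elem m * mut_elem n = K (v (form m n)) * mut_elem (m + n)"
    if "c m + c n \<le> 0" for m n
    using nonpos[of m n] left[of m n] right[of m n] that by linarith
  show ?thesis
  proof (cases "c m + c n \<le> 0")
    case False
    \<comment> \<open>For c (m + n) > 0 the rule is inverted; inversion reverses the factors, hence
      the order -n, -m.\<close>
    then have "mut_elem (- n) * mut_elem (- m) = K (v (form (- n) (- m))) * mut_elem (- n + - m)"
      using base[of "- n" "- m"] by (simp add: c_minus)
    then have "inverse (mut_elem m * mut_elem n) = K (v (form (- n) (- m))) * inverse (mut_elem (m + n))"
      using mut_elem_minus[of "m + n"] minus_add[of n m]
      by (simp add: add.commute mut_elem_minus mut_elem_nonzero nonzero_inverse_mult_distrib)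
    then have "mut_elem m * mut_elem n = inverse (K (v (form (- n) (- m))) * inverse (mut_elem (m + n)))"
      by (metis inverse_inverse_eq)
    also have "\<dots> = mut_elem (m + n) * inverse (K (v (form (- n) (- m))))"
      by (simp add: nonzero_inverse_mult_distrib mut_elem_nonzero v_form_nonzero)
    also have "inverse (K (v (form (- n) (- m)))) = K (v (form m n))"
    proof -
      have "v (form (- n) (- m)) * v (form m n) = 1"
        using v_form_minus_left[of n "- m"] v_form_minus_right[of n m] v_form_swap[of m n]
        by (smt (verit, best) mult.assoc mult.commute mult_1)
      then have "K (v (form (- n) (- m))) * K (v (form m n)) = 1" by (simp flip: K_mult)
      then show ?thesis by (rule inverse_unique)
    qed
    finally show ?thesis by (simp add: K_commute)
  qed (rule base)
qed

end

lemma frag_all_induct [case_names zero one diff]: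
  assumes "P 0" "\<And>i. P (frag_of i)" "\<And>a b. P a \<Longrightarrow> P b \<Longrightarrow> P (a - b)"
  shows "P (m :: 'i lattice)"
  by (rule frag_induction[of m UNIV]) (use assms in auto)

text \<open>Both sides turn addition of exponents into multiplication with the same twist, so
  agreement on the basis propagates to the lattice. This bridges the gap to the cluster mutations,
  whose formulas are given on the cluster variables alone.\<close>

lemma mutation_on_monomials:
  assumes "quantum_torus v form' \<iota>'" "mutation_direction v form \<iota> q y c"
    and iso: "algebra_iso \<iota>' \<iota> h"
    and \<tau>_add: "\<And>a b. \<tau> (a + b) = \<tau> a + \<tau> b"
    and form: "\<And>a b. v (form' a b) = v (form (\<tau> a) (\<tau> b))"
    and gen: "\<And>i. h (\<iota>' (single (frag_of i) 1)) =
        mutation_direction.mut_elem \<iota> q y c (\<tau> (frag_of i))"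
  shows "h (\<iota>' (single m 1)) = mutation_direction.mut_elem \<iota> q y c (\<tau> m)"
proof -
  interpret T': quantum_torus v form' \<iota>' by fact
  interpret mutation_direction v form \<iota> q y c by fact
  note h = algebra_iso_imp_ring_iso[OF iso]
  have hK: "h (T'.K d) = K d" for d
    using iso by (simp add: algebra_iso_def T'.K_def K_def)
  have neg: "h (T'.Z (- a)) = mut_elem (\<tau> (- a))" if "h (T'.Z a) = mut_elem (\<tau> a)" for a
    using that by (simp add: T'.Z_minus ring_iso_inverse[OF h] mut_elem_minus
        additive_minus[of \<tau>, OF \<tau>_add])
  have add: "h (T'.Z (a + b)) = mut_elem (\<tau> (a + b))"
    if "h (T'.Z a) = mut_elem (\<tau> a)" "h (T'.Z b) = mut_elem (\<tau> b)" for a b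
  proof -
    have "h (T'.Z (a + b)) = K (v (form' b a)) * (mut_elem (\<tau> a) * mut_elem (\<tau> b))"
      by (simp add: T'.Z_add ring_iso_mult[OF h] hK that mult.assoc)
    also have "\<dots> = K (v (form (\<tau> b) (\<tau> a)) * v (form (\<tau> a) (\<tau> b))) * mut_elem (\<tau> (a + b))"
      by (simp add: mut_elem_mult form K_mult mult.assoc \<tau>_add)
    finally show ?thesis by (simp add: v_form_swap)
  qed
  have "h (T'.Z m) = mut_elem (\<tau> m)"
  proof (induction m rule: frag_all_induct)
    case zero
    then show ?case
      by (simp add: ring_iso_1[OF h] additive_minus[of \<tau>, OF \<tau>_add] mut_elem_c_0 c_0)
  next
    case (one i)
    then show ?case using gen[of i] by (simp add: T'.Z_def)
  next
    case (diff a b)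
    then show ?case using add[of a "- b"] neg[of b] by simp
  qed
  then show ?thesis by (simp add: T'.Z_def)
qed

section \<open>Bilinearity of the twisted product\<close>

lemma twisted_mult_add_left:
  "twisted_mult v form (a + b) c = twisted_mult v form a c + twisted_mult v form b c"
proof -
  let ?A = "keys a \<union> keys b"
  have "keys (a + b) \<subseteq> ?A" by (rule keys_add)
  then show ?thesis
    by (simp add: twisted_mult_superset[of ?A _ "keys c"] lookup_add
        distrib_left distrib_right single_add sum.distrib)
qed

lemma twisted_mult_add_right:
  "twisted_mult v form c (a + b) = twisted_mult v form c a + twisted_mult v form c b"
proof -
  let ?A = "keys a \<union> keys b"
  have "keys (a + b) \<subseteq> ?A" by (rule keys_add)
  then show ?thesis
    by (simp add: twisted_mult_superset[of "keys c" _ ?A] lookup_add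
        distrib_left distrib_right single_add sum.distrib)
qed

lemma twisted_mult_0 [simp]: "twisted_mult v form 0 c = 0" "twisted_mult v form c 0 = 0"
  by (simp_all add: twisted_mult_def)

lemma twisted_mult_sum_left:
  "twisted_mult v form (sum f A) c = (\<Sum>x\<in>A. twisted_mult v form (f x) c)"
  by (induction A rule: infinite_finite_induct) (simp_all add: twisted_mult_add_left)

lemma twisted_mult_sum_right:
  "twisted_mult v form c (sum f A) = (\<Sum>x\<in>A. twisted_mult v form c (f x))"
  by (induction A rule: infinite_finite_induct) (simp_all add: twisted_mult_add_right)

section \<open>Monomial maps\<close>

lemma monomial_map_superset:
  assumes "finite A" "keys a \<subseteq> A"
  shows "monomial_map f a = (\<Sum>m\<in>A. single (f m) (lookup a m))"
  unfolding monomial_map_def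
  by (intro sum.mono_neutral_left) (use assms in \<open>auto simp: in_keys_iff\<close>)

lemma monomial_map_single: "monomial_map f (single m c) = single (f m) c"
  by (simp add: monomial_map_def)

lemma monomial_map_0 [simp]: "monomial_map f 0 = 0"
  by (simp add: monomial_map_def)

lemma monomial_map_add: "monomial_map f (a + b) = monomial_map f a + monomial_map f b"
proof -
  let ?A = "keys a \<union> keys b"
  have "keys (a + b) \<subseteq> ?A" by (rule keys_add)
  then show ?thesis
    by (simp add: monomial_map_superset[of ?A] lookup_add single_add sum.distrib)
qed

lemma monomial_map_sum: "monomial_map f (sum g A) = (\<Sum>x\<in>A. monomial_map f (g x))"
  by (induction A rule: infinite_finite_induct) (simp_all add: monomial_map_add)

lemma monomial_map_comp: "monomial_map g (monomial_map f a) = monomial_map (g \<circ> f) a"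
  by (simp add: monomial_map_def[of f] monomial_map_sum monomial_map_single)
     (simp add: monomial_map_def)

lemma monomial_map_id: "monomial_map id a = a"
  by (simp add: monomial_map_def poly_mapping_sum_single)

lemma bij_monomial_map:
  assumes "bij f"
  shows "bij (monomial_map f :: ('i::finite, 'k::idom) LP \<Rightarrow> _)"
proof (rule o_bij)
  show "monomial_map (inv f) \<circ> (monomial_map f :: ('i, 'k) LP \<Rightarrow> _) = id"
    using assms by (auto simp: monomial_map_comp fun_eq_iff bij_is_inj monomial_map_id)
  show "(monomial_map f :: ('i, 'k) LP \<Rightarrow> _) \<circ> monomial_map (inv f) = id"
    using surj_iff[THEN iffD1, OF bij_is_surj, OF assms]
    by (intro ext) (simp only: o_apply [of "monomial_map f"] monomial_map_comp monomial_map_id id_apply)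
qed

text \<open>The two forms are compared only on exponents that occur. This is for
  \<open>p_star\<close>, which in the quantum case matches the forms only when one argument is
  suitably restricted.\<close>

lemma monomial_map_twisted_mult:
  assumes "\<And>m n. f (m + n) = f m + f n"
    and "\<And>m n. m \<in> keys a \<Longrightarrow> n \<in> keys b \<Longrightarrow>
           v (form' (f m) (f n)) = v (form m n)"
  shows "monomial_map f (twisted_mult v form a b) =
    twisted_mult v form' (monomial_map f a) (monomial_map f b)"
proof -
  have "monomial_map f (twisted_mult v form a b) =
    (\<Sum>m\<in>keys a. \<Sum>n\<in>keys b. single (f m + f n)
     (v (form m n) * lookup a m * lookup b n))"
    by (simp add: twisted_mult_def monomial_map_sum monomial_map_single assms(1))
  also have "\<dots> = (\<Sum>m\<in>keys a. \<Sum>n\<in>keys b. single (f m + f n)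
     (v (form' (f m) (f n)) * lookup a m * lookup b n))"
    by (intro sum.cong refl) (simp add: assms(2))
  also have "\<dots> = twisted_mult v form' (monomial_map f a) (monomial_map f b)"
    by (simp add: monomial_map_def twisted_mult_sum_left twisted_mult_sum_right twisted_mult_single
        sum.swap[of _ "keys a"])
  finally show ?thesis .
qed

section \<open>Fractions\<close>

text \<open>Turning a left fraction into a right one amounts to the Ore exchange relation, which no
  longer involves inverses and can be read inside the torus.\<close>

lemma left_fraction_iff:
  fixes b b' c d :: "'a::division_ring"
  assumes "b \<noteq> 0" "d \<noteq> 0"
  shows "inverse b * b' = c * inverse d \<longleftrightarrow> b' * d = b * c"
proof
  assume *: "inverse b * b' = c * inverse d"
  have "b' * d = b * (inverse b * b') * d" using assms(1) by (simp flip: mult.assoc)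
  then show "b' * d = b * c" using assms(2) by (simp add: * mult.assoc)
next
  assume *: "b' * d = b * c"
  have "inverse b * b' = inverse b * (b' * d) * inverse d" using assms(2) by (simp add: mult.assoc)
  then show "inverse b * b' = c * inverse d" using assms(1) by (simp add: * flip: mult.assoc)
qed

lemma fraction_cancel_right:
  fixes a b c :: "'a::division_ring"
  assumes "b \<noteq> 0" "c \<noteq> 0"
  shows "(a * c) * inverse (b * c) = a * inverse b"
  using assms by (simp add: nonzero_inverse_mult_distrib mult.assoc)
     (simp flip: mult.assoc[of c])

context quantum_torus
begin

abbreviation tmul where "tmul \<equiv> twisted_mult v form"

lemma tmul_eq_0: "tmul a b = 0 \<longleftrightarrow> a = 0 \<or> b = 0"
  using \<iota>_mult[of a b] by (metis \<iota>_eq_0 mult_eq_0_iff)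

text \<open>The Ore condition comes from the skew-field: the element b^(-1) b' is a right fraction
  by assumption.\<close>

lemma oreE:
  assumes "b \<noteq> 0"
  obtains c d where "d \<noteq> 0" "tmul b' d = tmul b c"
proof -
  obtain c d where d: "d \<noteq> 0" "inverse (\<iota> b) * \<iota> b' = \<iota> c * inverse (\<iota> d)"
    by (rule fractionE)
  then have "\<iota> b' * \<iota> d = \<iota> b * \<iota> c"
    using left_fraction_iff[of "\<iota> b" "\<iota> d"] assms by (simp add: \<iota>_eq_0)
  then show ?thesis using d(1) that by (simp add: \<iota>_eq_iff flip: \<iota>_mult)
qed

lemma common_denominatorE:
  obtains a a' p where "p \<noteq> 0" "x = \<iota> a * inverse (\<iota> p)" "x' = \<iota> a' * inverse (\<iota> p)"
proof -
  obtain a b where b: "b \<noteq> 0" "x = \<iota> a * inverse (\<iota> b)" by (rule fractionE)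
  obtain a' b' where b': "b' \<noteq> 0" "x' = \<iota> a' * inverse (\<iota> b')" by (rule fractionE)
  obtain c d where d: "d \<noteq> 0" "tmul b' d = tmul b c" by (rule oreE[OF b(1)])
  have c: "c \<noteq> 0" using d b'(1) tmul_eq_0 by metis
  show ?thesis
  proof (rule that)
    show "tmul b c \<noteq> 0" using b(1) c by (simp add: tmul_eq_0)
    show "x = \<iota> (tmul a c) * inverse (\<iota> (tmul b c))"
      using b c by (simp add: \<iota>_mult fraction_cancel_right \<iota>_eq_0)
    show "x' = \<iota> (tmul a' d) * inverse (\<iota> (tmul b c))"
      unfolding d(2) [symmetric] using b' d(1) by (simp add: \<iota>_mult fraction_cancel_right \<iota>_eq_0)
  qed
qed

lemma ring_iso_cong:
  assumes g: "ring_iso g" and h: "ring_iso h"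
    and K: "\<And>c. g (K c) = h (K c)" and Z: "\<And>m. g (Z m) = h (Z m)"
  shows "g x = h x"
proof -
  have "g (\<iota> a) = h (\<iota> a)" for a
    by (simp add: \<iota>_expand[of a] ring_iso_sum[OF g] ring_iso_sum[OF h]
        ring_iso_mult[OF g] ring_iso_mult[OF h] K Z)
  moreover obtain a b where "x = \<iota> a * inverse (\<iota> b)" by (rule fractionE)
  ultimately show ?thesis
    by (simp add: ring_iso_mult[OF g] ring_iso_mult[OF h]
        ring_iso_inverse[OF g] ring_iso_inverse[OF h])
qed

end

text \<open>The universal property of Ore localization. The skew-fields are known only through their
  embeddings, so the extension is built on fractions; a monomial map preserves Ore relations, which
  yields well-definedness, additivity and multiplicativity.\<close>

lemma fractions_extension:
  fixes \<iota> :: "('i::finite, 'k::idom) LP \<Rightarrow> 'f::division_ring"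
    and \<iota>' :: "('i, 'k) LP \<Rightarrow> 'g::division_ring"
  assumes "quantum_torus v form \<iota>" "quantum_torus v form' \<iota>'"
    and f: "\<And>m n. f (m + n) = f m + f n" "bij f"
    and form: "\<And>m n. v (form' (f m) (f n)) = v (form m n)"
  obtains \<Phi> where "ring_iso \<Phi>" "\<And>a. \<Phi> (\<iota> a) = \<iota>' (monomial_map f a)"
proof -
  interpret T: quantum_torus v form \<iota> by fact
  interpret T': quantum_torus v form' \<iota>' by fact
  define V where "V a = \<iota>' (monomial_map f a)" for a
  have V_bij: "bij (monomial_map f :: ('i, 'k) LP \<Rightarrow> _)" by (rule bij_monomial_map[OF f(2)])
  have V_add: "V (a + b) = V a + V b" for a b
    by (simp add: V_def monomial_map_add T'.\<iota>_add)
  have V_mult: "V (T.tmul a b) = V a * V b" for a b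
    by (simp add: V_def monomial_map_twisted_mult[where form' = form'] f(1) form T'.\<iota>_mult)
  have V_0: "V a = 0 \<longleftrightarrow> a = 0" for a
    using bij_is_inj[OF V_bij, THEN inj_eq, of a 0] by (simp add: V_def T'.\<iota>_eq_0)
  have V_1: "V 1 = 1"
  proof -
    have "monomial_map f 1 = single (f 0) (1 :: 'k)"
      using monomial_map_single[of f 0 1] by simp
    then show ?thesis using additive_minus(1)[of f, OF f(1)] T'.\<iota>_1 by (simp add: V_def)
  qed
  define \<Phi> where "\<Phi> x = (SOME z. \<exists>a b. b \<noteq> 0 \<and> x = \<iota> a * inverse (\<iota> b) \<and> z = V a * inverse (V b))" for x
  have \<Phi>: "\<Phi> (\<iota> a * inverse (\<iota> b)) = V a * inverse (V b)" if b: "b \<noteq> 0" for a b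
  proof -
    have "V a' * inverse (V b') = V a * inverse (V b)"
      if b': "b' \<noteq> 0" and eq: "\<iota> a * inverse (\<iota> b) = \<iota> a' * inverse (\<iota> b')" for a' b'
    proof -
      obtain c d where d: "d \<noteq> 0" "T.tmul b' d = T.tmul b c" by (rule T.oreE[OF b])
      then have c: "c \<noteq> 0" using b' T.tmul_eq_0 by metis
      have "\<iota> (T.tmul a c) * inverse (\<iota> (T.tmul b c)) = \<iota> (T.tmul a' d) * inverse (\<iota> (T.tmul b' d))"
        using b b' c d(1) eq by (simp add: T.\<iota>_mult fraction_cancel_right T.\<iota>_eq_0)
      then have "T.tmul a c = T.tmul a' d"
        using d b b' c by (simp add: T.\<iota>_eq_iff T.\<iota>_eq_0 T.tmul_eq_0)
      then have "V a * V c = V a' * V d" "V b * V c = V b' * V d"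
        using d(2) by (simp_all flip: V_mult)
      then show ?thesis
        using fraction_cancel_right[of "V b" "V c" "V a"] fraction_cancel_right[of "V b'" "V d" "V a'"]
          b b' c d(1) by (simp add: V_0)
    qed
    then show ?thesis
      unfolding \<Phi>_def using b by (intro some_equality) blast+
  qed
  have \<Phi>_\<iota>: "\<Phi> (\<iota> a) = V a" for a
    using \<Phi>[of 1 a] by (simp add: T.\<iota>_1 V_1)
  have "ring_iso \<Phi>"
    unfolding ring_iso_def
  proof (intro conjI allI)
    show add: "\<Phi> (x + y) = \<Phi> x + \<Phi> y" for x y
    proof -
      obtain a a' p where p: "p \<noteq> 0" "x = \<iota> a * inverse (\<iota> p)" "y = \<iota> a' * inverse (\<iota> p)"
        by (rule T.common_denominatorE)
      then have "x + y = \<iota> (a + a') * inverse (\<iota> p)" by (simp add: T.\<iota>_add distrib_right)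
      then show ?thesis using p by (simp add: \<Phi> V_add distrib_right)
    qed
    show "\<Phi> (x * y) = \<Phi> x * \<Phi> y" for x y
    proof -
      obtain a b where b: "b \<noteq> 0" "x = \<iota> a * inverse (\<iota> b)" by (rule T.fractionE)
      obtain a' b' where b': "b' \<noteq> 0" "y = \<iota> a' * inverse (\<iota> b')" by (rule T.fractionE)
      \<comment> \<open>One Ore relation turns the inner left fraction b^(-1) a' into c d^(-1), and
        does so both before and after applying V.\<close>
      obtain c d where d: "d \<noteq> 0" "T.tmul a' d = T.tmul b c" by (rule T.oreE[OF b(1)])
      have 1: "inverse (\<iota> b) * \<iota> a' = \<iota> c * inverse (\<iota> d)"
        using left_fraction_iff[of "\<iota> b" "\<iota> d"] d b(1) by (simp add: T.\<iota>_eq_0 flip: T.\<iota>_mult)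
      have 2: "inverse (V b) * V a' = V c * inverse (V d)"
        using left_fraction_iff[of "V b" "V d"] d b(1) by (simp add: V_0 flip: V_mult)
      have "x * y = \<iota> a * (inverse (\<iota> b) * \<iota> a') * inverse (\<iota> b')"
        using b b' by (simp add: mult.assoc)
      also have "\<dots> = \<iota> (T.tmul a c) * inverse (\<iota> (T.tmul b' d))"
        using b'(1) d(1) unfolding 1
        by (simp add: T.\<iota>_mult nonzero_inverse_mult_distrib T.\<iota>_eq_0 mult.assoc)
      finally have "\<Phi> (x * y) = V (T.tmul a c) * inverse (V (T.tmul b' d))"
        using b'(1) d(1) by (simp add: \<Phi> T.tmul_eq_0)
      also have "\<dots> = V a * (inverse (V b) * V a') * inverse (V b')"
        using b'(1) d(1) unfolding 2
        by (simp add: V_mult nonzero_inverse_mult_distrib V_0 mult.assoc)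
      finally show ?thesis using b b' by (simp add: \<Phi> mult.assoc)
    qed
    show "bij \<Phi>"
    proof (rule bijI)
      show "inj \<Phi>"
      proof (rule injI)
        fix x y assume "\<Phi> x = \<Phi> y"
        moreover have "\<Phi> (x - y) + \<Phi> y = \<Phi> x" by (simp flip: add)
        ultimately have 0: "\<Phi> (x - y) = 0" by simp
        obtain a b where b: "b \<noteq> 0" "x - y = \<iota> a * inverse (\<iota> b)" by (rule T.fractionE)
        then have "a = 0" using 0 by (simp add: \<Phi> V_0)
        then show "x = y" using b by (simp add: T.\<iota>_0)
      qed
      show "surj \<Phi>"
        unfolding surj_def
      proof
        fix z
        obtain a b where b: "b \<noteq> 0" "z = \<iota>' a * inverse (\<iota>' b)" by (rule T'.fractionE)
        let ?a = "inv (monomial_map f) a" and ?b = "inv (monomial_map f) b"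
        have *: "V ?a = \<iota>' a" "V ?b = \<iota>' b"
          using V_bij by (simp_all add: V_def bij_is_surj surj_f_inv_f)
        then have "?b \<noteq> 0" using b(1) V_0[of ?b] by (simp add: T'.\<iota>_eq_0)
        then have "z = \<Phi> (\<iota> ?a * inverse (\<iota> ?b))" using b * by (simp add: \<Phi>)
        then show "\<exists>x. z = \<Phi> x" ..
      qed
    qed
  qed
  then show ?thesis using \<Phi>_\<iota> that by (simp add: V_def)
qed

section \<open>Mutations are involutive\<close>

text \<open>At v = 1 and with b = c m \<ge> 0, writing Y for Z^y, the round trip gives Z^m Y^b (1 +
  Y)^(-b) (1 + Y^(-1))^b, which is Z^m. The hypotheses say that the two directions are opposite and
  that the tropical parts compose to a shear, which is the source of Y^b.\<close>

lemma mutation_involutive: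
  assumes "mutation_direction v form \<iota> q y c" "mutation_direction v form' \<iota>' q y' c'"
    and iso: "algebra_iso \<iota>' \<iota> h" and iso': "algebra_iso \<iota> \<iota>' h'"
    and h_Z: "\<And>m. h (\<iota>' (single m 1)) =
        mutation_direction.mut_elem \<iota> q y c (\<tau> m)"
    and h'_Z: "\<And>m. h' (\<iota> (single m 1)) =
        mutation_direction.mut_elem \<iota>' q y' c' (\<tau>' m)"
    and \<tau>_add: "\<And>a b. \<tau> (a + b) = \<tau> a + \<tau> b"
    and \<tau>_y': "\<tau> y' = - y"
    and c_\<tau>: "\<And>m. c (\<tau> m) = - c' m"
    and \<tau>_\<tau>': "\<And>m. \<tau> (\<tau>' m) = m + frag_cmul (c m) y"
  shows "h (h' x) = x"
proof -
  interpret M: mutation_direction v form \<iota> q y c by fact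
  interpret M': mutation_direction v form' \<iota>' q y' c' by fact
  note h = algebra_iso_imp_ring_iso[OF iso] and h' = algebra_iso_imp_ring_iso[OF iso']
  have hK: "h (M'.K d) = M.K d" and h'K: "h' (M.K d) = M'.K d" for d
    using iso iso' by (simp_all add: algebra_iso_def M'.K_def M.K_def)
  have hZ: "h (M'.Z m) = M.mut_elem (\<tau> m)" and h'Z: "h' (M.Z m) = M'.mut_elem (\<tau>' m)" for m
    using h_Z[of m] h'_Z[of m] by (simp_all add: M.Z_def M'.Z_def)
  have nonneg: "h (h' (M.Z m)) = M.Z m" if cm: "c m \<ge> 0" for m
  proof -
    define b where "b = nat (c m)"
    have b: "int b = c m" using cm by (simp add: b_def)
    \<comment> \<open>N is \<tau> (\<tau>' m), the exponent reached before the binomial factors are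
      taken into account.\<close>
    define N where "N = m + frag_cmul (int b) y"
    have cN: "c N = int b" by (simp add: N_def M.c_add M.c_cmul_y b)
    have c': "c' (\<tau>' m) = - int b"
      using c_\<tau>[of "\<tau>' m"] cN by (simp add: \<tau>_\<tau>' N_def b)
    have Zy: "M.Z (- frag_cmul (int s) y) = M.mut_elem (- frag_cmul (int s) y)" for s
      by (simp add: M.mut_elem_c_0 M.c_minus M.c_cmul_y)
    have summand: "h (M'.Z (\<tau>' m + frag_cmul (int s) y')) =
        M.K (v (form (- frag_cmul (int s) y) N)) * (M.mut_elem N * M.Z (- frag_cmul (int s) y))" for s
    proof -
      have "\<tau> (\<tau>' m + frag_cmul (int s) y') = N + - frag_cmul (int s) y"
        by (simp add: \<tau>_add \<tau>_\<tau>' additive_frag_cmul[of \<tau>, OF \<tau>_add] \<tau>_y' N_def b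
            frag_cmul_minus_one [symmetric] del: frag_cmul_minus_one)
      then have "h (M'.Z (\<tau>' m + frag_cmul (int s) y')) = M.mut_elem (N + - frag_cmul (int s) y)"
        by (simp add: hZ)
      moreover have "M.K (v (form (- frag_cmul (int s) y) N)) *
          (M.mut_elem N * M.mut_elem (- frag_cmul (int s) y)) =
          M.K (v (form (- frag_cmul (int s) y) N) * v (form N (- frag_cmul (int s) y))) *
            M.mut_elem (N + - frag_cmul (int s) y)"
        by (simp only: M.mut_elem_mult M.K_mult mult.assoc)
      ultimately show ?thesis
        by (simp only: Zy M.v_form_swap M.K_1 mult_1)
    qed
    have "h (h' (M.Z m)) = (\<Sum>s\<le>b. M.K (q_binom q b s) *
        h (M'.Z (\<tau>' m + frag_cmul (int s) y')))"
      by (simp add: h'Z M'.mut_elem_def c' M'.\<iota>_binom_sum ring_iso_sum[OF h]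
          ring_iso_mult[OF h] hK)
    also have "\<dots> = M.mut_elem N * (\<Sum>s\<le>b. M.K (q_binom q b s * v (form (- frag_cmul (int s) y) N)) *
        M.Z (- frag_cmul (int s) y))"
      unfolding summand sum_distrib_left
      by (intro sum.cong refl) (simp add: M.K_mult mult.assoc M.K_left_commute[of "M.mut_elem N"])
    also have "(\<Sum>s\<le>b. M.K (q_binom q b s * v (form (- frag_cmul (int s) y) N)) *
        M.Z (- frag_cmul (int s) y)) = \<iota> (M.binom_sum (- N) b) * M.Z m"
    proof -
      have "\<iota> (M.binom_sum (- N) b) * M.Z m =
        (\<Sum>s\<le>b. M.K (q_binom q b s) * (M.Z (- N + frag_cmul (int s) y) * M.Z m))"
        by (simp add: M.\<iota>_binom_sum sum_distrib_right mult.assoc)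
      \<comment> \<open>Reversing the summation turns powers of Z^y into negative powers, up to the
        shift by b that N contains; the binomials are symmetric.\<close>
      also have "\<dots> = (\<Sum>s\<le>b. M.K (q_binom q b (b - s)) * (M.Z (- N + frag_cmul (int (b - s)) y) * M.Z m))"
        by (rule sum.reindex_bij_witness[of _ "\<lambda>s. b - s" "\<lambda>s. b - s"]) auto
      also have "\<dots> = (\<Sum>s\<le>b. M.K (q_binom q b s * v (form (- frag_cmul (int s) y) N)) *
        M.Z (- frag_cmul (int s) y))"
      proof (rule sum.cong[OF refl])
        fix s assume "s \<in> {..b}"
        then have s: "s \<le> b" by simp
        have e: "- N + frag_cmul (int (b - s)) y = - m + - frag_cmul (int s) y"
          using s by (simp add: N_def of_nat_diff frag_cmul_diff_distrib del: minus_frag_cmul)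
        have "v (form (- m + - frag_cmul (int s) y) m) = v (form (- frag_cmul (int s) y) m)"
          by (simp only: M.v_form_add_left M.v_form_minus_self mult_1)
        also have "\<dots> = v (form (- frag_cmul (int s) y) N)"
        proof -
          have "v (form (frag_cmul (int s) y) (frag_cmul (int b) y)) = 1"
            by (simp add: M.v_form_cmul_left M.v_form_cmul_right M.v_form_self)
          then have "v (form (- frag_cmul (int s) y) (frag_cmul (int b) y)) = 1"
            using M.v_form_minus_left[of "frag_cmul (int s) y" "frag_cmul (int b) y"] by simp
          then show ?thesis by (simp only: N_def M.v_form_add_right mult_1_right)
        qed
        finally have w: "v (form (- m + - frag_cmul (int s) y) m) = v (form (- frag_cmul (int s) y) N)" .
        show "M.K (q_binom q b (b - s)) * (M.Z (- N + frag_cmul (int (b - s)) y) * M.Z m) =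
          M.K (q_binom q b s * v (form (- frag_cmul (int s) y) N)) * M.Z (- frag_cmul (int s) y)"
          unfolding e M.Z_mult w M.q_binom_symmetric[OF s] by (simp add: M.K_mult mult.assoc)
      qed
      finally show ?thesis ..
    qed
    also have "M.mut_elem N * (\<iota> (M.binom_sum (- N) b) * M.Z m) = M.Z m"
    proof -
      have "M.mut_elem N = inverse (\<iota> (M.binom_sum (- N) b))"
        using M.mut_elem_minus[of "- N"] cN by (simp add: M.mut_elem_def M.c_minus)
      then show ?thesis by (simp add: M.\<iota>_eq_0 M.binom_sum_nonzero flip: mult.assoc)
    qed
    finally show ?thesis .
  qed
  have "h (h' (M.Z m)) = M.Z m" for m
  proof (cases "c m \<ge> 0")
    case False
    then have "h (h' (M.Z (- m))) = M.Z (- m)" by (intro nonneg) (simp add: M.c_minus)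
    then show ?thesis
      by (simp add: M.Z_minus ring_iso_inverse[OF h] ring_iso_inverse[OF h'])
  qed (rule nonneg)
  then show ?thesis
    using M.ring_iso_cong[OF ring_iso_comp[OF h h'] ring_iso_id, of x]
    by (simp add: hK h'K)
qed

section \<open>Upper cluster algebras and mutation\<close>

lemma mutates_simps [simp]: "mutates [] s = s" "mutates (k # ks) s = mutates ks (mutate k s)"
  by (simp_all add: mutates_def)

lemma mutates_snoc: "mutates (ks @ [k]) s = mutate k (mutates ks s)"
  by (simp add: mutates_def)

lemma mu_star_snoc: "mu_star mu (ks @ [k]) s = mu_star mu ks s \<circ> mu (mutates ks s) k"
  by (induction ks arbitrary: s) (simp_all add: comp_assoc)

lemma v_sub_mutate [simp]: "v_sub v (mutate k s) j = v_sub v s j"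
  by (simp add: v_sub_def mutate_def fun_eq_iff)

lemma mut_elem_monomial_map:
  assumes "mutation_direction v form \<iota> q y c" "mutation_direction v form' \<iota>' q y' c'"
    and \<Phi>: "ring_iso \<Phi>" "\<And>a. \<Phi> (\<iota> a) = \<iota>' (monomial_map V a)"
    and V: "\<And>a b. V (a + b) = V a + V b" "V y = y'" "c' (V m) = c m"
  shows "\<Phi> (mutation_direction.mut_elem \<iota> q y c m) = mutation_direction.mut_elem \<iota>' q y' c' (V m)"
proof -
  interpret M: mutation_direction v form \<iota> q y c by fact
  interpret M': mutation_direction v form' \<iota>' q y' c' by fact
  have sum: "monomial_map V (M.binom_sum m b) = M'.binom_sum (V m) b" for m b
    by (simp add: M.binom_sum_def M'.binom_sum_def monomial_map_sum monomial_map_single V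
        additive_frag_cmul[of V, OF V(1)])
  show ?thesis
    by (simp add: M.mut_elem_def M'.mut_elem_def V ring_iso_inverse[OF \<Phi>(1)] \<Phi>(2) sum
        additive_minus[of V, OF V(1)])
qed

text \<open>What the A-side and the X-side share over a class C of seeds closed under mutation. The
  map \<open>\<tau> s k\<close> goes from exponents at \<open>mutate k s\<close> to exponents at s;
  the conditions from \<open>mutate_mutate\<close> on are there to make
  \<open>mutation_involutive\<close> applicable.\<close>

locale mutation_system =
  fixes v :: "rat \<Rightarrow> 'k::idom" and U :: "'i::finite set" and C :: "'i seed set"
    and form :: "'i seed \<Rightarrow> 'i lattice \<Rightarrow> 'i lattice \<Rightarrow> rat"
    and y :: "'i seed \<Rightarrow> 'i \<Rightarrow> 'i lattice"
    and c :: "'i seed \<Rightarrow> 'i \<Rightarrow> 'i lattice \<Rightarrow> int"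
    and \<tau> :: "'i seed \<Rightarrow> 'i \<Rightarrow> 'i lattice \<Rightarrow> 'i lattice"
    and \<iota> :: "'i seed \<Rightarrow> ('i, 'k) LP \<Rightarrow> 'f::division_ring"
    and mu :: "'i seed \<Rightarrow> 'i \<Rightarrow> 'f \<Rightarrow> 'f"
  assumes mutate_in_C: "s \<in> C \<Longrightarrow> k \<in> U \<Longrightarrow> mutate k s \<in> C"
    and unfrozen_C: "s \<in> C \<Longrightarrow> unfrozen s = U"
    and torus: "s \<in> C \<Longrightarrow> quantum_torus v (form s) (\<iota> s)"
    and direction: "s \<in> C \<Longrightarrow> k \<in> U \<Longrightarrow>
      mutation_direction v (form s) (\<iota> s) (v_sub v s k) (y s k) (c s k)"
    and mu_iso: "s \<in> C \<Longrightarrow> k \<in> U \<Longrightarrow> algebra_iso (\<iota> (mutate k s)) (\<iota> s) (mu s k)"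
    and mu_monomial: "s \<in> C \<Longrightarrow> k \<in> U \<Longrightarrow> mu s k (\<iota> (mutate k s) (single m 1)) =
      mutation_direction.mut_elem (\<iota> s) (v_sub v s k) (y s k) (c s k) (\<tau> s k m)"
    and \<tau>_add: "s \<in> C \<Longrightarrow> k \<in> U \<Longrightarrow> \<tau> s k (a + b) = \<tau> s k a + \<tau> s k b"
    and mutate_mutate: "s \<in> C \<Longrightarrow> k \<in> U \<Longrightarrow> mutate k (mutate k s) = s"
    and \<tau>_y: "s \<in> C \<Longrightarrow> k \<in> U \<Longrightarrow> \<tau> s k (y (mutate k s) k) = - y s k"
    and c_\<tau>: "s \<in> C \<Longrightarrow> k \<in> U \<Longrightarrow> c s k (\<tau> s k m) = - c (mutate k s) k m"
    and \<tau>_\<tau>: "s \<in> C \<Longrightarrow> k \<in> U \<Longrightarrow>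
      \<tau> s k (\<tau> (mutate k s) k m) = m + frag_cmul (c s k m) (y s k)"
begin

abbreviation mut where
  "mut s k \<equiv> mutation_direction.mut_elem (\<iota> s) (v_sub v s k) (y s k) (c s k)"

text \<open>\<open>mutate k (mutate k s)\<close> equals s as a record, Poisson form included, so the
  second mutation really starts from the chosen embedding of s.\<close>

lemma mu_involutive:
  assumes "s \<in> C" "k \<in> U"
  shows "mu s k (mu (mutate k s) k x) = x"
proof -
  note C' = mutate_in_C[OF assms]
  have dir': "mutation_direction v (form (mutate k s)) (\<iota> (mutate k s)) (v_sub v s k)
      (y (mutate k s) k) (c (mutate k s) k)"
    using direction[OF C' assms(2)] by simp
  have iso': "algebra_iso (\<iota> s) (\<iota> (mutate k s)) (mu (mutate k s) k)"
    using mu_iso[OF C' assms(2)] by (simp add: mutate_mutate assms)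
  have mon': "mu (mutate k s) k (\<iota> s (single m 1)) =
      mutation_direction.mut_elem (\<iota> (mutate k s)) (v_sub v s k) (y (mutate k s) k)
        (c (mutate k s) k) (\<tau> (mutate k s) k m)" for m
    using mu_monomial[OF C' assms(2), of m] by (simp add: mutate_mutate assms)
  show ?thesis
    by (rule mutation_involutive[OF direction[OF assms] dir' mu_iso[OF assms] iso'
          mu_monomial[OF assms] mon' \<tau>_add[OF assms] \<tau>_y[OF assms] c_\<tau>[OF assms]
          \<tau>_\<tau>[OF assms]])
qed

lemma mu_star_iso:
  "s \<in> C \<Longrightarrow> set ks \<subseteq> U \<Longrightarrow> algebra_iso (\<iota> (mutates ks s)) (\<iota> s) (mu_star mu ks s)"
proof (induction ks arbitrary: s)
  case Nil
  then show ?case by (simp add: algebra_iso_def bij_id [unfolded id_def])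
next
  case (Cons k ks)
  then show ?case
    using Cons.IH[of "mutate k s"] mu_iso[of s k] mutate_in_C[of s k]
    by (auto simp: algebra_iso_def intro: bij_comp [unfolded o_def])
qed

lemma image_INT_bij:
  assumes "bij f"
  shows "f ` (\<Inter>x\<in>A. B x) = (\<Inter>x\<in>A. f ` B x)"
proof (cases "A = {}")
  case True
  then show ?thesis using assms by (simp add: bij_is_surj)
next
  case False
  then show ?thesis using bij_image_INT[OF assms, of B A] by simp
qed

text \<open>Prefixing k turns sequences from \<open>mutate k s\<close> into sequences from s, which
  gives one inclusion. For the other, \<open>ks\<close> and \<open>k # k # ks\<close> produce the
  same Laurent ring by involutivity.\<close>

lemma mu_upper_cluster_algebra:
  assumes s: "s \<in> C" "k \<in> U"
  shows "mu s k ` upper_cluster_algebra \<iota> mu (mutate k s) = upper_cluster_algebra \<iota> mu s"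
proof -
  note C' = mutate_in_C[OF s]
  have bij: "bij (mu s k)" using mu_iso[OF s] by (simp add: algebra_iso_def)
  let ?L = "\<lambda>ks. mu_star mu ks s ` range (\<iota> (mutates ks s))"
  have 1: "mu s k ` upper_cluster_algebra \<iota> mu (mutate k s) =
      (\<Inter>ks\<in>{ks. set ks \<subseteq> U}. ?L (k # ks))"
    unfolding upper_cluster_algebra_def image_INT_bij[OF bij] unfrozen_C[OF C']
    by (simp add: image_comp)
  have 2: "upper_cluster_algebra \<iota> mu s = (\<Inter>ks\<in>{ks. set ks \<subseteq> U}. ?L ks)"
    by (simp add: upper_cluster_algebra_def unfrozen_C s)
  have 3: "?L (k # k # ks) = ?L ks" for ks
    by (simp add: mutate_mutate s image_comp o_def mu_involutive)
  show ?thesis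
  proof
    show "mu s k ` upper_cluster_algebra \<iota> mu (mutate k s) \<subseteq> upper_cluster_algebra \<iota> mu s"
      unfolding 1 2
    proof (rule INT_greatest)
      fix ks assume "ks \<in> {ks. set ks \<subseteq> U}"
      then have "(\<Inter>ks\<in>{ks. set ks \<subseteq> U}. ?L (k # ks)) \<subseteq> ?L (k # (k # ks))"
        using s(2) by (intro INT_lower) simp
      then show "(\<Inter>ks\<in>{ks. set ks \<subseteq> U}. ?L (k # ks)) \<subseteq> ?L ks" unfolding 3 .
    qed
    show "upper_cluster_algebra \<iota> mu s \<subseteq> mu s k ` upper_cluster_algebra \<iota> mu (mutate k s)"
      unfolding 1 2
    proof (rule INT_greatest)
      fix ks assume "ks \<in> {ks. set ks \<subseteq> U}"
      then show "(\<Inter>ks\<in>{ks. set ks \<subseteq> U}. ?L ks) \<subseteq> ?L (k # ks)"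
        using s(2) by (intro INT_lower) simp
    qed
  qed
qed

lemma mu_star_upper_cluster_algebra:
  "s \<in> C \<Longrightarrow> set ks \<subseteq> U \<Longrightarrow>
     mu_star mu ks s ` upper_cluster_algebra \<iota> mu (mutates ks s) = upper_cluster_algebra \<iota> mu s"
proof (induction ks arbitrary: s)
  case (Cons k ks)
  then have "mu_star mu ks (mutate k s) ` upper_cluster_algebra \<iota> mu (mutates ks (mutate k s)) =
      upper_cluster_algebra \<iota> mu (mutate k s)"
    by (simp add: mutate_in_C)
  then show ?case
    using mu_upper_cluster_algebra[of s k] Cons.prems
    by (simp only: mu_star.simps mutates_simps image_comp [symmetric]) simp
qed simp

end

section \<open>Twists from compatible families of variation maps\<close>

text \<open>
  The relation \<open>Var s s' V\<close> is a bisimulation: it is preserved under simultaneous mutation at \<open>k\<close>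
  and \<open>\<sigma> k\<close>, the maps \<open>V\<close> being intertwined by \<open>\<tau>\<close>.
\<close>

locale variation_system = mutation_system v U C form y c \<tau> \<iota> mu
  for v :: "rat \<Rightarrow> 'k::idom" and U :: "'i::finite set" and C :: "'i seed set"
    and form y c \<tau> and \<iota> :: "'i seed \<Rightarrow> ('i, 'k) LP \<Rightarrow> 'f::division_ring" and mu +
  fixes \<sigma> :: "'i \<Rightarrow> 'i" and Var :: "'i seed \<Rightarrow> 'i seed \<Rightarrow> ('i lattice \<Rightarrow> 'i lattice) \<Rightarrow> bool"
  assumes \<sigma>: "\<sigma> permutes U"
    and Var_C: "Var s s' V \<Longrightarrow> s \<in> C" "Var s s' V \<Longrightarrow> s' \<in> C"
    and Var_add: "Var s s' V \<Longrightarrow> V (a + b) = V a + V b"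
    and Var_bij: "Var s s' V \<Longrightarrow> bij V"
    and Var_form: "Var s s' V \<Longrightarrow> v (form s' (V a) (V b)) = v (form s a b)"
    and Var_y: "Var s s' V \<Longrightarrow> k \<in> U \<Longrightarrow> V (y s k) = y s' (\<sigma> k)"
    and Var_c: "Var s s' V \<Longrightarrow> k \<in> U \<Longrightarrow> c s' (\<sigma> k) (V m) = c s k m"
    and Var_v: "Var s s' V \<Longrightarrow> k \<in> U \<Longrightarrow> v_sub v s' (\<sigma> k) = v_sub v s k"
    and Var_mutate: "Var s s' V \<Longrightarrow> k \<in> U \<Longrightarrow>
      \<exists>V'. Var (mutate k s) (mutate (\<sigma> k) s') V' \<and> (\<forall>m. \<tau> s' (\<sigma> k) (V' m) = V (\<tau> s k m))"
begin

lemma \<sigma>_in_U: "k \<in> U \<Longrightarrow> \<sigma> k \<in> U"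
  using \<sigma> by (simp add: permutes_in_image)

text \<open>\<open>mut_elem\<close> is built from the form, the direction, the functional and q
  alone, and V matches all four; hence \<Phi> carries one mutation formula to the other.\<close>

lemma variation_intertwines_mu:
  assumes Var: "Var s s' V" and k: "k \<in> U"
    and \<Phi>: "ring_iso \<Phi>" "\<And>a. \<Phi> (\<iota> s a) = \<iota> s' (monomial_map V a)"
    and V': "\<And>m. \<tau> s' (\<sigma> k) (V' m) = V (\<tau> s k m)"
      "\<And>a b. V' (a + b) = V' a + V' b"
  shows "\<Phi> (mu s k (\<iota> (mutate k s) a)) =
    mu s' (\<sigma> k) (\<iota> (mutate (\<sigma> k) s') (monomial_map V' a))"
proof -
  note C = Var_C[OF Var] and \<sigma>k = \<sigma>_in_U[OF k]
  interpret T: quantum_torus v "form (mutate k s)" "\<iota> (mutate k s)"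
    by (rule torus[OF mutate_in_C[OF C(1) k]])
  interpret T': quantum_torus v "form (mutate (\<sigma> k) s')" "\<iota> (mutate (\<sigma> k) s')"
    by (rule torus[OF mutate_in_C[OF C(2) \<sigma>k]])
  note iso = mu_iso[OF C(1) k] and iso' = mu_iso[OF C(2) \<sigma>k]
  note h = algebra_iso_imp_ring_iso[OF iso] and h' = algebra_iso_imp_ring_iso[OF iso']
  have V0: "V 0 = 0" using additive_minus(1)[of V, OF Var_add[OF Var]] .
  have K: "\<Phi> (mu s k (T.K d)) = mu s' (\<sigma> k) (T'.K d)" for d
    using iso iso' by (simp add: algebra_iso_def T.K_def T'.K_def \<Phi>(2) monomial_map_single V0)
  have Z: "\<Phi> (mu s k (T.Z m)) = mu s' (\<sigma> k) (T'.Z (V' m))" for m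
  proof -
    have "mutation_direction v (form s') (\<iota> s') (v_sub v s k) (y s' (\<sigma> k)) (c s' (\<sigma> k))"
      using direction[OF C(2) \<sigma>k] by (simp add: Var_v[OF Var k])
    from mut_elem_monomial_map[OF direction[OF C(1) k] this \<Phi> Var_add[OF Var] Var_y[OF Var k]
        Var_c[OF Var k]]
    show ?thesis
      by (simp add: T.Z_def T'.Z_def mu_monomial C k \<sigma>k V' Var_v[OF Var k])
  qed
  have "\<iota> (mutate (\<sigma> k) s') (monomial_map V' a) =
      (\<Sum>m\<in>keys a. T'.K (lookup a m) * T'.Z (V' m))"
    by (simp add: monomial_map_def T'.\<iota>_sum T'.\<iota>_single)
  then show ?thesis
    by (simp add: T.\<iota>_expand[of a] ring_iso_sum[OF h] ring_iso_sum[OF h']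
        ring_iso_sum[OF \<Phi>(1)] ring_iso_mult[OF h] ring_iso_mult[OF h']
        ring_iso_mult[OF \<Phi>(1)] K Z)
qed

text \<open>The intertwiner at later seeds is \<Phi> conjugated by mutations, so the square commutes
  by construction. The content is that it is again a monomial map on Laurent polynomials.\<close>

lemma variation_intertwines_mu_star:
  assumes "Var s s' V" "ring_iso \<Phi>" "\<And>a. \<Phi> (\<iota> s a) = \<iota> s' (monomial_map V a)" "set ks \<subseteq> U"
  shows "\<exists>V' \<Phi>'. bij V' \<and> (\<forall>a. \<Phi>' (\<iota> (mutates ks s) a) = \<iota> (mutates (map \<sigma> ks) s') (monomial_map V' a)) \<and>
    mu_star mu (map \<sigma> ks) s' \<circ> \<Phi>' = \<Phi> \<circ> mu_star mu ks s"
  using assms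
proof (induction ks arbitrary: s s' V \<Phi>)
  case Nil
  then show ?case using Var_bij by (intro exI[of _ V] exI[of _ \<Phi>]) simp
next
  case (Cons k ks)
  then have k: "k \<in> U" "set ks \<subseteq> U" by auto
  note Var = Cons.prems(1)
  note C = Var_C[OF Var] and \<sigma>k = \<sigma>_in_U[OF k(1)]
  note h = algebra_iso_imp_ring_iso[OF mu_iso[OF C(1) k(1)]]
    and h' = algebra_iso_imp_ring_iso[OF mu_iso[OF C(2) \<sigma>k]]
  obtain V' where V': "Var (mutate k s) (mutate (\<sigma> k) s') V'"
      "\<And>m. \<tau> s' (\<sigma> k) (V' m) = V (\<tau> s k m)"
    using Var_mutate[OF Var k(1)] by blast
  define \<Psi> where "\<Psi> = inv (mu s' (\<sigma> k)) \<circ> (\<Phi> \<circ> mu s k)"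
  have \<Psi>: "ring_iso \<Psi>"
    unfolding \<Psi>_def by (intro ring_iso_comp ring_iso_inv h h' Cons.prems(2))
  have mu_\<Psi>: "mu s' (\<sigma> k) \<circ> \<Psi> = \<Phi> \<circ> mu s k"
    using ring_iso_bij[OF h'] by (simp add: \<Psi>_def fun_eq_iff bij_is_surj surj_f_inv_f)
  have "\<Psi> (\<iota> (mutate k s) a) = \<iota> (mutate (\<sigma> k) s') (monomial_map V' a)" for a
    using variation_intertwines_mu[OF Var k(1) Cons.prems(2,3) V'(2) Var_add[OF V'(1)], of a]
      ring_iso_bij[OF h'] by (simp add: \<Psi>_def bij_is_inj)
  from Cons.IH[OF V'(1) \<Psi> this k(2)] obtain V'' \<Phi>' where *: "bij V''"
    "\<And>a. \<Phi>' (\<iota> (mutates ks (mutate k s)) a) =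
       \<iota> (mutates (map \<sigma> ks) (mutate (\<sigma> k) s')) (monomial_map V'' a)"
    "mu_star mu (map \<sigma> ks) (mutate (\<sigma> k) s') \<circ> \<Phi>' = \<Psi> \<circ> mu_star mu ks (mutate k s)"
    by blast
  have "mu_star mu (map \<sigma> (k # ks)) s' \<circ> \<Phi>' = \<Phi> \<circ> mu_star mu (k # ks) s"
    by (simp only: list.map mu_star.simps comp_assoc *(3)) (simp only: comp_assoc [symmetric] mu_\<Psi>)
  then show ?case using *(1,2) unfolding mutates_simps list.map by blast
qed

text \<open>\<Phi> sends the Laurent ring reached by \<open>ks\<close> to the one reached by
  \<open>map \<sigma> ks\<close>, and \<open>map \<sigma>\<close> permutes the mutation
  sequences.\<close>

lemma variation_upper_cluster_algebra:
  assumes Var: "Var s s' V" and \<Phi>: "ring_iso \<Phi>" "\<And>a. \<Phi> (\<iota> s a) = \<iota> s' (monomial_map V a)"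
  shows "\<Phi> ` upper_cluster_algebra \<iota> mu s = upper_cluster_algebra \<iota> mu s'"
proof -
  let ?L = "\<lambda>s ks. mu_star mu ks s ` range (\<iota> (mutates ks s))"
  let ?I = "{ks. set ks \<subseteq> U}"
  have lists: "map \<sigma> ` ?I = ?I"
    using permutes_image[OF \<sigma>] lists_image[of \<sigma> U] by (simp add: lists_eq_set)
  have "\<Phi> ` ?L s ks = ?L s' (map \<sigma> ks)" if ks: "ks \<in> ?I" for ks
  proof -
    obtain V' \<Phi>' where *: "bij V'"
      "\<And>a. \<Phi>' (\<iota> (mutates ks s) a) = \<iota> (mutates (map \<sigma> ks) s') (monomial_map V' a)"
      "mu_star mu (map \<sigma> ks) s' \<circ> \<Phi>' = \<Phi> \<circ> mu_star mu ks s"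
      using variation_intertwines_mu_star[OF Var \<Phi>] ks[unfolded mem_Collect_eq] by blast
    have "\<Phi> ` ?L s ks = mu_star mu (map \<sigma> ks) s' ` \<Phi>' ` range (\<iota> (mutates ks s))"
      by (simp only: image_comp comp_assoc [symmetric] *(3))
    also have "\<Phi>' ` range (\<iota> (mutates ks s)) =
        \<iota> (mutates (map \<sigma> ks) s') ` range (monomial_map V')"
      by (auto simp: *(2) image_comp)
    also have "range (monomial_map V' :: ('i, 'k) LP \<Rightarrow> _) = UNIV"
      using bij_monomial_map[OF *(1)] by (rule bij_is_surj)
    finally show ?thesis .
  qed
  then have "\<Phi> ` (\<Inter>ks\<in>?I. ?L s ks) = (\<Inter>ks\<in>?I. ?L s' (map \<sigma> ks))"
    unfolding image_INT_bij[OF ring_iso_bij[OF \<Phi>(1)]] by (intro INF_cong refl) simp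
  also have "\<dots> = (\<Inter>ks\<in>map \<sigma> ` ?I. ?L s' ks)" by (simp add: image_comp)
  finally show ?thesis
    unfolding lists by (simp add: upper_cluster_algebra_def unfrozen_C Var_C[OF Var])
qed

lemma twist_exists:
  assumes ks: "set ks \<subseteq> U" and Var: "Var t (mutates ks t) V"
  obtains tw where
    "\<And>a. tw (\<iota> t a) = mu_star mu ks t (\<iota> (mutates ks t) (monomial_map V a))"
    "algebra_automorphism_on (\<iota> t) (upper_cluster_algebra \<iota> mu t) tw"
proof -
  note C = Var_C[OF Var]
  obtain \<Phi> where \<Phi>: "ring_iso \<Phi>" "\<And>a. \<Phi> (\<iota> t a) = \<iota> (mutates ks t) (monomial_map V a)"
    using fractions_extension[OF torus[OF C(1)] torus[OF C(2)] Var_add[OF Var] Var_bij[OF Var]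
        Var_form[OF Var]] by metis
  note iso = mu_star_iso[OF C(1) ks]
  note g = algebra_iso_imp_ring_iso[OF iso]
  let ?tw = "mu_star mu ks t \<circ> \<Phi>"
  have tw: "ring_iso ?tw" by (rule ring_iso_comp[OF g \<Phi>(1)])
  have "?tw ` upper_cluster_algebra \<iota> mu t = upper_cluster_algebra \<iota> mu t"
    unfolding image_comp [symmetric] variation_upper_cluster_algebra[OF Var \<Phi>]
    by (rule mu_star_upper_cluster_algebra[OF C(1) ks])
  then have "bij_betw ?tw (upper_cluster_algebra \<iota> mu t) (upper_cluster_algebra \<iota> mu t)"
    using inj_on_subset[OF bij_is_inj[OF ring_iso_bij[OF tw]] subset_UNIV]
    by (simp only: bij_betw_def)
  moreover have "?tw (\<iota> t (single 0 d)) = \<iota> t (single 0 d)" for d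
    using iso additive_minus(1)[of V, OF Var_add[OF Var]]
    by (simp add: \<Phi>(2) monomial_map_single algebra_iso_def)
  ultimately have "algebra_automorphism_on (\<iota> t) (upper_cluster_algebra \<iota> mu t) ?tw"
    unfolding algebra_automorphism_on_def
    using ring_iso_add[OF tw] ring_iso_mult[OF tw] by blast
  then show ?thesis using that[of ?tw] by (simp add: \<Phi>(2))
qed

end

section \<open>Tropical mutations as lattice isomorphisms\<close>

abbreviation coord :: "'i lattice \<Rightarrow> 'i \<Rightarrow> int" where
  "coord \<equiv> lookup"

abbreviation bmat_row :: "'i::finite seed \<Rightarrow> 'i \<Rightarrow> 'i lattice \<Rightarrow> int" where
  "bmat_row s k n \<equiv> \<Sum>i\<in>UNIV. bmat s k i * coord n i"

abbreviation X_form :: "'i::finite seed \<Rightarrow> 'i lattice \<Rightarrow> 'i lattice \<Rightarrow> rat" where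
  "X_form s \<equiv> \<lambda>n n'. - omega s n n'"

lemma lattice_expansion: "(n :: 'i::finite lattice) = (\<Sum>i\<in>UNIV. frag_cmul (coord n i) (frag_of i))"
  by (rule poly_mapping_eqI) (simp add: lookup_sum lookup_single when_def if_distrib cong: if_cong)

lemma biadditive_eqI:
  fixes f g :: "'i lattice \<Rightarrow> 'i lattice \<Rightarrow> 'a::ab_group_add"
  assumes "\<And>a b c. f (a + b) c = f a c + f b c" "\<And>a b c. f a (b + c) = f a b + f a c"
    and "\<And>a b c. g (a + b) c = g a c + g b c" "\<And>a b c. g a (b + c) = g a b + g a c"
    and "\<And>i j. f (frag_of i) (frag_of j) = g (frag_of i) (frag_of j)"
  shows "f a b = g a b"
proof (induction a rule: frag_all_induct)
  case zero
  then show ?case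
    using additive_minus(1)[of "\<lambda>a. f a b"] additive_minus(1)[of "\<lambda>a. g a b"] assms by simp
next
  case (one i)
  show ?case
  proof (induction b rule: frag_all_induct)
    case zero
    then show ?case
      using additive_minus(1)[of "f (frag_of i)"] additive_minus(1)[of "g (frag_of i)"] assms by simp
  next
    case (one j)
    show ?case by (rule assms)
  next
    case (diff b c)
    then show ?case
      using additive_minus(3)[of "f (frag_of i)"] additive_minus(3)[of "g (frag_of i)"] assms by simp
  qed
next
  case (diff a c)
  then show ?case
    using additive_minus(3)[of "\<lambda>a. f a b"] additive_minus(3)[of "\<lambda>a. g a b"] assms by simp
qed

lemma omega_add_left: "omega s (a + b) c = omega s a c + omega s b c"
  by (simp add: omega_def lookup_add distrib_right sum.distrib add_divide_distrib)

lemma omega_add_right: "omega s a (b + c) = omega s a b + omega s a c"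
  by (simp add: omega_def lookup_add distrib_left distrib_right sum.distrib add_divide_distrib)

lemma omega_frag_of_right:
  "omega s n (frag_of k) = of_int (bmat_row s k n) / of_int (mult s k)"
proof -
  have "omega s n (frag_of k) = (\<Sum>i\<in>UNIV. \<Sum>j\<in>UNIV.
      if j = k then of_int (bmat s k i * coord n i) / of_int (mult s k) else 0)"
    unfolding omega_def by (intro sum.cong refl) auto
  then show ?thesis by (simp add: sum_divide_distrib)
qed

lemma omega_frag_of: "omega s (frag_of i) (frag_of j) = of_int (bmat s j i) / of_int (mult s j)"
  by (simp add: omega_frag_of_right lookup_frag_of if_distrib cong: if_cong)

lemma omega_swap:
  assumes "is_seed s"
  shows "omega s a b = - omega s b a"
proof (rule biadditive_eqI[where g = "\<lambda>a b. - omega s b a"])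
  show "omega s (frag_of i) (frag_of j) = - omega s (frag_of j) (frag_of i)" for i j
    using assms unfolding is_seed_def omega_frag_of by blast
qed (simp_all add: omega_add_left omega_add_right)

lemma omega_self: "is_seed s \<Longrightarrow> omega s a a = 0"
  using omega_swap[of s a a] by simp

lemma bmat_diag:
  assumes "is_seed s"
  shows "bmat s k k = 0"
proof -
  have "mult s k \<noteq> 0" using assms unfolding is_seed_def by (metis less_irrefl)
  then show ?thesis using omega_self[OF assms, of "frag_of k"] by (simp add: omega_frag_of)
qed

text \<open>The evaluation pairing of M\<degree> with N; the denominators come from f_i being the
  i-th dual basis vector divided by d_i.\<close>

definition pairing :: "'i::finite seed \<Rightarrow> 'i lattice \<Rightarrow> 'i lattice \<Rightarrow> rat" where
  "pairing s m n = (\<Sum>i\<in>UNIV. of_int (coord m i * coord n i) / of_int (mult s i))"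

lemma pairing_add_left: "pairing s (a + b) c = pairing s a c + pairing s b c"
  by (simp add: pairing_def lookup_add distrib_right sum.distrib add_divide_distrib)

lemma pairing_add_right: "pairing s a (b + c) = pairing s a b + pairing s a c"
  by (simp add: pairing_def lookup_add distrib_left sum.distrib add_divide_distrib)

lemma pairing_frag_of_right: "pairing s m (frag_of i) = of_int (coord m i) / of_int (mult s i)"
proof -
  have "pairing s m (frag_of i) =
      (\<Sum>j\<in>UNIV. if j = i then of_int (coord m i) / of_int (mult s i) else 0)"
    unfolding pairing_def by (intro sum.cong refl) auto
  then show ?thesis by simp
qed

lemma pairing_mutate [simp]: "pairing (mutate k s) = pairing s"
  by (simp add: pairing_def mutate_def fun_eq_iff)

lemma biadditive_cmul:
  fixes f :: "'i lattice \<Rightarrow> 'i lattice \<Rightarrow> rat"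
  shows "(\<And>a b c. f (a + b) c = f a c + f b c) \<Longrightarrow> f (frag_cmul z a) b = of_int z * f a b"
    and "(\<And>a b c. f a (b + c) = f a b + f a c) \<Longrightarrow> f a (frag_cmul z b) = of_int z * f a b"
proof -
  have 1: "g (frag_cmul z a) = of_int z * g a" if g: "\<And>a b. g (a + b) = g a + g b"
    for g :: "'i lattice \<Rightarrow> rat" and a
  proof -
    have nat: "g (frag_cmul (int n) a) = of_int (int n) * g a" for n
      by (induction n) (simp_all add: frag_cmul_distrib g additive_minus(1)[of g, OF g] distrib_right)
    show ?thesis
      using nat[of "nat z"] nat[of "nat (- z)"]
      by (cases "z \<ge> 0") (auto simp flip: minus_frag_cmul simp: additive_minus(2)[of g, OF g])
  qed
  show "(\<And>a b c. f (a + b) c = f a c + f b c) \<Longrightarrow> f (frag_cmul z a) b = of_int z * f a b"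
    by (rule 1[of "\<lambda>a. f a b"])
  show "(\<And>a b c. f a (b + c) = f a b + f a c) \<Longrightarrow> f a (frag_cmul z b) = of_int z * f a b"
    by (rule 1[of "f a"])
qed

lemmas omega_cmul_left = biadditive_cmul(1)[of "omega s" for s, OF omega_add_left]
lemmas omega_cmul_right = biadditive_cmul(2)[of "omega s" for s, OF omega_add_right]
lemmas pairing_cmul_left = biadditive_cmul(1)[of "pairing s" for s, OF pairing_add_left]
lemmas pairing_cmul_right = biadditive_cmul(2)[of "pairing s" for s, OF pairing_add_right]
lemmas omega_minus_left = additive_minus(2)[of "\<lambda>a. omega s a b" for s b, OF omega_add_left]
lemmas omega_minus_right = additive_minus(2)[of "omega s a" for s a, OF omega_add_right]
lemmas pairing_minus_left = additive_minus(2)[of "\<lambda>a. pairing s a b" for s b, OF pairing_add_left]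
lemmas pairing_minus_right = additive_minus(2)[of "pairing s a" for s a, OF pairing_add_right]

lemma pairing_eqI:
  assumes "\<And>i. mult s i > 0" "\<And>n. pairing s m n = pairing s m' n"
  shows "m = m'"
proof (rule poly_mapping_eqI)
  fix i
  have "mult s i \<noteq> 0" using assms(1)[of i] by simp
  then show "coord m i = coord m' i"
    using assms(2)[of "frag_of i"] by (simp add: pairing_frag_of_right)
qed

lemma p_star_add: "p_star s (a + b) = p_star s a + p_star s b"
  by (simp add: p_star_def frag_extend_add)

lemmas p_star_cmul = additive_frag_cmul[of "p_star s" for s, OF p_star_add]
lemmas p_star_minus = additive_minus(2)[of "p_star s" for s, OF p_star_add]

lemma coord_p_star_frag_of: "coord (p_star s (frag_of j)) i = bmat s i j"
  by (simp add: p_star_def lookup_sum lookup_frag_of if_distrib cong: if_cong)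

lemma pairing_p_star: "pairing s (p_star s a) b = omega s a b"
  by (rule biadditive_eqI)
     (simp_all add: pairing_add_left pairing_add_right p_star_add omega_add_left omega_add_right
       pairing_frag_of_right coord_p_star_frag_of omega_frag_of)

text \<open>
  Here \<open>\<psi> : N(s) \<rightarrow> N(s')\<close> and \<open>\<phi> : M\<degree>(s) \<rightarrow> M\<degree>(s')\<close>. Since \<open>\<langle>p\<^sup>* n, n'\<rangle> = \<omega>(n, n')\<close>, such a pair
  automatically commutes with \<open>p\<^sup>*\<close>.
\<close>

definition lattice_iso ::
  "'i::finite seed \<Rightarrow> 'i seed \<Rightarrow> ('i lattice \<Rightarrow> 'i lattice) \<Rightarrow> ('i lattice \<Rightarrow> 'i lattice) \<Rightarrow> bool" where
  "lattice_iso s s' \<psi> \<phi> \<longleftrightarrow>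
     bij \<psi> \<and> bij \<phi> \<and> (\<forall>a b. \<psi> (a + b) = \<psi> a + \<psi> b) \<and> (\<forall>a b. \<phi> (a + b) = \<phi> a + \<phi> b) \<and>
     (\<forall>m n. pairing s' (\<phi> m) (\<psi> n) = pairing s m n) \<and>
     (\<forall>a b. omega s' (\<psi> a) (\<psi> b) = omega s a b) \<and>
     (\<forall>a b. pois s' (\<phi> a) (\<phi> b) = pois s a b)"

context
  fixes s s' :: "'i::finite seed" and \<psi> \<phi>
  assumes iso: "lattice_iso s s' \<psi> \<phi>"
begin

lemma lattice_iso_bij: "bij \<psi>" "bij \<phi>"
  and lattice_iso_add: "\<psi> (a + b) = \<psi> a + \<psi> b" "\<phi> (a + b) = \<phi> a + \<phi> b"
  and lattice_iso_pairing: "pairing s' (\<phi> m) (\<psi> n) = pairing s m n"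
  and lattice_iso_omega: "omega s' (\<psi> a) (\<psi> b) = omega s a b"
  and lattice_iso_pois: "pois s' (\<phi> a) (\<phi> b) = pois s a b"
  using iso by (simp_all add: lattice_iso_def)

lemma lattice_iso_p_star:
  assumes "\<And>i. mult s' i > 0"
  shows "\<phi> (p_star s n) = p_star s' (\<psi> n)"
proof (rule pairing_eqI[OF assms])
  fix n'
  obtain a where a: "n' = \<psi> a" using lattice_iso_bij(1) by (metis bij_pointE)
  show "pairing s' (\<phi> (p_star s n)) n' = pairing s' (p_star s' (\<psi> n)) n'"
    by (simp add: a lattice_iso_pairing pairing_p_star lattice_iso_omega)
qed

lemma lattice_iso_inv: "lattice_iso s' s (inv \<psi>) (inv \<phi>)"
proof -
  have inv: "\<psi> (inv \<psi> a) = a" "\<phi> (inv \<phi> a) = a" for a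
    using lattice_iso_bij by (simp_all add: bij_is_surj surj_f_inv_f)
  have inj: "\<psi> a = \<psi> b \<longleftrightarrow> a = b" "\<phi> a = \<phi> b \<longleftrightarrow> a = b" for a b
    using lattice_iso_bij by (simp_all add: bij_is_inj inj_eq)
  show ?thesis
    unfolding lattice_iso_def
  proof (intro conjI allI)
    show "inv \<psi> (a + b) = inv \<psi> a + inv \<psi> b" for a b
      by (rule inj(1)[THEN iffD1]) (simp add: inv lattice_iso_add)
    show "inv \<phi> (a + b) = inv \<phi> a + inv \<phi> b" for a b
      by (rule inj(2)[THEN iffD1]) (simp add: inv lattice_iso_add)
    show "pairing s (inv \<phi> m) (inv \<psi> n) = pairing s' m n" for m n
      using lattice_iso_pairing[of "inv \<phi> m" "inv \<psi> n"] by (simp add: inv)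
    show "omega s (inv \<psi> m) (inv \<psi> n) = omega s' m n" for m n
      using lattice_iso_omega[of "inv \<psi> m" "inv \<psi> n"] by (simp add: inv)
    show "pois s (inv \<phi> m) (inv \<phi> n) = pois s' m n" for m n
      using lattice_iso_pois[of "inv \<phi> m" "inv \<phi> n"] by (simp add: inv)
  qed (use lattice_iso_bij in \<open>auto intro: bij_imp_bij_inv\<close>)
qed

end

lemma lattice_iso_id: "lattice_iso s s id id"
  by (simp add: lattice_iso_def)

lemma lattice_iso_comp:
  "lattice_iso s s' \<psi> \<phi> \<Longrightarrow> lattice_iso s' s'' \<psi>' \<phi>' \<Longrightarrow> lattice_iso s s'' (\<psi>' \<circ> \<psi>) (\<phi>' \<circ> \<phi>)"
  by (auto simp: lattice_iso_def bij_comp)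

text \<open>The change of basis e'_k \<mapsto> -e_k, e'_i \<mapsto> e_i + [\<epsilon> b_ki]_+ e_k
  from the mutated seed to s; the summand -2 n_k is what turns e_k into -e_k.\<close>

definition trop_N :: "int \<Rightarrow> 'i::finite seed \<Rightarrow> 'i \<Rightarrow> 'i lattice \<Rightarrow> 'i lattice" where
  "trop_N \<epsilon> s k n =
     n + frag_cmul ((\<Sum>i\<in>UNIV. max (\<epsilon> * bmat s k i) 0 * coord n i) - 2 * coord n k) (frag_of k)"

text \<open>The contragredient of \<open>trop_N \<epsilon> s k\<close> for the evaluation
  pairing.\<close>

definition trop_M :: "int \<Rightarrow> 'i::finite seed \<Rightarrow> 'i \<Rightarrow> 'i lattice \<Rightarrow> 'i lattice" where
  "trop_M \<epsilon> s k m =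
     m + frag_cmul (coord m k)
       ((\<Sum>j\<in>UNIV. frag_cmul (max (- \<epsilon> * bmat s j k) 0) (frag_of j)) - frag_cmul 2 (frag_of k))"

lemma trop_N_add: "trop_N \<epsilon> s k (a + b) = trop_N \<epsilon> s k a + trop_N \<epsilon> s k b"
proof -
  have "(\<Sum>i\<in>UNIV. max (\<epsilon> * bmat s k i) 0 * coord (a + b) i) =
      (\<Sum>i\<in>UNIV. max (\<epsilon> * bmat s k i) 0 * coord a i) + (\<Sum>i\<in>UNIV. max (\<epsilon> * bmat s k i) 0 * coord b i)"
    by (simp add: lookup_add distrib_left sum.distrib)
  then show ?thesis
    unfolding trop_N_def
    by (intro poly_mapping_eqI) (simp add: lookup_add lookup_frag_of algebra_simps)
qed

lemma trop_M_add: "trop_M \<epsilon> s k (a + b) = trop_M \<epsilon> s k a + trop_M \<epsilon> s k b"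
  by (simp add: trop_M_def lookup_add frag_cmul_distrib)

lemma coord_trop_N: "i \<noteq> k \<Longrightarrow> coord (trop_N \<epsilon> s k n) i = coord n i"
  by (simp add: trop_N_def lookup_add lookup_frag_of)

lemma coord_trop_M:
  "coord (trop_M \<epsilon> s k m) i =
     (if i = k then (max (- \<epsilon> * bmat s k k) 0 - 1) * coord m k
      else coord m i + max (- \<epsilon> * bmat s i k) 0 * coord m k)"
  by (simp add: trop_M_def lookup_add lookup_minus lookup_sum lookup_frag_of algebra_simps
      if_distrib cong: if_cong)

lemma trop_N_frag_of:
  "trop_N \<epsilon> s k (frag_of i) =
     frag_of i + frag_cmul (max (\<epsilon> * bmat s k i) 0 - (if i = k then 2 else 0)) (frag_of k)"
  by (simp add: trop_N_def lookup_frag_of if_distrib cong: if_cong)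

context
  fixes s :: "'i::finite seed" and k :: 'i
  assumes seed: "is_seed s"
begin

lemma mult_pos: "mult s i > 0"
  using seed by (simp add: is_seed_def)

lemma bmat_skew: "mult s j * bmat s i j = - (mult s i * bmat s j i)"
proof -
  have "of_int (bmat s i j) / (of_int (mult s i) :: rat) = - (of_int (bmat s j i) / of_int (mult s j))"
    using seed unfolding is_seed_def by blast
  moreover have "(of_int (mult s i) :: rat) \<noteq> 0" "(of_int (mult s j) :: rat) \<noteq> 0"
    using mult_pos[of i] mult_pos[of j] by simp_all
  ultimately have "(of_int (mult s j * bmat s i j) :: rat) = of_int (- (mult s i * bmat s j i))"
    by (simp add: field_simps)
  then show ?thesis by (simp only: of_int_eq_iff)
qed

text \<open>Skew-symmetrizability trades column k for row k; the duality between
  \<open>trop_M\<close> and \<open>trop_N\<close> rests on it.\<close>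

lemma max_bmat_skew:
  "of_int (max (- \<epsilon> * bmat s j k) 0) / (of_int (mult s j) :: rat) =
   of_int (max (\<epsilon> * bmat s k j) 0) / of_int (mult s k)"
proof -
  have "mult s k * max (- \<epsilon> * bmat s j k) 0 = max (mult s k * (- \<epsilon> * bmat s j k)) 0"
    using mult_pos[of k] by (simp add: max_mult_distrib_left)
  also have "mult s k * (- \<epsilon> * bmat s j k) = mult s j * (\<epsilon> * bmat s k j)"
    using bmat_skew[of k j] by (simp add: algebra_simps)
  also have "max (mult s j * (\<epsilon> * bmat s k j)) 0 = mult s j * max (\<epsilon> * bmat s k j) 0"
    using mult_pos[of j] by (simp add: max_mult_distrib_left)
  finally have "(of_int (mult s k) :: rat) * of_int (max (- \<epsilon> * bmat s j k) 0) =
      of_int (mult s j) * of_int (max (\<epsilon> * bmat s k j) 0)"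
    by (simp only: of_int_mult [symmetric])
  then show ?thesis
    using mult_pos[of k] mult_pos[of j] by (simp add: field_simps)
qed

lemma trop_N_involution: "trop_N \<epsilon> s k (trop_N \<epsilon> s k n) = n"
proof -
  let ?c = "\<lambda>n. (\<Sum>i\<in>UNIV. max (\<epsilon> * bmat s k i) 0 * coord n i)"
  have "?c (trop_N \<epsilon> s k n) = ?c n"
    by (intro sum.cong refl) (use bmat_diag[OF seed, of k] coord_trop_N in \<open>metis mult_zero_left mult_zero_right max.idem\<close>)
  then show ?thesis
    unfolding trop_N_def[of \<epsilon> s k "trop_N \<epsilon> s k n"]
    by (simp add: trop_N_def lookup_add lookup_frag_of flip: frag_cmul_distrib)
qed

lemma trop_M_involution: "trop_M \<epsilon> s k (trop_M \<epsilon> s k m) = m"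
  by (rule poly_mapping_eqI) (simp add: coord_trop_M bmat_diag[OF seed])

lemma bij_trop: "bij (trop_N \<epsilon> s k)" "bij (trop_M \<epsilon> s k)"
  using trop_N_involution trop_M_involution by (auto intro!: o_bij simp: fun_eq_iff)

text \<open>If \<open>trop_N\<close> adds a e_k to n and \<open>trop_M\<close> adds m_k g to m, then
  <g, n> = a / d_k and <g, e_k> = -2 / d_k, so the three correction terms cancel.\<close>

lemma pairing_trop: "pairing s (trop_M \<epsilon> s k m) (trop_N \<epsilon> s k n) = pairing s m n"
proof -
  let ?a = "(\<Sum>i\<in>UNIV. max (\<epsilon> * bmat s k i) 0 * coord n i) - 2 * coord n k"
  let ?g = "(\<Sum>j\<in>UNIV. frag_cmul (max (- \<epsilon> * bmat s j k) 0) (frag_of j)) - frag_cmul 2 (frag_of k)"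
  have g: "coord ?g j = max (- \<epsilon> * bmat s j k) 0 - (if j = k then 2 else 0)" for j
    by (simp add: lookup_minus lookup_sum lookup_frag_of if_distrib cong: if_cong)
  have gn: "pairing s ?g n = of_int ?a / of_int (mult s k)"
  proof -
    have "of_int (coord ?g j * coord n j) / (of_int (mult s j) :: rat) =
        of_int (max (\<epsilon> * bmat s k j) 0 * coord n j) / of_int (mult s k) -
        (if j = k then of_int (2 * coord n k) / of_int (mult s k) else 0)" for j
    proof -
      have "of_int (coord ?g j * coord n j) / (of_int (mult s j) :: rat) =
        of_int (max (- \<epsilon> * bmat s j k) 0) / of_int (mult s j) * of_int (coord n j) -
        (if j = k then of_int (2 * coord n k) / of_int (mult s k) else 0)"
        unfolding g by (simp add: algebra_simps diff_divide_distrib)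
      then show ?thesis unfolding max_bmat_skew by simp
    qed
    then show ?thesis
      by (simp add: pairing_def sum_subtractf sum_divide_distrib diff_divide_distrib)
  qed
  have gk: "pairing s ?g (frag_of k) = - 2 / of_int (mult s k)"
    unfolding pairing_frag_of_right g by (simp add: bmat_diag[OF seed])
  show ?thesis
    unfolding trop_M_def trop_N_def
    by (simp only: pairing_add_left pairing_add_right pairing_cmul_left pairing_cmul_right)
       (simp only: gn gk, simp only: pairing_frag_of_right, simp add: algebra_simps diff_divide_distrib)
qed

lemma bmat_mutate:
  "bmat (mutate k s) i j = (if i = k \<or> j = k then - bmat s i j
     else bmat s i j + bmat s i k * max (bmat s k j) 0 + max (- bmat s i k) 0 * bmat s k j)"
  by (simp add: mutate_def)

text \<open>Matrix mutation is the change of basis of \<omega> under the positive tropical map;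
  skew-symmetrizability moves the denominator from d_k to d_j.\<close>

lemma omega_trop_1: "omega s (trop_N 1 s k a) (trop_N 1 s k b) = omega (mutate k s) a b"
proof (rule biadditive_eqI[where f = "\<lambda>a b. omega s (trop_N 1 s k a) (trop_N 1 s k b)"])
  fix i j
  let ?al = "\<lambda>i. max (bmat s k i) 0 - (if i = k then 2 else 0)"
  have "omega s (trop_N 1 s k (frag_of i)) (trop_N 1 s k (frag_of j)) =
      of_int (bmat s j i + ?al i * bmat s j k) / of_int (mult s j) +
      of_int (?al j) * of_int (bmat s k i) / of_int (mult s k)"
    by (simp add: trop_N_frag_of omega_add_left omega_add_right omega_cmul_left omega_cmul_right
        omega_frag_of bmat_diag[OF seed] add_divide_distrib)
  also have "of_int (?al j) * of_int (bmat s k i) / of_int (mult s k) =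
      (of_int ((max (- bmat s j k) 0 - (if j = k then 2 else 0)) * bmat s k i) / of_int (mult s j) :: rat)"
  proof (cases "j = k")
    case False
    have "of_int (max (bmat s k j) 0) * of_int (bmat s k i) / (of_int (mult s k) :: rat) =
        of_int (max (bmat s k j) 0) / of_int (mult s k) * of_int (bmat s k i)" by simp
    also have "\<dots> = of_int (max (- bmat s j k) 0) / of_int (mult s j) * of_int (bmat s k i)"
      using max_bmat_skew[of 1 j] by simp
    finally show ?thesis using False by simp
  qed (simp add: bmat_diag[OF seed])
  also have "of_int (bmat s j i + ?al i * bmat s j k) / of_int (mult s j) + \<dots> =
      (of_int (bmat (mutate k s) j i) :: rat) / of_int (mult s j)"
    unfolding add_divide_distrib [symmetric] of_int_add [symmetric] bmat_mutate
    by (intro arg_cong2[where f = "(/)"] arg_cong[where f = of_int] refl)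
       (auto simp: bmat_diag[OF seed] algebra_simps)
  also have "\<dots> = omega (mutate k s) (frag_of i) (frag_of j)"
    by (simp add: omega_frag_of mutate_def)
  finally show "omega s (trop_N 1 s k (frag_of i)) (trop_N 1 s k (frag_of j)) =
    omega (mutate k s) (frag_of i) (frag_of j)" .
qed (simp_all add: trop_N_add omega_add_left omega_add_right)

text \<open>Since [-x]_+ = [x]_+ - x, the two signs differ by a shear along e_k. The same shear
  separates the two ends of a binomial sum, which later decides the sign.\<close>

lemma trop_N_minus_1:
  "trop_N (- 1) s k n = trop_N 1 s k n + frag_cmul (- (bmat_row s k n)) (frag_of k)"
proof -
  have "max (- bmat s k i) 0 = max (bmat s k i) 0 - bmat s k i" for i by simp
  then have "(\<Sum>i\<in>UNIV. max (- 1 * bmat s k i) 0 * coord n i) =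
    (\<Sum>i\<in>UNIV. max (1 * bmat s k i) 0 * coord n i) - (bmat_row s k n)"
    by (simp add: sum_subtractf left_diff_distrib)
  then show ?thesis
    unfolding trop_N_def
    by (simp add: add.assoc flip: frag_cmul_distrib) (simp add: algebra_simps)
qed

lemma trop_M_minus_1:
  "trop_M (- 1) s k m = trop_M 1 s k m + frag_cmul (coord m k) (p_star s (frag_of k))"
  by (rule poly_mapping_eqI)
     (auto simp: coord_trop_M lookup_add coord_p_star_frag_of bmat_diag[OF seed] algebra_simps max_def)

text \<open>The negative sign adds a shear along e_k, whose two cross terms cancel by
  skew-symmetry.\<close>

lemma omega_trop:
  assumes "\<epsilon> = 1 \<or> \<epsilon> = - 1"
  shows "omega s (trop_N \<epsilon> s k a) (trop_N \<epsilon> s k b) = omega (mutate k s) a b"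
proof (cases "\<epsilon> = 1")
  case True
  then show ?thesis by (simp add: omega_trop_1)
next
  case False
  then have \<epsilon>: "\<epsilon> = - 1" using assms by simp
  have w: "omega s (trop_N 1 s k n) (frag_of k) =
      of_int (bmat_row s k n) / of_int (mult s k)" for n
    unfolding omega_frag_of_right
    by (intro arg_cong2[where f = "(/)"] arg_cong[where f = of_int] sum.cong refl)
       (metis bmat_diag[OF seed] coord_trop_N mult_zero_left)
  define \<beta> where "\<beta> n = (bmat_row s k n)" for n
  have "omega s (trop_N \<epsilon> s k a) (trop_N \<epsilon> s k b) =
      omega s (trop_N 1 s k a) (trop_N 1 s k b)
      + of_int (- \<beta> b) * omega s (trop_N 1 s k a) (frag_of k)
      + of_int (- \<beta> a) * omega s (frag_of k) (trop_N 1 s k b)"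
    unfolding \<epsilon> trop_N_minus_1 \<beta>_def [symmetric]
    by (simp only: omega_add_left omega_add_right omega_cmul_left omega_cmul_right omega_self[OF seed])
       simp
  also have "omega s (frag_of k) (trop_N 1 s k b) = - omega s (trop_N 1 s k b) (frag_of k)"
    by (rule omega_swap[OF seed])
  finally show ?thesis
    unfolding w \<beta>_def [symmetric] omega_trop_1 by simp
qed

lemma is_seed_mutate: "is_seed (mutate k s)"
proof -
  have skew: "of_int (bmat (mutate k s) i j) / (of_int (mult s i) :: rat) =
      - (of_int (bmat (mutate k s) j i) / of_int (mult s j))" for i j
  proof -
    have "omega (mutate k s) (frag_of j) (frag_of i) = - omega (mutate k s) (frag_of i) (frag_of j)"
      unfolding omega_trop_1 [symmetric] by (rule omega_swap[OF seed])
    then show ?thesis by (simp add: omega_frag_of) (simp add: mutate_def)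
  qed
  have mult: "mult (mutate k s) = mult s" by (simp add: mutate_def)
  show ?thesis unfolding is_seed_def mult using skew mult_pos by blast
qed

lemma transport_M_eq: "transport_M s k m = trop_M 1 s k m"
proof -
  have "transport_M s k (frag_of i) = trop_M 1 s k (frag_of i)" for i
    by (rule poly_mapping_eqI)
       (auto simp: coord_trop_M transport_M_def lookup_add lookup_minus lookup_sum lookup_frag_of
         bmat_diag[OF seed] if_distrib cong: if_cong)
  moreover have "transport_M s k (a - b) = transport_M s k a - transport_M s k b" for a b
    by (simp add: transport_M_def frag_extend_diff)
  ultimately show ?thesis
    by (induction m rule: frag_all_induct)
       (simp_all add: additive_minus[of "trop_M 1 s k", OF trop_M_add], simp add: transport_M_def)
qed

lemma bmat_mutate_mutate: "bmat (mutate k (mutate k s)) i j = bmat s i j"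
  by (auto simp: mutate_def max_def algebra_simps)

text \<open>Row and column k change sign under mutation, so the positive map at
  \<open>mutate k s\<close> is the negative one at s. Two positive steps thus compose to a shear
  along p^* e_k.\<close>

lemma trop_M_trop_M_mutate:
  "trop_M 1 s k (trop_M 1 (mutate k s) k m) = m + frag_cmul (coord m k) (p_star s (frag_of k))"
  by (rule poly_mapping_eqI)
     (auto simp: coord_trop_M bmat_diag[OF seed] bmat_mutate lookup_add coord_p_star_frag_of
       algebra_simps max_def)

lemma trop_N_trop_N_mutate:
  "trop_N 1 s k (trop_N 1 (mutate k s) k n) =
     n + frag_cmul (bmat_row s k n) (frag_of k)"
proof -
  have "trop_N 1 (mutate k s) k n = trop_N (- 1) s k n"
    unfolding trop_N_def bmat_mutate by simp
  also have "\<dots> = trop_N 1 s k n + frag_cmul (- (bmat_row s k n)) (frag_of k)"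
    by (rule trop_N_minus_1)
  also have "trop_N 1 s k \<dots> = trop_N 1 s k (trop_N 1 s k n) +
      frag_cmul (- (bmat_row s k n)) (trop_N 1 s k (frag_of k))"
    by (simp only: trop_N_add additive_frag_cmul[of "trop_N 1 s k", OF trop_N_add])
  also have "trop_N 1 s k (frag_of k) = - frag_of k"
    by (rule poly_mapping_eqI)
       (simp add: trop_N_frag_of bmat_diag[OF seed] lookup_add lookup_frag_of)
  also have "frag_cmul (- z) (- frag_of k) = frag_cmul z (frag_of k)" for z
    by (rule poly_mapping_eqI) simp
  finally show ?thesis by (simp add: trop_N_involution)
qed

end

section \<open>Seeds with a compatible form\<close>

text \<open>
  The locale covers both cases: the form on \<open>M\<degree>\<close> satisfies \<open>\<lambda>(m, p\<^sup>* e_k) = - \<chi> m_k / d_k\<close>, where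
  \<open>\<chi> = 1\<close> in the quantum case and \<open>\<chi> = 0\<close> in the classical one. The set \<open>E\<close> consists of the relevant
  exponents of \<open>v\<close>.
\<close>

locale exponents =
  fixes v :: "rat \<Rightarrow> 'k::idom" and E :: "rat set" and \<chi> :: rat
  assumes E_0: "0 \<in> E"
    and E_add: "a \<in> E \<Longrightarrow> b \<in> E \<Longrightarrow> a + b \<in> E"
    and E_minus: "a \<in> E \<Longrightarrow> - a \<in> E"
    and v_0: "v 0 = 1"
    and v_add: "a \<in> E \<Longrightarrow> b \<in> E \<Longrightarrow> v (a + b) = v a * v b"
    and v_\<chi>: "a \<in> E \<Longrightarrow> v (\<chi> * a) = v a"
    and quantum_parameter_E:
      "d > 0 \<Longrightarrow> 1 / of_int d \<in> E \<Longrightarrow> quantum_parameter (\<lambda>n. v (of_int n / of_int d))"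
begin

lemma E_cmul: "a \<in> E \<Longrightarrow> of_int z * a \<in> E"
proof -
  assume a: "a \<in> E"
  have nat: "of_nat n * a \<in> E" for n
    by (induction n) (simp_all add: E_0 E_add a distrib_right)
  show ?thesis
    using nat[of "nat z"] E_minus[OF nat[of "nat (- z)"]]
    by (cases "z \<ge> 0") auto
qed

lemma E_sum: "(\<And>x. x \<in> A \<Longrightarrow> f x \<in> E) \<Longrightarrow> sum f A \<in> E"
  by (induction A rule: infinite_finite_induct) (auto simp: E_0 E_add)

text \<open>The invariant carried along mutations. With \<chi> = 0 the last clause is met by the
  zero form; with \<chi> = 1 it is compatibility extended linearly from the basis to all m.\<close>

definition seed_ok :: "'i::finite seed \<Rightarrow> bool" where
  "seed_ok s \<longleftrightarrow> is_seed s \<and> (\<forall>i. 1 / of_int (mult s i) \<in> E) \<and> (\<forall>a b. pois s a b \<in> E) \<and>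
     (\<forall>a b c. pois s (a + b) c = pois s a c + pois s b c) \<and> (\<forall>a b. pois s a b = - pois s b a) \<and>
     (\<forall>m. \<forall>k\<in>unfrozen s. pois s m (p_star s (frag_of k)) =
        - \<chi> * (of_int (coord m k) / of_int (mult s k)))"

context
  fixes s :: "'i::finite seed"
  assumes ok: "seed_ok s"
begin

lemma ok_seed: "is_seed s"
  and ok_mult: "1 / of_int (mult s i) \<in> E"
  and ok_pois_E: "pois s a b \<in> E"
  and pois_add_left: "pois s (a + b) c = pois s a c + pois s b c"
  and pois_swap: "pois s a b = - pois s b a"
  and pois_p_star_frag_of: "k \<in> unfrozen s \<Longrightarrow>
    pois s m (p_star s (frag_of k)) = - \<chi> * (of_int (coord m k) / of_int (mult s k))"
  using ok unfolding seed_ok_def by blast+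

lemma pois_add_right: "pois s a (b + c) = pois s a b + pois s a c"
  using pois_add_left[of b c a] pois_swap[of a] by (metis minus_add_distrib)

lemma pois_self: "pois s a a = 0"
  using pois_swap[of a a] by simp

lemma pois_cmul_left: "pois s (frag_cmul z a) b = of_int z * pois s a b"
  by (rule biadditive_cmul(1)[OF pois_add_left])

lemma pois_cmul_right: "pois s a (frag_cmul z b) = of_int z * pois s a b"
  by (rule biadditive_cmul(2)[OF pois_add_right])

lemma omega_E: "omega s a b \<in> E"
  unfolding omega_def
proof (intro E_sum)
  fix i j
  have "of_int (coord a i) * of_int (coord b j) * (of_int (bmat s j i) / of_int (mult s j) :: rat) =
      of_int (coord a i * coord b j * bmat s j i) * (1 / of_int (mult s j))" by simp
  then show "of_int (coord a i) * of_int (coord b j) * (of_int (bmat s j i) / of_int (mult s j)) \<in> E"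
    using E_cmul[OF ok_mult] by metis
qed

text \<open>\<open>mutate\<close> transports \<lambda> by the positive map. The negative one differs
  by a shear along p^* e_k, and the cross terms cancel because \<lambda>(m, p^* e_k) is proportional
  to m_k, which tropical mutation negates.\<close>

lemma pois_trop:
  assumes \<epsilon>: "\<epsilon> = 1 \<or> \<epsilon> = - 1" and k: "k \<in> unfrozen s"
  shows "pois s (trop_M \<epsilon> s k a) (trop_M \<epsilon> s k b) = pois (mutate k s) a b"
proof -
  have 1: "pois (mutate k s) a b = pois s (trop_M 1 s k a) (trop_M 1 s k b)"
    by (simp add: mutate_def transport_M_eq[OF ok_seed])
  let ?y = "p_star s (frag_of k)"
  have y: "pois s ?y m = \<chi> * (of_int (coord m k) / of_int (mult s k))" for m
    using pois_swap[of ?y m] pois_p_star_frag_of[OF k, of m] by simp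
  have "pois s (trop_M (- 1) s k a) (trop_M (- 1) s k b) = pois s (trop_M 1 s k a) (trop_M 1 s k b)"
    unfolding trop_M_minus_1[OF ok_seed]
    by (simp add: pois_add_left pois_add_right pois_cmul_left pois_cmul_right
        pois_p_star_frag_of[OF k] y coord_trop_M lookup_add bmat_diag[OF ok_seed] coord_p_star_frag_of
        algebra_simps)
  then show ?thesis using \<epsilon> 1 by auto
qed

lemma lattice_iso_trop:
  assumes "\<epsilon> = 1 \<or> \<epsilon> = - 1" "k \<in> unfrozen s"
  shows "lattice_iso (mutate k s) s (trop_N \<epsilon> s k) (trop_M \<epsilon> s k)"
  by (simp add: lattice_iso_def bij_trop[OF ok_seed] trop_N_add trop_M_add pairing_trop[OF ok_seed]
      omega_trop[OF ok_seed assms(1)] pois_trop[OF assms])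

text \<open>Seen from s, the second transport is \<open>trop_M (- 1)\<close>, which is not the
  inverse of the first. That \<lambda> returns therefore depends on its being transported in the
  same way by both signs.\<close>

lemma mutate_mutate_ok:
  assumes k: "k \<in> unfrozen s"
  shows "mutate k (mutate k s) = s"
proof -
  have "pois (mutate k (mutate k s)) a b = pois s a b" for a b
  proof -
    have "pois (mutate k (mutate k s)) a b =
        pois (mutate k s) (transport_M (mutate k s) k a) (transport_M (mutate k s) k b)"
      by (simp add: mutate_def[of k "mutate k s"])
    also have "\<dots> = pois s (trop_M (- 1) s k (trop_M (- 1) s k a)) (trop_M (- 1) s k (trop_M (- 1) s k b))"
    proof -
      have "trop_M 1 (mutate k s) k m = trop_M (- 1) s k m" for m
        unfolding trop_M_def bmat_mutate[OF ok_seed] by simp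
      then show ?thesis
        using pois_trop[of "- 1" k] k
        by (simp add: transport_M_eq[OF is_seed_mutate[OF ok_seed]])
    qed
    finally show ?thesis by (simp add: trop_M_involution[OF ok_seed])
  qed
  then have "pois (mutate k (mutate k s)) = pois s" by (simp add: fun_eq_iff)
  moreover have "bmat (mutate k (mutate k s)) = bmat s"
    by (simp add: fun_eq_iff bmat_mutate_mutate[OF ok_seed])
  moreover have "unfrozen (mutate k (mutate k s)) = unfrozen s" "mult (mutate k (mutate k s)) = mult s"
    "seed.more (mutate k (mutate k s)) = seed.more s"
    by (simp_all add: mutate_def)
  ultimately show ?thesis by (intro seed.equality)
qed

text \<open>For compatibility at the new seed, \<open>trop_N\<close> sends e_j to a combination of
  the unfrozen e_j and e_k, where compatibility at s applies; the pairing is then carried back by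
  \<open>pairing_trop\<close>.\<close>

lemma seed_ok_mutate:
  assumes k: "k \<in> unfrozen s"
  shows "seed_ok (mutate k s)"
  unfolding seed_ok_def
proof (intro conjI allI ballI)
  note iso = lattice_iso_trop[of 1, OF _ k, simplified]
  have pois: "pois (mutate k s) a b = pois s (trop_M 1 s k a) (trop_M 1 s k b)" for a b
    by (simp add: lattice_iso_pois[OF iso])
  show "is_seed (mutate k s)" by (rule is_seed_mutate[OF ok_seed])
  show "1 / of_int (mult (mutate k s) i) \<in> E" for i using ok_mult by (simp add: mutate_def)
  show "pois (mutate k s) a b \<in> E" for a b by (simp add: pois ok_pois_E)
  show "pois (mutate k s) (a + b) c = pois (mutate k s) a c + pois (mutate k s) b c" for a b c
    by (simp add: pois trop_M_add pois_add_left)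
  show "pois (mutate k s) a b = - pois (mutate k s) b a" for a b
    by (simp only: pois pois_swap[symmetric])
  fix m j assume "j \<in> unfrozen (mutate k s)"
  then have j: "j \<in> unfrozen s" by (simp add: mutate_def)
  let ?z = "max (1 * bmat s k j) 0 - (if j = k then 2 else 0)"
  have "pois (mutate k s) m (p_star (mutate k s) (frag_of j)) =
      pois s (trop_M 1 s k m) (p_star s (trop_N 1 s k (frag_of j)))"
    by (simp add: pois lattice_iso_p_star[OF iso mult_pos[OF ok_seed]])
  also have "\<dots> = - \<chi> * pairing s (trop_M 1 s k m) (trop_N 1 s k (frag_of j))"
    unfolding trop_N_frag_of
    by (simp only: p_star_add p_star_cmul pois_add_right pois_cmul_right pois_p_star_frag_of[OF k]
        pois_p_star_frag_of[OF j] pairing_add_right pairing_cmul_right pairing_frag_of_right)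
       (simp add: algebra_simps)
  also have "\<dots> = - \<chi> * (of_int (coord m j) / of_int (mult (mutate k s) j))"
    unfolding pairing_trop[OF ok_seed] by (simp add: pairing_frag_of_right mutate_def)
  finally show "pois (mutate k s) m (p_star (mutate k s) (frag_of j)) =
    - \<chi> * (of_int (coord m j) / of_int (mult (mutate k s) j))" .
qed

lemma quantum_parameter_v_sub: "quantum_parameter (v_sub v s k)"
  using quantum_parameter_E[OF mult_pos[OF ok_seed] ok_mult] unfolding v_sub_def by simp

end

lemma unfrozen_mutates [simp]: "unfrozen (mutates ks s) = unfrozen s"
  and mult_mutates [simp]: "mult (mutates ks s) = mult s"
  by (induction ks arbitrary: s) (simp_all, simp_all add: mutate_def)

lemma seed_ok_mutates: "seed_ok s \<Longrightarrow> set ks \<subseteq> unfrozen s \<Longrightarrow> seed_ok (mutates ks s)"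
proof (induction ks arbitrary: s)
  case (Cons k ks)
  then have "seed_ok (mutate k s)" by (auto intro: seed_ok_mutate)
  moreover have "unfrozen (mutate k s) = unfrozen s" by (simp add: mutate_def)
  ultimately show ?case using Cons by simp
qed simp

end

section \<open>The degree valuation of a total order\<close>

text \<open>The order on \<open>nat \<Rightarrow>\<^sub>0 int\<close> is lexicographic, total and
  translation invariant. It is pulled back along an injection of the index type, which carries no
  order, into the naturals.\<close>

lemma exists_positive_embedding:
  "\<exists>\<nu> :: 'i::finite lattice \<Rightarrow> (nat \<Rightarrow>\<^sub>0 int).
     (\<forall>a b. \<nu> (a + b) = \<nu> a + \<nu> b) \<and> inj \<nu> \<and> (\<forall>i. \<nu> (frag_of i) > 0)"
proof -
  obtain idx :: "'i \<Rightarrow> nat" where idx: "inj idx"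
    using finite_imp_inj_to_nat_seg[OF finite_UNIV] by blast
  define \<nu> where "\<nu> m = (\<Sum>i\<in>UNIV. single (idx i) (coord m i))" for m
  have lookup: "coord (\<nu> m) (idx i) = coord m i" for m i
  proof -
    have "coord (\<nu> m) (idx i) = (\<Sum>j\<in>UNIV. if j = i then coord m i else 0)"
      unfolding \<nu>_def lookup_sum
      by (intro sum.cong refl) (auto simp: lookup_single when_def inj_eq[OF idx])
    then show ?thesis by simp
  qed
  show ?thesis
  proof (intro exI[of _ \<nu>] conjI allI)
    show "\<nu> (a + b) = \<nu> a + \<nu> b" for a b
      by (simp add: \<nu>_def lookup_add single_add sum.distrib)
    show "inj \<nu>"
      by (rule injI, rule poly_mapping_eqI) (metis lookup)
    show "\<nu> (frag_of i) > 0" for i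
    proof -
      have "\<nu> (frag_of i) = (\<Sum>j\<in>UNIV. if j = i then single (idx i) 1 else 0)"
        unfolding \<nu>_def by (intro sum.cong refl) auto
      then have "\<nu> (frag_of i) = single (idx i) 1" by simp
      then show ?thesis
        by (simp add: less_poly_mapping.rep_eq less_fun_def lookup_single when_def)
    qed
  qed
qed

locale valued_torus = quantum_torus v form \<iota>
  for v :: "rat \<Rightarrow> 'k::idom"
    and form :: "'i::finite lattice \<Rightarrow> 'i lattice \<Rightarrow> rat"
    and \<iota> :: "('i, 'k) LP \<Rightarrow> 'f::division_ring" +
  fixes \<nu> :: "'i lattice \<Rightarrow> 'o::linordered_ab_group_add"
  assumes \<nu>_add: "\<nu> (a + b) = \<nu> a + \<nu> b"
    and \<nu>_inj: "inj \<nu>"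
begin

lemma \<nu>_eq_iff: "\<nu> a = \<nu> b \<longleftrightarrow> a = b"
  using \<nu>_inj by (simp add: inj_eq)

definition lowest :: "('i, 'k) LP \<Rightarrow> 'i lattice \<Rightarrow> bool" where
  "lowest a p \<longleftrightarrow> p \<in> keys a \<and> (\<forall>n\<in>keys a. n \<noteq> p \<longrightarrow> \<nu> p < \<nu> n)"

lemma lowest_exists:
  assumes "a \<noteq> 0"
  obtains p where "lowest a p"
proof -
  let ?S = "\<nu> ` keys a"
  have S: "finite ?S" "?S \<noteq> {}" using assms by auto
  obtain p where p: "p \<in> keys a" "\<nu> p = Min ?S"
    using Min_in[OF S] unfolding image_iff by metis
  have "\<nu> p < \<nu> n" if "n \<in> keys a" "n \<noteq> p" for n
  proof -
    have "\<nu> p \<le> \<nu> n" unfolding p(2) using S(1) that(1) by (intro Min_le) auto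
    then show ?thesis using that(2) \<nu>_eq_iff by (simp add: order_less_le)
  qed
  then show ?thesis using p(1) that[of p] by (simp add: lowest_def)
qed

lemma lowest_unique: "lowest a p \<Longrightarrow> lowest a p' \<Longrightarrow> p = p'"
  unfolding lowest_def by (metis less_asym)

lemma lowest_nonzero: "lowest a p \<Longrightarrow> a \<noteq> 0"
  by (auto simp: lowest_def)

lemma lowest_single: "c \<noteq> 0 \<Longrightarrow> lowest (single m c) m"
  by (simp add: lowest_def)

text \<open>By translation invariance (p, r) is the only pair of exponents with sum p + r, so
  nothing can cancel its coefficient, a product of nonzero scalars.\<close>

lemma lowest_mult:
  assumes "lowest a p" "lowest b r"
  shows "lowest (tmul a b) (p + r)"
proof -
  have pr: "p \<in> keys a" "r \<in> keys b" using assms by (auto simp: lowest_def)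
  have less: "\<nu> (p + r) < \<nu> (m + n)"
    if "m \<in> keys a" "n \<in> keys b" "(m, n) \<noteq> (p, r)" for m n
    using assms that unfolding lowest_def \<nu>_add
    by (cases "m = p"; cases "n = r") (auto intro: add_strict_mono)
  let ?c = "\<lambda>m n. v (form m n) * lookup a m * lookup b n"
  have lookup: "lookup (tmul a b) x =
      (\<Sum>m\<in>keys a. \<Sum>n\<in>keys b. if m + n = x then ?c m n else 0)" for x
    unfolding twisted_mult_def lookup_sum
    by (intro sum.cong refl) (simp add: lookup_single when_def)
  have "lookup (tmul a b) (p + r) =
      (\<Sum>m\<in>keys a. \<Sum>n\<in>keys b. if m = p \<and> n = r then ?c p r else 0)"
    unfolding lookup
  proof (intro sum.cong refl)
    fix m n assume "m \<in> keys a" "n \<in> keys b"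
    then show "(if m + n = p + r then ?c m n else 0) = (if m = p \<and> n = r then ?c p r else 0)"
      using less[of m n] by auto
  qed
  also have "\<dots> = (\<Sum>m\<in>keys a. if m = p then ?c p r else 0)"
    using pr by (intro sum.cong refl) auto
  also have "\<dots> = ?c p r" using pr by simp
  finally have "p + r \<in> keys (tmul a b)"
    using pr by (simp add: in_keys_iff v_form_nonzero)
  moreover have "\<nu> (p + r) < \<nu> x" if x: "x \<in> keys (tmul a b)" "x \<noteq> p + r" for x
  proof -
    have "lookup (tmul a b) x \<noteq> 0" using x(1) by (simp add: in_keys_iff)
    then obtain m where m: "m \<in> keys a"
      "(\<Sum>n\<in>keys b. if m + n = x then ?c m n else 0) \<noteq> 0"
      unfolding lookup by (rule sum.not_neutral_contains_not_neutral)
    from m(2) obtain n where "n \<in> keys b" "(if m + n = x then ?c m n else 0) \<noteq> 0"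
      by (rule sum.not_neutral_contains_not_neutral)
    then show ?thesis using less[OF m(1), of n] x(2) by (auto split: if_splits)
  qed
  ultimately show ?thesis by (simp add: lowest_def)
qed

lemma lowest_add:
  assumes "lowest a p" "\<And>n. n \<in> keys b \<Longrightarrow> \<nu> p < \<nu> n"
  shows "lowest (a + b) p"
proof -
  have "p \<notin> keys b" using assms(2) by blast
  then have "p \<in> keys (a + b)"
    using assms(1) by (auto simp: lowest_def in_keys_iff lookup_add)
  then show ?thesis
    using assms keys_add[of a b] unfolding lowest_def by blast
qed

text \<open>A valuation on the skew-field that records the lowest exponent itself rather than its
  position in the order. Being a relation, it needs no value at 0.\<close>

definition has_deg :: "'f \<Rightarrow> 'i lattice \<Rightarrow> bool" where
  "has_deg x n \<longleftrightarrow> (\<exists>a b p r. lowest a p \<and> lowest b r \<and> x = \<iota> a * inverse (\<iota> b) \<and> n = p - r)"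

lemma has_degI: "lowest a p \<Longrightarrow> lowest b r \<Longrightarrow> has_deg (\<iota> a * inverse (\<iota> b)) (p - r)"
  unfolding has_deg_def by blast

lemma has_degE:
  assumes "has_deg x n"
  obtains a b p r where "lowest a p" "lowest b r" "x = \<iota> a * inverse (\<iota> b)" "n = p - r"
  using assms unfolding has_deg_def by blast

lemma has_deg_nonzero: "has_deg x n \<Longrightarrow> x \<noteq> 0"
  by (auto elim!: has_degE simp: \<iota>_eq_0 dest: lowest_nonzero)

lemma has_deg_\<iota>: "lowest a p \<Longrightarrow> has_deg (\<iota> a) p"
  using has_degI[of a p 1 0] lowest_single[of 1 0] by (simp add: \<iota>_1)

text \<open>After expanding two fractions by an Ore relation their numerators and denominators
  agree, and lowest exponents add.\<close>

lemma has_deg_unique: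
  assumes "has_deg x n" "has_deg x n'"
  shows "n = n'"
proof -
  from assms(1) obtain a b p r where 1: "lowest a p" "lowest b r" "x = \<iota> a * inverse (\<iota> b)" "n = p - r"
    by (rule has_degE)
  from assms(2) obtain a' b' p' r' where 2: "lowest a' p'" "lowest b' r'"
    "x = \<iota> a' * inverse (\<iota> b')" "n' = p' - r'" by (rule has_degE)
  note nz = 1(1,2)[THEN lowest_nonzero] 2(1,2)[THEN lowest_nonzero]
  obtain c d where d: "d \<noteq> 0" "tmul b' d = tmul b c" by (rule oreE[OF nz(2)])
  have c: "c \<noteq> 0" using d nz tmul_eq_0 by metis
  obtain pc pd where low: "lowest c pc" "lowest d pd" using lowest_exists c d(1) by metis
  have "\<iota> (tmul a c) * inverse (\<iota> (tmul b c)) = \<iota> (tmul a' d) * inverse (\<iota> (tmul b' d))"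
    using nz c d(1) 1(3) 2(3) by (simp add: \<iota>_mult fraction_cancel_right \<iota>_eq_0)
  then have "tmul a c = tmul a' d"
    using d nz c by (simp add: \<iota>_eq_iff \<iota>_eq_0 tmul_eq_0)
  then have "p + pc = p' + pd"
    using lowest_unique lowest_mult[OF 1(1) low(1)] lowest_mult[OF 2(1) low(2)] by simp
  moreover have "r + pc = r' + pd"
    using lowest_unique lowest_mult[OF 1(2) low(1)] lowest_mult[OF 2(2) low(2)] d(2) by simp
  ultimately show ?thesis unfolding 1(4) 2(4) by (metis add_diff_cancel_right)
qed

lemma has_deg_mult:
  assumes "has_deg x n" "has_deg x' n'"
  shows "has_deg (x * x') (n + n')"
proof -
  from assms(1) obtain a b p r where 1: "lowest a p" "lowest b r" "x = \<iota> a * inverse (\<iota> b)" "n = p - r"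
    by (rule has_degE)
  from assms(2) obtain a' b' p' r' where 2: "lowest a' p'" "lowest b' r'"
    "x' = \<iota> a' * inverse (\<iota> b')" "n' = p' - r'" by (rule has_degE)
  note nz = 1(1,2)[THEN lowest_nonzero] 2(1,2)[THEN lowest_nonzero]
  obtain c d where d: "d \<noteq> 0" "tmul a' d = tmul b c" by (rule oreE[OF nz(2)])
  have c: "c \<noteq> 0" using d nz tmul_eq_0 by metis
  obtain pc pd where low: "lowest c pc" "lowest d pd" using lowest_exists c d(1) by metis
  have "inverse (\<iota> b) * \<iota> a' = \<iota> c * inverse (\<iota> d)"
    using left_fraction_iff[of "\<iota> b" "\<iota> d"] d nz by (simp add: \<iota>_eq_0 flip: \<iota>_mult)
  then have "x * x' = \<iota> a * (\<iota> c * inverse (\<iota> d)) * inverse (\<iota> b')"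
    unfolding 1(3) 2(3) by (simp add: mult.assoc) (simp flip: mult.assoc)
  also have "\<dots> = \<iota> (tmul a c) * inverse (\<iota> (tmul b' d))"
    using nz d(1) by (simp add: \<iota>_mult nonzero_inverse_mult_distrib \<iota>_eq_0 mult.assoc)
  finally have "has_deg (x * x') ((p + pc) - (r' + pd))"
    using has_degI[OF lowest_mult[OF 1(1) low(1)] lowest_mult[OF 2(2) low(2)]] by simp
  moreover have "p' + pd = r + pc"
    using lowest_unique lowest_mult[OF 2(1) low(2)] lowest_mult[OF 1(2) low(1)] d(2) by simp
  then have "(p + pc) - (r' + pd) = n + n'"
    unfolding 1(4) 2(4) by (simp add: algebra_simps)
  ultimately show ?thesis by simp
qed

lemma has_deg_inverse:
  assumes "has_deg x n"
  shows "has_deg (inverse x) (- n)"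
proof -
  from assms obtain a b p r where 1: "lowest a p" "lowest b r" "x = \<iota> a * inverse (\<iota> b)" "n = p - r"
    by (rule has_degE)
  then have "inverse x = \<iota> b * inverse (\<iota> a)"
    by (simp add: nonzero_inverse_mult_distrib \<iota>_eq_0 lowest_nonzero)
  then show ?thesis using has_degI[OF 1(2,1)] 1(4) by simp
qed

lemma has_deg_add:
  assumes x: "has_deg x n" and x': "x' = 0 \<or> (\<exists>n'. has_deg x' n' \<and> \<nu> n < \<nu> n')"
  shows "has_deg (x + x') n"
proof (cases "x' = 0")
  case False
  then obtain n' where n': "has_deg x' n'" "\<nu> n < \<nu> n'" using x' by blast
  obtain a a' p where p: "p \<noteq> 0" "x = \<iota> a * inverse (\<iota> p)" "x' = \<iota> a' * inverse (\<iota> p)"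
    by (rule common_denominatorE)
  have "a \<noteq> 0" "a' \<noteq> 0" using has_deg_nonzero[OF x] p False by (auto simp: \<iota>_0)
  then obtain r r' rp where low: "lowest a r" "lowest a' r'" "lowest p rp"
    using lowest_exists p(1) by metis
  have n: "n = r - rp" "n' = r' - rp"
    using has_deg_unique x n'(1) has_degI low p(2,3) by metis+
  have "\<nu> r < \<nu> r'"
    using n'(2) additive_minus(3)[of \<nu>, OF \<nu>_add] unfolding n by simp
  then have "lowest (a + a') r"
    using low(1,2) by (intro lowest_add) (auto simp: lowest_def intro: less_trans)
  then have "has_deg (\<iota> (a + a') * inverse (\<iota> p)) (r - rp)" by (rule has_degI[OF _ low(3)])
  then show ?thesis by (simp add: p(2,3) n(1) \<iota>_add distrib_right)
qed (use x in simp)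

lemma has_deg_sum:
  assumes "finite A" "s \<in> A" "has_deg (f s) n"
    and "\<And>i. i \<in> A \<Longrightarrow> i \<noteq> s \<Longrightarrow> f i = 0 \<or> (\<exists>n'. has_deg (f i) n' \<and> \<nu> n < \<nu> n')"
  shows "has_deg (sum f A) n"
proof -
  have "has_deg (f s + sum f B) n" if "finite B" "B \<subseteq> A - {s}" for B
    using that
  proof (induction B rule: finite_induct)
    case (insert i B)
    then have i: "i \<in> A" "i \<noteq> s" and B: "has_deg (f s + sum f B) n" by auto
    have "has_deg ((f s + sum f B) + f i) n" by (rule has_deg_add[OF B assms(4)[OF i]])
    then show ?case using insert by (simp add: add_ac)
  qed (use assms(3) in simp)
  from this[of "A - {s}"] show ?thesis using assms(1,2) by (simp add: sum.remove)
qed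

lemma has_deg_K: "c \<noteq> 0 \<Longrightarrow> has_deg (K c) 0"
  unfolding K_def by (intro has_deg_\<iota> lowest_single)

lemma has_deg_Z: "has_deg (Z m) m"
  unfolding Z_def by (intro has_deg_\<iota> lowest_single) simp

text \<open>The nonzero exponents of a pointed polynomial are nonnegative combinations of the e_i,
  hence positive in the order, so its lowest term is the constant 1.\<close>

lemma has_X_degree_has_deg:
  assumes pos: "\<And>i. \<nu> (frag_of i) > 0" and "has_X_degree t \<iota> x n"
  shows "has_deg x n"
proof -
  have \<nu>_0: "\<nu> 0 = 0" by (rule additive_minus(1)[OF \<nu>_add])
  have "\<nu> n > 0" if n: "\<And>i. coord n i \<ge> 0" "n \<noteq> 0" for n
  proof -
    have nat: "\<nu> (frag_cmul (int r) (frag_of i)) \<ge> 0 \<and> (r > 0 \<longrightarrow> \<nu> (frag_cmul (int r) (frag_of i)) > 0)"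
      for r i
      by (induction r) (use pos[of i] in \<open>auto simp: \<nu>_0 frag_cmul_distrib \<nu>_add
          intro: add_pos_nonneg add_nonneg_nonneg order_less_imp_le\<close>)
    have \<nu>_sum: "\<nu> (sum f A) = (\<Sum>i\<in>A. \<nu> (f i))" for f and A :: "'i set"
      by (induction A rule: infinite_finite_induct) (simp_all add: \<nu>_0 \<nu>_add)
    have "\<exists>i. coord n i \<noteq> 0" using n(2) by (metis lookup_zero poly_mapping_eqI)
    then obtain i where i: "coord n i > 0" using n(1) by (metis order_less_le)
    have "\<nu> n = (\<Sum>i\<in>UNIV. \<nu> (frag_cmul (coord n i) (frag_of i)))"
      by (subst lattice_expansion[of n]) (rule \<nu>_sum)
    also have "\<dots> > 0"
      using nat[of "nat (coord n _)"] n(1) i by (intro sum_pos2[of _ i]) auto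
    finally show ?thesis .
  qed
  then have "lowest P 0" if "pointed_poly t P" for P
    using that unfolding lowest_def pointed_poly_def by (auto simp: in_keys_iff \<nu>_0)
  then show ?thesis
    using assms(2) has_deg_mult[OF has_deg_mult[OF has_deg_Z has_deg_\<iota>] has_deg_inverse[OF has_deg_\<iota>]]
    unfolding has_X_degree_def Z_def by fastforce
qed

text \<open>The exponents of a binomial sum lie on a line in direction y, so the lowest term sits at
  one of the two ends, where the coefficient is 1; the sign of \<theta> y decides which. The
  resulting exponent is linear in m whatever the sign of c m, and this is what makes degrees into
  lattice maps.\<close>

lemma has_deg_mut_elem:
  assumes "mutation_direction v form' \<iota>' q y c"
    and iso: "algebra_iso \<iota>' \<iota> g"
    and \<theta>: "\<And>a b. \<theta> (a + b) = \<theta> a + \<theta> b"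
    and Z: "\<And>m. has_deg (g (\<iota>' (single m 1))) (\<theta> m)"
    and y: "\<theta> y \<noteq> 0"
  shows "has_deg (g (mutation_direction.mut_elem \<iota>' q y c m))
    (\<theta> (if \<nu> (\<theta> y) > 0 then m else m + frag_cmul (- c m) y))"
proof -
  interpret M: mutation_direction v form' \<iota>' q y c by fact
  note g = algebra_iso_imp_ring_iso[OF iso]
  have gK: "g (M.K d) = K d" for d using iso by (simp add: algebra_iso_def M.K_def K_def)
  note cmul = additive_frag_cmul[of \<theta>, OF \<theta>]
  have \<nu>y: "\<nu> (\<theta> y) < 0" if "\<not> \<nu> (\<theta> y) > 0"
    using that y \<nu>_eq_iff[of "\<theta> y" 0] additive_minus(1)[of \<nu>, OF \<nu>_add] by auto
  have \<nu>_cmul_pos: "\<nu> (frag_cmul (int s) a) > 0" if "\<nu> a > 0" "s > 0" for s a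
    using that(2)
  proof (induction s)
    case (Suc s)
    then show ?case
      using that(1) by (cases "s = 0") (auto simp: frag_cmul_distrib \<nu>_add intro: add_pos_pos)
  qed simp
  have sum: "has_deg (g (\<iota>' (M.binom_sum m b)))
      (\<theta> (if \<nu> (\<theta> y) > 0 then m else m + frag_cmul (int b) y))" for m b
  proof -
    let ?f = "\<lambda>s. K (q_binom q b s) * g (M.Z (m + frag_cmul (int s) y))"
    let ?d = "\<lambda>s. \<theta> m + frag_cmul (int s) (\<theta> y)"
    have deg: "has_deg (?f s) (?d s)" if "q_binom q b s \<noteq> 0" for s
      using has_deg_mult[OF has_deg_K[OF that] Z[of "m + frag_cmul (int s) y"]]
      by (simp add: M.Z_def \<theta> cmul)
    have "g (\<iota>' (M.binom_sum m b)) = (\<Sum>s\<le>b. ?f s)"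
      by (simp add: M.\<iota>_binom_sum ring_iso_sum[OF g] ring_iso_mult[OF g] gK)
    moreover have "has_deg (\<Sum>s\<le>b. ?f s) (?d 0)" if pos: "\<nu> (\<theta> y) > 0"
    proof (rule has_deg_sum[of _ 0])
      fix s assume "s \<noteq> (0 :: nat)"
      then have "\<nu> (?d 0) < \<nu> (?d s)" using \<nu>_cmul_pos[OF pos, of s] by (simp add: \<nu>_add)
      then show "?f s = 0 \<or> (\<exists>n'. has_deg (?f s) n' \<and> \<nu> (?d 0) < \<nu> n')"
        using deg[of s] by (cases "q_binom q b s = 0") auto
    qed (use deg[of 0] in auto)
    moreover have "has_deg (\<Sum>s\<le>b. ?f s) (?d b)" if neg: "\<not> \<nu> (\<theta> y) > 0"
    proof (rule has_deg_sum[of _ b])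
      fix s assume s: "s \<in> {..b}" "s \<noteq> b"
      have "\<nu> (- \<theta> y) > 0" using \<nu>y[OF neg] by (simp add: additive_minus(2)[of \<nu>, OF \<nu>_add])
      then have "\<nu> (frag_cmul (int (b - s)) (- \<theta> y)) > 0" using s by (intro \<nu>_cmul_pos) auto
      moreover have "?d s = ?d b + frag_cmul (int (b - s)) (- \<theta> y)"
        by (rule poly_mapping_eqI) (use s in \<open>simp add: lookup_add of_nat_diff algebra_simps\<close>)
      ultimately have "\<nu> (?d b) < \<nu> (?d s)" by (simp add: \<nu>_add)
      then show "?f s = 0 \<or> (\<exists>n'. has_deg (?f s) n' \<and> \<nu> (?d b) < \<nu> n')"
        using deg[of s] by (cases "q_binom q b s = 0") auto
    qed (use deg[of b] in auto)
    ultimately show ?thesis by (simp add: \<theta> cmul)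
  qed
  show ?thesis
  proof (cases "c m \<le> 0")
    case True
    then have "int (nat (- c m)) = - c m" by simp
    then show ?thesis using sum[of m "nat (- c m)"] True by (simp add: M.mut_elem_def split: if_splits)
  next
    case False
    then have "int (nat (c m)) = c m" by simp
    then have "has_deg (g (M.mut_elem m)) (- \<theta> (if \<nu> (\<theta> y) > 0 then - m else - m + frag_cmul (c m) y))"
      using has_deg_inverse[OF sum[of "- m" "nat (c m)"]] False
      by (simp add: M.mut_elem_def ring_iso_inverse[OF g] split: if_splits)
    moreover have "- \<theta> (if \<nu> (\<theta> y) > 0 then - m else - m + frag_cmul (c m) y) =
        \<theta> (if \<nu> (\<theta> y) > 0 then m else m + frag_cmul (- c m) y)"
      unfolding additive_minus(2)[of \<theta>, OF \<theta>, symmetric] by (simp flip: minus_frag_cmul)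
    ultimately show ?thesis by simp
  qed
qed

end

section \<open>The mutation systems of a seed\<close>

lemma trop_M_frag_of_self:
  "trop_M \<epsilon> s k (frag_of k) =
     - frag_of k + (\<Sum>j\<in>UNIV. frag_cmul (max (- \<epsilon> * bmat s j k) 0) (frag_of j))"
  by (rule poly_mapping_eqI)
     (simp add: trop_M_def lookup_add lookup_minus lookup_sum)

lemma trop_M_frag_of_other: "i \<noteq> k \<Longrightarrow> trop_M \<epsilon> s k (frag_of i) = frag_of i"
  by (simp add: trop_M_def)

lemma trop_N_frag_of_self: "is_seed s \<Longrightarrow> trop_N \<epsilon> s k (frag_of k) = - frag_of k"
  by (rule poly_mapping_eqI) (simp add: trop_N_frag_of bmat_diag lookup_add)

lemma sum_bmat_trop_N:
  assumes "is_seed s"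
  shows "(bmat_row s k (trop_N \<epsilon> s k n)) = (bmat_row s k n)"
  by (intro sum.cong refl) (metis bmat_diag[OF assms] coord_trop_N mult_zero_left)

lemma sum_bmat_frag_of:
  fixes s :: "'i::finite seed"
  shows "(bmat_row s k (frag_of j)) = bmat s k j"
proof -
  have "(bmat_row s k (frag_of j)) = (\<Sum>i\<in>UNIV. if i = j then bmat s k j else 0)"
    by (intro sum.cong refl) auto
  also have "\<dots> = bmat s k j" by simp
  finally show ?thesis .
qed

definition mutation_class :: "'i::finite seed \<Rightarrow> 'i seed set" where
  "mutation_class t = {mutates ks t |ks. set ks \<subseteq> unfrozen t}"

lemma mutates_in_mutation_class: "set ks \<subseteq> unfrozen t \<Longrightarrow> mutates ks t \<in> mutation_class t"
  by (auto simp: mutation_class_def)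

lemma self_in_mutation_class: "t \<in> mutation_class t"
  using mutates_in_mutation_class[of "[]" t] by simp

lemma mutate_in_mutation_class:
  assumes "s \<in> mutation_class t" "k \<in> unfrozen t"
  shows "mutate k s \<in> mutation_class t"
proof -
  obtain ks where "set ks \<subseteq> unfrozen t" "s = mutates ks t"
    using assms(1) by (auto simp: mutation_class_def)
  then show ?thesis
    using assms(2) mutates_in_mutation_class[of "ks @ [k]" t] by (simp add: mutates_snoc)
qed

context exponents
begin

lemma unfrozen_mutation_class: "s \<in> mutation_class t \<Longrightarrow> unfrozen s = unfrozen t"
  by (auto simp: mutation_class_def)

lemma seed_ok_mutation_class: "seed_ok t \<Longrightarrow> s \<in> mutation_class t \<Longrightarrow> seed_ok s"
  by (auto simp: mutation_class_def seed_ok_mutates)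

lemma A_torus:
  assumes ok: "seed_ok s" and "skew_field_of_fractions (A_mult v s) \<iota>"
  shows "quantum_torus v (pois s) \<iota>"
  using assms(2) unfolding A_mult_def
  by unfold_locales
     (simp_all add: pois_add_left[OF ok] pois_add_right[OF ok] v_add ok_pois_E[OF ok]
       pois_self[OF ok] v_0)

lemma X_torus:
  assumes ok: "seed_ok s" and "skew_field_of_fractions (X_mult v s) \<iota>"
  shows "quantum_torus v (X_form s) \<iota>"
proof -
  have add: "v (- (a + b)) = v (- a) * v (- b)" if "a \<in> E" "b \<in> E" for a b
    using v_add[OF E_minus[OF that(1)] E_minus[OF that(2)]] by (simp add: add.commute)
  show ?thesis
    using assms(2) unfolding X_mult_def
    by unfold_locales
       (simp_all add: omega_add_left omega_add_right add omega_E[OF ok]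
         omega_self[OF ok_seed[OF ok]] v_0 del: minus_add_distrib)
qed

lemma A_direction:
  assumes ok: "seed_ok s" and "skew_field_of_fractions (A_mult v s) \<iota>" and k: "k \<in> unfrozen s"
  shows "mutation_direction v (pois s) \<iota> (v_sub v s k) (p_star s (frag_of k)) (\<lambda>m. coord m k)"
proof -
  interpret quantum_torus v "pois s" \<iota> by (rule A_torus[OF assms(1,2)])
  interpret quantum_parameter "v_sub v s k" by (rule quantum_parameter_v_sub[OF ok])
  show ?thesis
  proof unfold_locales
    fix m
    have E: "of_int (- coord m k) / of_int (mult s k) \<in> E"
      using E_cmul[OF ok_mult[OF ok], of "- coord m k" k] by simp
    \<comment> \<open>The factor \<chi> is absorbed by \<open>v_\<chi>\<close>: it is 1 in the
      quantum case, and v is constant in the classical one.\<close>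
    have "pois s m (p_star s (frag_of k)) = \<chi> * (of_int (- coord m k) / of_int (mult s k))"
      by (simp add: pois_p_star_frag_of[OF ok k])
    then show "v (pois s m (p_star s (frag_of k))) = v_sub v s k (- coord m k)"
      by (simp only: v_\<chi>[OF E] v_sub_def)
  qed (simp_all add: lookup_add coord_p_star_frag_of bmat_diag[OF ok_seed[OF ok]])
qed

lemma X_direction:
  assumes ok: "seed_ok s" and "skew_field_of_fractions (X_mult v s) \<iota>"
  shows "mutation_direction v (X_form s) \<iota> (v_sub v s k) (frag_of k)
    (bmat_row s k)"
proof -
  interpret quantum_torus v "X_form s" \<iota> by (rule X_torus[OF assms])
  interpret quantum_parameter "v_sub v s k" by (rule quantum_parameter_v_sub[OF ok])
  show ?thesis
  proof unfold_locales
    show "(bmat_row s k (frag_of k)) = 0"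
      by (simp only: sum_bmat_frag_of bmat_diag[OF ok_seed[OF ok]])
  qed (simp_all add: lookup_add distrib_left sum.distrib omega_frag_of_right v_sub_def)
qed

lemma A_mutation_monomial:
  assumes ok: "seed_ok s" and k: "k \<in> unfrozen s"
    and frac: "skew_field_of_fractions (A_mult v s) \<iota>"
      "skew_field_of_fractions (A_mult v (mutate k s)) \<iota>'"
    and h: "is_A_mutation s k \<iota>' \<iota> h"
  shows "h (\<iota>' (single m 1)) = mutation_direction.mut_elem \<iota> (v_sub v s k)
    (p_star s (frag_of k)) (\<lambda>m. coord m k) (trop_M 1 s k m)"
proof (rule mutation_on_monomials[where v = v and h = h and \<iota>' = \<iota>' and
      \<tau> = "trop_M 1 s k" and form = "pois s" and form' = "pois (mutate k s)"])
  show "quantum_torus v (pois (mutate k s)) \<iota>'" by (rule A_torus[OF seed_ok_mutate[OF ok k] frac(2)])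
  show dir: "mutation_direction v (pois s) \<iota> (v_sub v s k) (p_star s (frag_of k)) (\<lambda>m. coord m k)"
    by (rule A_direction[OF ok frac(1) k])
  interpret mutation_direction v "pois s" \<iota> "v_sub v s k" "p_star s (frag_of k)" "\<lambda>m. coord m k"
    by (rule dir)
  show "algebra_iso \<iota>' \<iota> h" using h by (simp add: is_A_mutation_def)
  show "v (pois (mutate k s) a b) = v (pois s (trop_M 1 s k a) (trop_M 1 s k b))" for a b
    by (simp add: pois_trop[OF ok _ k])
  show "h (\<iota>' (single (frag_of i) 1)) = mut_elem (trop_M 1 s k (frag_of i))" for i
  proof (cases "i = k")
    case True
    let ?m = "trop_M 1 s k (frag_of k)"
    have c: "coord ?m k = - 1" by (simp add: coord_trop_M bmat_diag[OF ok_seed[OF ok]])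
    \<comment> \<open>The coordinate -1 leaves two terms, one for each sign of the tropical
      mutation: the two monomials of the exchange relation.\<close>
    have "?m + p_star s (frag_of k) = trop_M (- 1) s k (frag_of k)"
      by (simp add: trop_M_minus_1[OF ok_seed[OF ok]])
    then have mut: "mut_elem ?m = \<iota> (single ?m 1) +
        \<iota> (single (trop_M (- 1) s k (frag_of k)) 1)"
      by (simp add: mut_elem_def c binom_sum_def \<iota>_add q_binom_self[of 1, simplified])
    show ?thesis
      unfolding True mut using h unfolding is_A_mutation_def trop_M_frag_of_self by simp
  next
    case False
    then show ?thesis
      using h by (simp add: is_A_mutation_def trop_M_frag_of_other mut_elem_c_0 Z_def)
  qed
qed (rule trop_M_add)

lemma X_mutation_monomial:
  assumes ok: "seed_ok s" and k: "k \<in> unfrozen s"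
    and frac: "skew_field_of_fractions (X_mult v s) \<iota>"
      "skew_field_of_fractions (X_mult v (mutate k s)) \<iota>'"
    and h: "is_X_mutation v s k \<iota>' \<iota> h"
  shows "h (\<iota>' (single m 1)) = mutation_direction.mut_elem \<iota> (v_sub v s k)
    (frag_of k) (bmat_row s k) (trop_N 1 s k m)"
proof (rule mutation_on_monomials[where v = v and h = h and \<iota>' = \<iota>' and
      \<tau> = "trop_N 1 s k" and form = "X_form s" and
      form' = "X_form (mutate k s)"])
  note seed = ok_seed[OF ok]
  show "quantum_torus v (X_form (mutate k s)) \<iota>'"
    by (rule X_torus[OF seed_ok_mutate[OF ok k] frac(2)])
  show dir: "mutation_direction v (X_form s) \<iota> (v_sub v s k) (frag_of k)
    (bmat_row s k)"
    by (rule X_direction[OF ok frac(1)])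
  interpret mutation_direction v "X_form s" \<iota> "v_sub v s k" "frag_of k"
    "bmat_row s k"
    by (rule dir)
  show "algebra_iso \<iota>' \<iota> h" using h by (simp add: is_X_mutation_def)
  show "v (- omega (mutate k s) a b) = v (- omega s (trop_N 1 s k a) (trop_N 1 s k b))" for a b
    by (simp add: omega_trop_1[OF seed])
  let ?c = "bmat_row s k"
  show "h (\<iota>' (single (frag_of i) 1)) = mut_elem (trop_N 1 s k (frag_of i))" for i
  proof (cases "i = k")
    case True
    have "?c (- frag_of k) = 0" unfolding c_minus sum_bmat_frag_of bmat_diag[OF seed] by simp
    then have "mut_elem (- frag_of k) = inverse (Z (frag_of k))" by (simp add: mut_elem_c_0 Z_minus)
    then show ?thesis
      using h True by (simp add: is_X_mutation_def trop_N_frag_of_self[OF seed] Z_def)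
  next
    case False
    have c: "?c (trop_N 1 s k (frag_of i)) = bmat s k i"
      by (simp only: sum_bmat_trop_N[OF seed] sum_bmat_frag_of)
    show ?thesis
    proof (cases "bmat s k i \<le> 0")
      case True
      have e: "trop_N 1 s k (frag_of i) = frag_of i" using False True by (simp add: trop_N_frag_of)
      show ?thesis
        using h False True c unfolding is_X_mutation_def mut_elem_def c e
        by (simp add: binom_sum_def \<iota>_sum atLeast0AtMost)
    next
      case b: False
      \<comment> \<open>For b_ki > 0 the tropical part already contains b_ki e_k; its negative is
        the shift in the exponents s - b_ki of the denominator.\<close>
      have e: "trop_N 1 s k (frag_of i) = frag_of i + frag_cmul (bmat s k i) (frag_of k)"
        using False b by (simp add: trop_N_frag_of)
      have "- trop_N 1 s k (frag_of i) + frag_cmul (int r) (frag_of k) =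
          - frag_of i + frag_cmul (int r - bmat s k i) (frag_of k)" for r
        unfolding e by (rule poly_mapping_eqI) (simp add: lookup_add lookup_minus left_diff_distrib)
      then show ?thesis
        using h False b unfolding is_X_mutation_def mut_elem_def c
        by (simp add: binom_sum_def \<iota>_sum atLeast0AtMost)
    qed
  qed
qed (rule trop_N_add)

lemma A_mutation_system:
  assumes ok: "seed_ok t" and real: "A_realization v t \<iota> mu"
  shows "mutation_system v (unfrozen t) (mutation_class t) pois (\<lambda>s k. p_star s (frag_of k))
    (\<lambda>s k m. coord m k) (trop_M 1) \<iota> mu"
proof (rule mutation_system.intro)
  fix s assume s: "s \<in> mutation_class t"
  note oks = seed_ok_mutation_class[OF ok s]
  obtain ks where ks: "set ks \<subseteq> unfrozen t" "s = mutates ks t"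
    using s by (auto simp: mutation_class_def)
  have frac: "skew_field_of_fractions (A_mult v s) (\<iota> s)"
    using real ks unfolding A_realization_def by blast
  show "unfrozen s = unfrozen t" by (rule unfrozen_mutation_class[OF s])
  show "quantum_torus v (pois s) (\<iota> s)" by (rule A_torus[OF oks frac])
  fix k assume k: "k \<in> unfrozen t"
  then have k': "k \<in> unfrozen s" using unfrozen_mutation_class[OF s] by simp
  show "mutate k s \<in> mutation_class t" by (rule mutate_in_mutation_class[OF s k])
  have frac': "skew_field_of_fractions (A_mult v (mutate k s)) (\<iota> (mutate k s))"
    using real ks k unfolding A_realization_def
    by (metis Un_subset_iff empty_subsetI insert_subset list.set mutates_snoc set_append)
  have h: "is_A_mutation s k (\<iota> (mutate k s)) (\<iota> s) (mu s k)"
    using real ks k unfolding A_realization_def by blast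
  show "mutation_direction v (pois s) (\<iota> s) (v_sub v s k) (p_star s (frag_of k)) (\<lambda>m. coord m k)"
    by (rule A_direction[OF oks frac k'])
  show "algebra_iso (\<iota> (mutate k s)) (\<iota> s) (mu s k)" using h by (simp add: is_A_mutation_def)
  show "mutate k (mutate k s) = s" by (rule mutate_mutate_ok[OF oks k'])
  note iso = lattice_iso_trop[OF oks _ k', of 1, simplified]
  show "trop_M 1 s k (p_star (mutate k s) (frag_of k)) = - p_star s (frag_of k)"
    by (simp add: lattice_iso_p_star[OF iso mult_pos[OF ok_seed[OF oks]]]
        trop_N_frag_of_self[OF ok_seed[OF oks]] p_star_minus)
  fix m a b
  show "mu s k (\<iota> (mutate k s) (single m 1)) = mutation_direction.mut_elem (\<iota> s)
     (v_sub v s k) (p_star s (frag_of k)) (\<lambda>m. coord m k) (trop_M 1 s k m)"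
    by (rule A_mutation_monomial[OF oks k' frac frac' h])
  show "trop_M 1 s k (a + b) = trop_M 1 s k a + trop_M 1 s k b" by (rule trop_M_add)
  show "coord (trop_M 1 s k m) k = - coord m k"
    by (simp add: coord_trop_M bmat_diag[OF ok_seed[OF oks]])
  show "trop_M 1 s k (trop_M 1 (mutate k s) k m) = m + frag_cmul (coord m k) (p_star s (frag_of k))"
    by (rule trop_M_trop_M_mutate[OF ok_seed[OF oks]])
qed

lemma X_mutation_system:
  assumes ok: "seed_ok t" and real: "X_realization v t \<iota> mu"
  shows "mutation_system v (unfrozen t) (mutation_class t) X_form
    (\<lambda>s k. frag_of k) bmat_row (trop_N 1) \<iota> mu"
proof (rule mutation_system.intro)
  fix s assume s: "s \<in> mutation_class t"
  note oks = seed_ok_mutation_class[OF ok s]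
  obtain ks where ks: "set ks \<subseteq> unfrozen t" "s = mutates ks t"
    using s by (auto simp: mutation_class_def)
  have frac: "skew_field_of_fractions (X_mult v s) (\<iota> s)"
    using real ks unfolding X_realization_def by blast
  show "unfrozen s = unfrozen t" by (rule unfrozen_mutation_class[OF s])
  show "quantum_torus v (X_form s) (\<iota> s)" by (rule X_torus[OF oks frac])
  fix k assume k: "k \<in> unfrozen t"
  then have k': "k \<in> unfrozen s" using unfrozen_mutation_class[OF s] by simp
  show "mutate k s \<in> mutation_class t" by (rule mutate_in_mutation_class[OF s k])
  have frac': "skew_field_of_fractions (X_mult v (mutate k s)) (\<iota> (mutate k s))"
    using real ks k unfolding X_realization_def
    by (metis Un_subset_iff empty_subsetI insert_subset list.set mutates_snoc set_append)
  have h: "is_X_mutation v s k (\<iota> (mutate k s)) (\<iota> s) (mu s k)"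
    using real ks k unfolding X_realization_def by blast
  show "mutation_direction v (X_form s) (\<iota> s) (v_sub v s k) (frag_of k)
    (bmat_row s k)"
    by (rule X_direction[OF oks frac])
  show "algebra_iso (\<iota> (mutate k s)) (\<iota> s) (mu s k)" using h by (simp add: is_X_mutation_def)
  show "mutate k (mutate k s) = s" by (rule mutate_mutate_ok[OF oks k'])
  show "trop_N 1 s k (frag_of k) = - frag_of k" by (rule trop_N_frag_of_self[OF ok_seed[OF oks]])
  fix m a b
  show "mu s k (\<iota> (mutate k s) (single m 1)) = mutation_direction.mut_elem (\<iota> s)
     (v_sub v s k) (frag_of k) (bmat_row s k) (trop_N 1 s k m)"
    by (rule X_mutation_monomial[OF oks k' frac frac' h])
  show "trop_N 1 s k (a + b) = trop_N 1 s k a + trop_N 1 s k b" by (rule trop_N_add)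
  show "(bmat_row s k (trop_N 1 s k m)) =
      - (bmat_row (mutate k s) k m)"
    unfolding sum_bmat_trop_N[OF ok_seed[OF oks]] bmat_mutate[OF ok_seed[OF oks]]
    by (simp add: sum_negf)
  show "trop_N 1 s k (trop_N 1 (mutate k s) k m) =
      m + frag_cmul (bmat_row s k m) (frag_of k)"
    by (rule trop_N_trop_N_mutate[OF ok_seed[OF oks]])
qed

section \<open>Degrees of the mutated variables\<close>

text \<open>
  The total order selects the sign of each tropical mutation along the sequence, so that no
  sign-coherence of \<open>c\<close>-vectors is needed.
\<close>

lemma X_degrees:
  assumes ok: "seed_ok t" and real: "X_realization v t \<iota> mu"
    and "valued_torus v (X_form t) (\<iota> t) \<nu>"
    and "set ks \<subseteq> unfrozen t"
  shows "\<exists>\<psi> \<phi>. lattice_iso (mutates ks t) t \<psi> \<phi> \<and>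
    (\<forall>n. valued_torus.has_deg (\<iota> t) \<nu>
       (mu_star mu ks t (\<iota> (mutates ks t) (single n 1))) (\<psi> n))"
proof -
  interpret valued_torus v "X_form t" "\<iota> t" \<nu> by fact
  interpret S: mutation_system v "unfrozen t" "mutation_class t" X_form
    "\<lambda>s k. frag_of k" bmat_row "trop_N 1" \<iota> mu
    by (rule X_mutation_system[OF ok real])
  show ?thesis
    using assms(4)
  \<comment> \<open>The last mutation of the sequence is applied first by \<mu>^*, so it is expanded
    at the last seed, where the degrees of all monomials are known by induction.\<close>
  proof (induction ks rule: rev_induct)
    case Nil
    show ?case
    proof (intro exI conjI allI)
      show "lattice_iso (mutates [] t) t id id" by (simp only: mutates_simps lattice_iso_id)
      show "has_deg (mu_star mu [] t (\<iota> (mutates [] t) (single n 1))) (id n)" for n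
        using has_deg_Z by (simp add: Z_def)
    qed
  next
    case (snoc k ks)
    then have ks: "set ks \<subseteq> unfrozen t" and k: "k \<in> unfrozen t" by auto
    define s where "s = mutates ks t"
    have s: "s \<in> mutation_class t" unfolding s_def by (rule mutates_in_mutation_class[OF ks])
    note oks = seed_ok_mutation_class[OF ok s]
    have k': "k \<in> unfrozen s" using k unfrozen_mutation_class[OF s] by simp
    obtain \<psi> \<phi> where iso: "lattice_iso s t \<psi> \<phi>"
      and deg: "\<And>n. has_deg (mu_star mu ks t (\<iota> s (single n 1))) (\<psi> n)"
      using snoc.IH[OF ks] unfolding s_def by blast
    define \<epsilon> :: int where "\<epsilon> = (if \<nu> (\<psi> (frag_of k)) > 0 then 1 else - 1)"
    have \<psi>_0: "\<psi> 0 = 0" by (rule additive_minus(1)[OF lattice_iso_add(1)[OF iso]])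
    have "\<psi> (frag_of k) \<noteq> 0"
      using bij_is_inj[OF lattice_iso_bij(1)[OF iso]] \<psi>_0 by (metis frag_of_nonzero inj_eq)
    note mut_deg = has_deg_mut_elem[OF S.direction[OF s k]
        S.mu_star_iso[OF self_in_mutation_class ks, folded s_def] lattice_iso_add(1)[OF iso] deg this]
    have "has_deg (mu_star mu (ks @ [k]) t (\<iota> (mutates (ks @ [k]) t) (single n 1)))
        ((\<psi> \<circ> trop_N \<epsilon> s k) n)" for n
    proof -
      \<comment> \<open>The far end of the binomial sum moves the exponent by a multiple of e_k, and
        \<open>trop_N_minus_1\<close> recognizes this as the negative tropical map.\<close>
      have "(if 0 < \<nu> (\<psi> (frag_of k)) then trop_N 1 s k n else trop_N 1 s k n +
          frag_cmul (- (bmat_row s k (trop_N 1 s k n))) (frag_of k)) =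
          trop_N \<epsilon> s k n"
        unfolding sum_bmat_trop_N[OF ok_seed[OF oks]] trop_N_minus_1[OF ok_seed[OF oks], symmetric]
        by (simp add: \<epsilon>_def)
      then show ?thesis
        using mut_deg[of "trop_N 1 s k n"] S.mu_monomial[OF s k, of n]
        by (simp add: mu_star_snoc mutates_snoc s_def [symmetric])
    qed
    moreover have "lattice_iso (mutates (ks @ [k]) t) t (\<psi> \<circ> trop_N \<epsilon> s k) (\<phi> \<circ> trop_M \<epsilon> s k)"
      using lattice_iso_comp[OF lattice_iso_trop[OF oks _ k', of \<epsilon>] iso]
      by (simp add: \<epsilon>_def mutates_snoc s_def)
    ultimately show ?case by blast
  qed
qed

section \<open>Variation maps of Donaldson--Thomas type\<close>

definition seed_similarity ::
  "'i::finite seed \<Rightarrow> ('i \<Rightarrow> 'i) \<Rightarrow> 'i seed \<Rightarrow> 'i seed \<Rightarrow> ('i lattice \<Rightarrow> 'i lattice)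
     \<Rightarrow> ('i lattice \<Rightarrow> 'i lattice) \<Rightarrow> bool" where
  "seed_similarity t \<sigma> s s' \<psi> \<phi> \<longleftrightarrow>
     s \<in> mutation_class t \<and> s' \<in> mutation_class t \<and> lattice_iso s s' \<psi> \<phi> \<and>
     (\<forall>k\<in>unfrozen t. \<psi> (frag_of k) = frag_of (\<sigma> k) \<and> mult s' (\<sigma> k) = mult s k)"

lemma lattice_iso_uminus:
  assumes ok: "seed_ok s'" and iso: "lattice_iso s s' \<psi> \<phi>"
  shows "lattice_iso s s' (\<lambda>n. - \<psi> n) (\<lambda>m. - \<phi> m)"
proof -
  have "bij (uminus :: 'i lattice \<Rightarrow> _)" by (rule o_bij[of uminus]) (simp_all add: fun_eq_iff)
  then have "bij (\<lambda>n. - \<psi> n)" "bij (\<lambda>m. - \<phi> m)"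
    using bij_comp[OF lattice_iso_bij(1)[OF iso], of uminus]
      bij_comp[OF lattice_iso_bij(2)[OF iso], of uminus] by (simp_all add: o_def)
  moreover have "pois s' (- a) (- b) = pois s' a b" for a b
    using pois_cmul_left[OF ok, of "- 1" a "- b"] pois_cmul_right[OF ok, of a "- 1" b] by simp
  ultimately show ?thesis
    using iso
    by (simp add: lattice_iso_def pairing_minus_left pairing_minus_right omega_minus_left
        omega_minus_right)
qed

lemma DT_similarity:
  fixes t :: "'i::finite seed"
  assumes ok: "seed_ok t" and real: "X_realization v t \<iota> mu"
    and inj: "injective_reachable_via \<iota> mu t ks \<sigma>" and sim: "similar_seeds \<sigma> t (mutates ks t)"
  obtains \<psi> \<phi> where "seed_similarity t \<sigma> t (mutates ks t) \<psi> \<phi>"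
proof -
  obtain \<nu> :: "'i lattice \<Rightarrow> (nat \<Rightarrow>\<^sub>0 int)" where \<nu>: "\<And>a b. \<nu> (a + b) = \<nu> a + \<nu> b" "inj \<nu>"
    "\<And>i. \<nu> (frag_of i) > 0" using exists_positive_embedding by blast
  interpret S: mutation_system v "unfrozen t" "mutation_class t" X_form
    "\<lambda>s k. frag_of k" bmat_row "trop_N 1" \<iota> mu
    by (rule X_mutation_system[OF ok real])
  interpret quantum_torus v "X_form t" "\<iota> t"
    by (rule S.torus[OF self_in_mutation_class])
  interpret valued_torus v "X_form t" "\<iota> t" \<nu>
    by unfold_locales (rule \<nu>)+
  have ks: "set ks \<subseteq> unfrozen t" using inj by (simp add: injective_reachable_via_def)
  obtain \<psi> \<phi> where iso: "lattice_iso (mutates ks t) t \<psi> \<phi>" and deg: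
    "\<And>n. has_deg (mu_star mu ks t (\<iota> (mutates ks t) (single n 1))) (\<psi> n)"
    using X_degrees[OF ok real valued_torus_axioms ks] by blast
  have \<psi>: "\<psi> (frag_of (\<sigma> k)) = - frag_of k" if "k \<in> unfrozen t" for k
    using inj that has_deg_unique[OF deg has_X_degree_has_deg[OF \<nu>(3)]]
    unfolding injective_reachable_via_def by blast
  note iso' = lattice_iso_uminus[OF seed_ok_mutates[OF ok ks] lattice_iso_inv[OF iso]]
  have "- inv \<psi> (frag_of k) = frag_of (\<sigma> k)" if k: "k \<in> unfrozen t" for k
  proof -
    have "\<psi> (- frag_of (\<sigma> k)) = frag_of k"
      using \<psi>[OF k] additive_minus(2)[of \<psi>, OF lattice_iso_add(1)[OF iso]] by simp
    then have "inv \<psi> (frag_of k) = - frag_of (\<sigma> k)"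
      using inv_f_f[OF bij_is_inj[OF lattice_iso_bij(1)[OF iso]]] by metis
    then show ?thesis by simp
  qed
  then have "seed_similarity t \<sigma> t (mutates ks t) (\<lambda>n. - inv \<psi> n) (\<lambda>m. - inv \<phi> m)"
    using iso' sim ks self_in_mutation_class mutates_in_mutation_class
    by (auto simp: seed_similarity_def similar_seeds_def)
  then show ?thesis by (rule that)
qed

section \<open>Similar seeds under simultaneous mutation, and their variation maps\<close>

context
  fixes t s s' :: "'i::finite seed" and \<sigma> \<psi> \<phi>
  assumes ok: "seed_ok t" and \<sigma>: "\<sigma> permutes unfrozen t"
    and sim: "seed_similarity t \<sigma> s s' \<psi> \<phi>"
begin

lemma similarity_class: "s \<in> mutation_class t" "s' \<in> mutation_class t"
  and similarity_iso: "lattice_iso s s' \<psi> \<phi>"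
  and similarity_frag_of: "k \<in> unfrozen t \<Longrightarrow> \<psi> (frag_of k) = frag_of (\<sigma> k)"
  and similarity_mult: "k \<in> unfrozen t \<Longrightarrow> mult s' (\<sigma> k) = mult s k"
  using sim by (auto simp: seed_similarity_def)

lemma similarity_seeds: "is_seed s" "is_seed s'"
  using similarity_class seed_ok_mutation_class[OF ok] ok_seed by blast+

text \<open>Pairing with e_k reads off the k-th coordinate up to d_k, so the values of \<psi> on the
  unfrozen basis determine the unfrozen coordinates of \<phi>.\<close>

lemma similarity_coord:
  assumes k: "k \<in> unfrozen t"
  shows "coord (\<phi> m) (\<sigma> k) = coord m k"
  using lattice_iso_pairing[OF similarity_iso, of m "frag_of k"] mult_pos[OF similarity_seeds(1), of k]
  by (simp add: similarity_frag_of[OF k] pairing_frag_of_right similarity_mult[OF k])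

lemma similarity_bmat_functional:
  assumes k: "k \<in> unfrozen t"
  shows "(bmat_row s' (\<sigma> k) (\<psi> n)) = (bmat_row s k n)"
  using lattice_iso_omega[OF similarity_iso, of n "frag_of k"] mult_pos[OF similarity_seeds(1), of k]
  unfolding similarity_frag_of[OF k] omega_frag_of_right similarity_mult[OF k]
  by (simp del: of_int_sum)

lemma similarity_p_star:
  assumes k: "k \<in> unfrozen t"
  shows "\<phi> (p_star s (frag_of k)) = p_star s' (frag_of (\<sigma> k))"
  using lattice_iso_p_star[OF similarity_iso mult_pos[OF similarity_seeds(2)]]
  by (simp add: similarity_frag_of[OF k])

text \<open>The new maps are the old ones composed with the positive tropical mutations at k and
  \<sigma> k, which are involutions. They still send e_j to e_(\<sigma> j) because the unfrozen
  exchange matrices correspond.\<close>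

lemma similarity_mutate:
  assumes k: "k \<in> unfrozen t"
  obtains \<psi>' \<phi>' where "seed_similarity t \<sigma> (mutate k s) (mutate (\<sigma> k) s') \<psi>' \<phi>'"
    "\<And>n. trop_N 1 s' (\<sigma> k) (\<psi>' n) = \<psi> (trop_N 1 s k n)"
    "\<And>m. trop_M 1 s' (\<sigma> k) (\<phi>' m) = \<phi> (trop_M 1 s k m)"
proof -
  note oks = similarity_class[THEN seed_ok_mutation_class[OF ok]]
  note unf = similarity_class[THEN unfrozen_mutation_class]
  have \<sigma>k: "\<sigma> k \<in> unfrozen t" using \<sigma> k by (simp add: permutes_in_image)
  define \<psi>' where "\<psi>' = trop_N 1 s' (\<sigma> k) \<circ> \<psi> \<circ> trop_N 1 s k"
  define \<phi>' where "\<phi>' = trop_M 1 s' (\<sigma> k) \<circ> \<phi> \<circ> trop_M 1 s k"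
  have inv: "inv (trop_N 1 s' (\<sigma> k)) = trop_N 1 s' (\<sigma> k)" "inv (trop_M 1 s' (\<sigma> k)) = trop_M 1 s' (\<sigma> k)"
    by (auto intro!: inv_equality trop_N_involution trop_M_involution similarity_seeds)
  have "lattice_iso (mutate k s) s' (\<psi> \<circ> trop_N 1 s k) (\<phi> \<circ> trop_M 1 s k)"
    using lattice_iso_comp[OF lattice_iso_trop[OF oks(1), of 1 k] similarity_iso] k unf by simp
  moreover have "lattice_iso s' (mutate (\<sigma> k) s') (trop_N 1 s' (\<sigma> k)) (trop_M 1 s' (\<sigma> k))"
    using lattice_iso_inv[OF lattice_iso_trop[OF oks(2), of 1 "\<sigma> k"]] \<sigma>k unf inv by simp
  ultimately have "lattice_iso (mutate k s) (mutate (\<sigma> k) s') \<psi>' \<phi>'"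
    unfolding \<psi>'_def \<phi>'_def comp_assoc by (rule lattice_iso_comp)
  moreover have "\<psi>' (frag_of j) = frag_of (\<sigma> j)" if j: "j \<in> unfrozen t" for j
  proof -
    have "\<psi> (trop_N 1 s k (frag_of j)) = trop_N 1 s' (\<sigma> k) (frag_of (\<sigma> j))"
    proof -
      have "bmat s' (\<sigma> k) (\<sigma> j) = bmat s k j"
        using similarity_bmat_functional[OF k, of "frag_of j"]
        unfolding similarity_frag_of[OF j] sum_bmat_frag_of .
      moreover have "\<sigma> j = \<sigma> k \<longleftrightarrow> j = k" using permutes_inj[OF \<sigma>] by (simp add: inj_eq)
      ultimately show ?thesis
        by (simp add: trop_N_frag_of lattice_iso_add(1)[OF similarity_iso] similarity_frag_of j k
            additive_frag_cmul[of \<psi>, OF lattice_iso_add(1)[OF similarity_iso]])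
    qed
    then show ?thesis by (simp add: \<psi>'_def trop_N_involution[OF similarity_seeds(2)])
  qed
  ultimately have "seed_similarity t \<sigma> (mutate k s) (mutate (\<sigma> k) s') \<psi>' \<phi>'"
    using similarity_class similarity_mult k \<sigma>k
    unfolding seed_similarity_def
    by (simp add: mutate_in_mutation_class) (simp add: mutate_def)
  then show ?thesis
    by (rule that) (simp_all add: \<psi>'_def \<phi>'_def trop_N_involution[OF similarity_seeds(2)]
      trop_M_involution[OF similarity_seeds(2)])
qed

lemma similarity_M_variation: "s = t \<Longrightarrow> linear_M_variation s s' \<sigma> \<phi>"
  unfolding linear_M_variation_def
proof (intro conjI allI ballI impI)
  assume s: "s = t"
  note unf = similarity_class[THEN unfrozen_mutation_class]
  have \<sigma>_surj: "\<exists>j\<in>unfrozen t. i = \<sigma> j" if "i \<in> unfrozen t" for i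
    using permutes_image[OF \<sigma>] that by blast
  show "\<phi> (m + m') = \<phi> m + \<phi> m'" for m m' by (rule lattice_iso_add(2)[OF similarity_iso])
  show "\<phi> (frag_of k) - frag_of (\<sigma> k) \<in> frozen_sublattice s'" if "k \<in> unfrozen s" for k
  proof -
    have "coord (\<phi> (frag_of k) - frag_of (\<sigma> k)) i = 0" if i: "i \<in> unfrozen t" for i
    proof -
      obtain j where j: "j \<in> unfrozen t" "i = \<sigma> j" using \<sigma>_surj[OF i] by blast
      then show ?thesis
        by (simp add: lookup_minus similarity_coord inj_eq[OF permutes_inj[OF \<sigma>]])
    qed
    then show ?thesis by (simp add: frozen_sublattice_def unf)
  qed
  show "\<phi> (frag_of j) \<in> frozen_sublattice s'" if "j \<notin> unfrozen s" for j
  proof -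
    have "coord (\<phi> (frag_of j)) i = 0" if i: "i \<in> unfrozen t" for i
    proof -
      obtain k where k: "k \<in> unfrozen t" "i = \<sigma> k" using \<sigma>_surj[OF i] by blast
      then have "j \<noteq> k" using \<open>j \<notin> unfrozen s\<close> unf by auto
      then show ?thesis using k by (simp add: similarity_coord)
    qed
    then show ?thesis by (simp add: frozen_sublattice_def unf)
  qed
  show "\<phi> (p_star s (frag_of k)) = p_star s' (frag_of (\<sigma> k))" if "k \<in> unfrozen s" for k
    using similarity_p_star that s by simp
qed

lemma similarity_N_variation: "s = t \<Longrightarrow> linear_N_variation s s' \<sigma> \<psi>"
  unfolding linear_N_variation_def
proof (intro conjI allI ballI)
  assume s: "s = t"
  show "\<psi> (n + n') = \<psi> n + \<psi> n'" for n n' by (rule lattice_iso_add(1)[OF similarity_iso])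
  show "\<psi> (frag_of k) = frag_of (\<sigma> k)" if "k \<in> unfrozen s" for k
    using similarity_frag_of that s by simp
  show "omega s' (\<psi> (frag_of i)) (\<psi> (frag_of k)) = omega s (frag_of i) (frag_of k)" for i k
    by (rule lattice_iso_omega[OF similarity_iso])
qed

end

text \<open>The relation keeps \<phi> and hides its partner \<psi>, which must travel along: the
  conditions on coordinates and on p^* are derived from the values of \<psi> on the unfrozen
  basis.\<close>

lemma A_variation_system:
  assumes ok: "seed_ok t" and real: "A_realization v t \<iota> mu" and \<sigma>: "\<sigma> permutes unfrozen t"
  shows "variation_system v (unfrozen t) (mutation_class t) pois (\<lambda>s k. p_star s (frag_of k))
    (\<lambda>s k m. coord m k) (trop_M 1) \<iota> mu \<sigma> (\<lambda>s s' V. \<exists>\<psi>. seed_similarity t \<sigma> s s' \<psi> V)"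
proof -
  interpret S: mutation_system v "unfrozen t" "mutation_class t" pois "\<lambda>s k. p_star s (frag_of k)"
    "\<lambda>s k m. coord m k" "trop_M 1" \<iota> mu by (rule A_mutation_system[OF ok real])
  show ?thesis
  proof
    show "\<sigma> permutes unfrozen t" by (rule \<sigma>)
    fix s s' V assume "\<exists>\<psi>. seed_similarity t \<sigma> s s' \<psi> V"
    then obtain \<psi> where sim: "seed_similarity t \<sigma> s s' \<psi> V" ..
    note iso = similarity_iso[OF ok \<sigma> sim]
    show "s \<in> mutation_class t" "s' \<in> mutation_class t" by (rule similarity_class[OF ok \<sigma> sim])+
    show "V (a + b) = V a + V b" for a b by (rule lattice_iso_add(2)[OF iso])
    show "bij V" by (rule lattice_iso_bij(2)[OF iso])
    show "v (pois s' (V a) (V b)) = v (pois s a b)" for a b by (simp add: lattice_iso_pois[OF iso])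
    fix k assume k: "k \<in> unfrozen t"
    show "V (p_star s (frag_of k)) = p_star s' (frag_of (\<sigma> k))"
      by (rule similarity_p_star[OF ok \<sigma> sim k])
    show "coord (V m) (\<sigma> k) = coord m k" for m by (rule similarity_coord[OF ok \<sigma> sim k])
    show "v_sub v s' (\<sigma> k) = v_sub v s k"
      by (simp add: v_sub_def similarity_mult[OF ok \<sigma> sim k] fun_eq_iff)
    show "\<exists>V'. (\<exists>\<psi>. seed_similarity t \<sigma> (mutate k s) (mutate (\<sigma> k) s') \<psi> V') \<and>
        (\<forall>m. trop_M 1 s' (\<sigma> k) (V' m) = V (trop_M 1 s k m))"
      using similarity_mutate[OF ok \<sigma> sim k] by metis
  qed
qed

lemma X_variation_system:
  assumes ok: "seed_ok t" and real: "X_realization v t \<iota> mu" and \<sigma>: "\<sigma> permutes unfrozen t"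
  shows "variation_system v (unfrozen t) (mutation_class t) X_form
    (\<lambda>s k. frag_of k) bmat_row (trop_N 1) \<iota> mu \<sigma>
    (\<lambda>s s' V. \<exists>\<phi>. seed_similarity t \<sigma> s s' V \<phi>)"
proof -
  interpret S: mutation_system v "unfrozen t" "mutation_class t" X_form
    "\<lambda>s k. frag_of k" bmat_row "trop_N 1" \<iota> mu
    by (rule X_mutation_system[OF ok real])
  show ?thesis
  proof
    show "\<sigma> permutes unfrozen t" by (rule \<sigma>)
    fix s s' V assume "\<exists>\<phi>. seed_similarity t \<sigma> s s' V \<phi>"
    then obtain \<phi> where sim: "seed_similarity t \<sigma> s s' V \<phi>" ..
    note iso = similarity_iso[OF ok \<sigma> sim]
    show "s \<in> mutation_class t" "s' \<in> mutation_class t" by (rule similarity_class[OF ok \<sigma> sim])+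
    show "V (a + b) = V a + V b" for a b by (rule lattice_iso_add(1)[OF iso])
    show "bij V" by (rule lattice_iso_bij(1)[OF iso])
    show "v (- omega s' (V a) (V b)) = v (- omega s a b)" for a b
      by (simp add: lattice_iso_omega[OF iso])
    fix k assume k: "k \<in> unfrozen t"
    show "V (frag_of k) = frag_of (\<sigma> k)" by (rule similarity_frag_of[OF ok \<sigma> sim k])
    show "(bmat_row s' (\<sigma> k) (V m)) = (bmat_row s k m)" for m
      by (rule similarity_bmat_functional[OF ok \<sigma> sim k])
    show "v_sub v s' (\<sigma> k) = v_sub v s k"
      by (simp add: v_sub_def similarity_mult[OF ok \<sigma> sim k] fun_eq_iff)
    show "\<exists>V'. (\<exists>\<phi>. seed_similarity t \<sigma> (mutate k s) (mutate (\<sigma> k) s') V' \<phi>) \<and>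
        (\<forall>m. trop_N 1 s' (\<sigma> k) (V' m) = V (trop_N 1 s k m))"
      using similarity_mutate[OF ok \<sigma> sim k] by metis
  qed
qed

end

section \<open>Compatibility with \<open>p\<^sup>*\<close>\<close>

lemma twisted_mult_commute:
  assumes "\<And>m n. m \<in> keys a \<Longrightarrow> n \<in> keys b \<Longrightarrow> v (form m n) = v (form n m)"
  shows "twisted_mult v form a b = twisted_mult v form b a"
proof -
  have "twisted_mult v form a b = (\<Sum>m\<in>keys a. \<Sum>n\<in>keys b.
      single (n + m) (v (form n m) * lookup b n * lookup a m))"
    unfolding twisted_mult_def
  proof (intro sum.cong refl)
    fix m n assume "m \<in> keys a" "n \<in> keys b"
    then show "single (m + n) (v (form m n) * lookup a m * lookup b n) =
        single (n + m) (v (form n m) * lookup b n * lookup a m)"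
      by (simp add: assms[of m n] add.commute mult_ac)
  qed
  then show ?thesis unfolding twisted_mult_def by (simp only: sum.swap[of _ "keys a"])
qed

lemma in_keys_sumE:
  assumes "x \<in> keys (sum f A)"
  obtains i where "i \<in> A" "x \<in> keys (f i)"
  using assms keys_sum[of f A] by blast

lemma keys_twisted_mult:
  "keys (twisted_mult v form a b) \<subseteq>
     {m + n |m n. m \<in> keys a \<and> n \<in> keys b}"
proof
  fix x assume "x \<in> keys (twisted_mult v form a b)"
  then obtain m where m: "m \<in> keys a"
    "x \<in> keys (\<Sum>n\<in>keys b. single (m + n)
       (v (form m n) * lookup a m * lookup b n))"
    unfolding twisted_mult_def by (rule in_keys_sumE)
  from m(2) obtain n where "n \<in> keys b"
    "x \<in> keys (single (m + n)
       (v (form m n) * lookup a m * lookup b n))"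
    by (rule in_keys_sumE)
  then show "x \<in> {m + n |m n. m \<in> keys a \<and> n \<in> keys b}"
    using m(1) by (auto split: if_splits)
qed

text \<open>
  \<open>p\<^sup>*\<close> is not multiplicative, and not defined on the skew-field of \<open>LP\<^sup>X(s)\<close>. But it is
  multiplicative when the second factor involves only \<open>X_k\<close>, and the denominators occurring in
  \<open>\<mu>_k\<^sup>*\<close> are of that kind, so they can be cleared.
\<close>

locale p_star_step = exponents v E \<chi>
  for v :: "rat \<Rightarrow> 'k::idom" and E \<chi> +
  fixes s :: "'i::finite seed" and k :: 'i
    and \<iota>X :: "('i, 'k) LP \<Rightarrow> 'x::division_ring" and \<iota>A :: "('i, 'k) LP \<Rightarrow> 'a::division_ring"
  assumes ok: "seed_ok s" and k: "k \<in> unfrozen s"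
    and X_frac: "skew_field_of_fractions (X_mult v s) \<iota>X"
    and A_frac: "skew_field_of_fractions (A_mult v s) \<iota>A"
begin

sublocale X: mutation_direction v "X_form s" \<iota>X "v_sub v s k" "frag_of k"
  "bmat_row s k"
  by (rule X_direction[OF ok X_frac])

sublocale A: mutation_direction v "pois s" \<iota>A "v_sub v s k" "p_star s (frag_of k)" "\<lambda>m. coord m k"
  by (rule A_direction[OF ok A_frac k])

abbreviation P :: "('i, 'k) LP \<Rightarrow> ('i, 'k) LP" where
  "P \<equiv> monomial_map (p_star s)"

text \<open>Laurent polynomials in X_k alone, negative powers being allowed. They commute with each
  other for the twisted product.\<close>

definition k_polys :: "('i, 'k) LP set" where
  "k_polys = {g. keys g \<subseteq> range (\<lambda>z. frag_cmul z (frag_of k))}"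

lemma p_star_0: "p_star s 0 = 0"
  by (rule additive_minus(1)[OF p_star_add])

text \<open>Compatibility evaluates \<lambda>(m, p^* e_k) as a pairing with e_k, and the pairing of
  p^* m with e_k is \<omega>(m, e_k). This is why p^* is multiplicative against powers of
  X_k.\<close>

lemma v_pois_p_star_right:
  "v (pois s (p_star s m) (p_star s (frag_cmul z (frag_of k)))) = v (- omega s m (frag_cmul z (frag_of k)))"
proof -
  have "pois s (p_star s m) (p_star s (frag_cmul z (frag_of k))) =
      \<chi> * (- (of_int z * pairing s (p_star s m) (frag_of k)))"
    by (simp add: p_star_cmul pois_cmul_right[OF ok] pois_p_star_frag_of[OF ok k]
        pairing_frag_of_right)
  also have "\<dots> = \<chi> * (- omega s m (frag_cmul z (frag_of k)))"
    by (simp add: pairing_p_star omega_cmul_right)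
  finally show ?thesis
    using v_\<chi>[OF E_minus[OF omega_E[OF ok]]] by simp
qed

lemma v_pois_p_star_left:
  "v (pois s (p_star s (frag_cmul z (frag_of k))) (p_star s m)) = v (- omega s (frag_cmul z (frag_of k)) m)"
  using A.v_form_swap[of "p_star s (frag_cmul z (frag_of k))" "p_star s m"]
    X.v_form_swap[of "frag_cmul z (frag_of k)" m] v_pois_p_star_right[of m z]
    X.v_form_nonzero[of m "frag_cmul z (frag_of k)"]
  by (metis mult_right_cancel)

lemma P_mult_k_polys: "g \<in> k_polys \<Longrightarrow> P (X.tmul a g) = A.tmul (P a) (P g)"
  by (rule monomial_map_twisted_mult) (auto simp: p_star_add k_polys_def v_pois_p_star_right)

lemma P_scale: "P (X.tmul (single 0 c) a) = A.tmul (single 0 c) (P a)"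
proof -
  have "P (X.tmul (single 0 c) a) = A.tmul (P (single 0 c)) (P a)"
    by (rule monomial_map_twisted_mult)
       (use X.v_form_0(1) in \<open>auto simp: p_star_add p_star_0 split: if_splits\<close>)
  then show ?thesis by (simp add: monomial_map_single p_star_0)
qed

lemma k_polys_commute:
  assumes "g \<in> k_polys" "g' \<in> k_polys"
  shows "X.tmul g g' = X.tmul g' g"
proof (rule twisted_mult_commute)
  fix m n assume "m \<in> keys g" "n \<in> keys g'"
  then obtain z z' where "m = frag_cmul z (frag_of k)" "n = frag_cmul z' (frag_of k)"
    using assms unfolding k_polys_def by blast
  then show "v (- omega s m n) = v (- omega s n m)"
    by (simp add: omega_cmul_left omega_cmul_right omega_self[OF ok_seed[OF ok]])
qed

lemma k_polys_mult:
  assumes "g \<in> k_polys" "g' \<in> k_polys"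
  shows "X.tmul g g' \<in> k_polys"
proof -
  have "x \<in> range (\<lambda>z. frag_cmul z (frag_of k))" if x: "x \<in> keys (X.tmul g g')" for x
  proof -
    obtain m n where mn: "m \<in> keys g" "n \<in> keys g'" "x = m + n"
      using x keys_twisted_mult by blast
    then obtain z z' where "m = frag_cmul z (frag_of k)" "n = frag_cmul z' (frag_of k)"
      using assms unfolding k_polys_def by blast
    then show ?thesis using mn(3) by (simp flip: frag_cmul_distrib)
  qed
  then show ?thesis unfolding k_polys_def by blast
qed

lemma P_binom_sum: "P (X.binom_sum m b) = A.binom_sum (p_star s m) b"
  by (simp add: X.binom_sum_def A.binom_sum_def monomial_map_sum monomial_map_single p_star_add
      p_star_cmul)

lemma coord_p_star: "coord (p_star s m) k = (bmat_row s k m)"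
proof -
  have "pairing s (p_star s m) (frag_of k) = omega s m (frag_of k)" by (rule pairing_p_star)
  then show ?thesis
    using mult_pos[OF ok_seed[OF ok], of k]
    unfolding pairing_frag_of_right omega_frag_of_right by (simp del: of_int_sum)
qed

text \<open>The graph of p^* on Laurent polynomials, viewed inside the two skew-fields. It replaces
  a map on fractions, and sums, scalars and right factors from \<open>k_polys\<close> preserve
  it.\<close>

definition related :: "'x \<Rightarrow> 'a \<Rightarrow> bool" where
  "related x y \<longleftrightarrow> (\<exists>a. x = \<iota>X a \<and> y = \<iota>A (P a))"

lemma related_unique: "related x y \<Longrightarrow> related x y' \<Longrightarrow> y = y'"
  by (auto simp: related_def X.\<iota>_eq_iff)

lemma related_0: "related 0 0"
  unfolding related_def by (rule exI[of _ 0]) (simp add: X.\<iota>_0 A.\<iota>_0)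

lemma related_add: "related x y \<Longrightarrow> related x' y' \<Longrightarrow> related (x + x') (y + y')"
  unfolding related_def by (metis A.\<iota>_add X.\<iota>_add monomial_map_add)

lemma related_sum: "(\<And>i. i \<in> B \<Longrightarrow> related (f i) (f' i)) \<Longrightarrow> related (sum f B) (sum f' B)"
  by (induction B rule: infinite_finite_induct) (auto simp: related_0 related_add)

lemma related_scale: "related x y \<Longrightarrow> related (X.K c * x) (A.K c * y)"
  unfolding related_def X.K_def A.K_def by (metis A.\<iota>_mult P_scale X.\<iota>_mult)

lemma related_mult_k_polys: "related x y \<Longrightarrow> g \<in> k_polys \<Longrightarrow> related (x * \<iota>X g) (y * \<iota>A (P g))"
  unfolding related_def by (metis A.\<iota>_mult P_mult_k_polys X.\<iota>_mult)

text \<open>If c m > 0, the denominator of \<open>mut_elem m\<close> is a binomial sum starting at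
  -m. Multiplying it by X^m leaves only powers of X_k, and with this g the product becomes the
  monomial X^m.\<close>

lemma clear_denominator:
  "\<exists>g\<in>k_polys. \<iota>A (P g) \<noteq> 0 \<and>
     related (X.mut_elem m * \<iota>X g) (A.mut_elem (p_star s m) * \<iota>A (P g))"
proof (cases "(bmat_row s k m) \<le> 0")
  case True
  have P1: "P 1 = 1"
    using monomial_map_single[of "p_star s" 0 "1 :: 'k"] by (simp add: p_star_0)
  have "related (X.mut_elem m) (A.mut_elem (p_star s m))"
    using True unfolding related_def X.mut_elem_def A.mut_elem_def coord_p_star
    by (intro exI[of _ "X.binom_sum m (nat (- (bmat_row s k m)))"])
       (simp add: P_binom_sum)
  moreover have "1 \<in> k_polys" by (auto simp: k_polys_def intro: image_eqI[of _ _ 0])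
  ultimately show ?thesis
    by (intro bexI[of _ 1]) (simp_all add: P1 X.\<iota>_1 A.\<iota>_1)
next
  case False
  define b where "b = nat (bmat_row s k m)"
  define g where "g = X.tmul (X.binom_sum (- m) b) (single m 1)"
  have keys: "keys (X.binom_sum (- m) b) \<subseteq>
      range (\<lambda>r. - m + frag_cmul (int r) (frag_of k))"
  proof
    fix x assume "x \<in> keys (X.binom_sum (- m) b)"
    then obtain r where "x \<in> keys (single (- m + frag_cmul (int r) (frag_of k))
        (q_binom (v_sub v s k) b r))"
      unfolding X.binom_sum_def by (rule in_keys_sumE)
    then show "x \<in> range (\<lambda>r. - m + frag_cmul (int r) (frag_of k))" by (auto split: if_splits)
  qed
  have g: "g \<in> k_polys"
    unfolding k_polys_def
  proof (rule CollectI, rule subsetI)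
    fix x assume "x \<in> keys g"
    then obtain n where "n \<in> keys (X.binom_sum (- m) b)" "x = n + m"
      using keys_twisted_mult unfolding g_def by (force split: if_splits)
    then obtain r where "x = frag_cmul (int r) (frag_of k)" using keys by fastforce
    then show "x \<in> range (\<lambda>z. frag_cmul z (frag_of k))" by simp
  qed
  have Pg: "\<iota>A (P g) = \<iota>A (A.binom_sum (- p_star s m) b) * A.Z (p_star s m)"
  proof -
    have "P g = A.tmul (P (X.binom_sum (- m) b)) (P (single m 1))"
      unfolding g_def
    proof (rule monomial_map_twisted_mult)
      fix n n' assume "n \<in> keys (X.binom_sum (- m) b)"
        "n' \<in> keys (single m (1 :: 'k))"
      then obtain r where n: "n = - m + frag_cmul (int r) (frag_of k)" "n' = m"
        using keys by (auto split: if_splits)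
      \<comment> \<open>The summand -m pairs trivially with m under both forms, so only a multiple
        of e_k against m is left to compare.\<close>
      have "v (pois s (p_star s n) (p_star s m)) =
          v (pois s (- p_star s m) (p_star s m)) *
          v (pois s (p_star s (frag_cmul (int r) (frag_of k))) (p_star s m))"
        unfolding n(1) p_star_add p_star_minus by (rule A.v_form_add_left)
      also have "\<dots> = v (- omega s (- m) m) * v (- omega s (frag_cmul (int r) (frag_of k)) m)"
        by (simp only: A.v_form_minus_self X.v_form_minus_self v_pois_p_star_left)
      also have "\<dots> = v (- omega s n m)" unfolding n(1) by (rule X.v_form_add_left [symmetric])
      finally show "v (pois s (p_star s n) (p_star s n')) = v (- omega s n n')" using n(2) by simp
    qed (rule p_star_add)
    then show ?thesis
      by (simp add: P_binom_sum monomial_map_single A.\<iota>_mult A.Z_def p_star_minus)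
  qed
  have "X.mut_elem m * \<iota>X g = X.Z m"
    using False unfolding X.mut_elem_def g_def b_def X.\<iota>_mult X.Z_def
    by (simp add: X.\<iota>_eq_0 X.binom_sum_nonzero flip: mult.assoc)
  moreover have "A.mut_elem (p_star s m) * \<iota>A (P g) = A.Z (p_star s m)"
    using False unfolding A.mut_elem_def Pg coord_p_star b_def
    by (simp add: A.\<iota>_eq_0 A.binom_sum_nonzero flip: mult.assoc)
  moreover have "related (X.Z m) (A.Z (p_star s m))"
    unfolding related_def X.Z_def A.Z_def
    by (intro exI[of _ "single m 1"]) (simp add: monomial_map_single)
  ultimately show ?thesis
    using g by (intro bexI[of _ g]) (simp_all add: Pg A.\<iota>_eq_0 A.binom_sum_nonzero)
qed

text \<open>The product of the individual denominators serves all elements at once: since they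
  commute, each can be placed next to the element it clears.\<close>

lemma clear_denominators:
  "finite M \<Longrightarrow> \<exists>g\<in>k_polys. \<iota>A (P g) \<noteq> 0 \<and>
     (\<forall>m\<in>M. related (X.mut_elem m * \<iota>X g) (A.mut_elem (p_star s m) * \<iota>A (P g)))"
proof (induction M rule: finite_induct)
  case empty
  show ?case using clear_denominator by blast
next
  case (insert m M)
  then obtain g where g: "g \<in> k_polys" "\<iota>A (P g) \<noteq> 0"
    "\<And>m. m \<in> M \<Longrightarrow> related (X.mut_elem m * \<iota>X g) (A.mut_elem (p_star s m) * \<iota>A (P g))" by blast
  obtain g' where g': "g' \<in> k_polys" "\<iota>A (P g') \<noteq> 0"
    "related (X.mut_elem m * \<iota>X g') (A.mut_elem (p_star s m) * \<iota>A (P g'))"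
    using clear_denominator by blast
  let ?h = "X.tmul g g'"
  have h: "?h = X.tmul g' g" by (rule k_polys_commute[OF g(1) g'(1)])
  have P_h: "\<iota>A (P ?h) = \<iota>A (P g) * \<iota>A (P g')"
    by (simp add: P_mult_k_polys[OF g'(1)] A.\<iota>_mult)
  have P_h': "\<iota>A (P ?h) = \<iota>A (P g') * \<iota>A (P g)"
    by (simp add: h P_mult_k_polys[OF g(1)] A.\<iota>_mult)
  have "related (X.mut_elem n * \<iota>X ?h) (A.mut_elem (p_star s n) * \<iota>A (P ?h))" if "n \<in> M" for n
    unfolding P_h X.\<iota>_mult using related_mult_k_polys[OF g(3)[OF that] g'(1)] by (simp add: mult.assoc)
  moreover have "related (X.mut_elem m * \<iota>X ?h) (A.mut_elem (p_star s m) * \<iota>A (P ?h))"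
    unfolding P_h' using related_mult_k_polys[OF g'(3) g(1)] by (simp add: h X.\<iota>_mult mult.assoc)
  moreover have "\<iota>A (P ?h) \<noteq> 0" using g(2) g'(2) by (simp add: P_h)
  ultimately show ?case using k_polys_mult[OF g(1) g'(1)] by blast
qed

text \<open>The mutated element is a sum of terms \<open>mut_elem\<close>, each of which may have a
  denominator although the total is Laurent. A common denominator in X_k makes every term
  \<open>related\<close>; afterwards it is cancelled, its image under p^* being nonzero.\<close>

lemma p_star_mutation:
  assumes X': "skew_field_of_fractions (X_mult v (mutate k s)) \<iota>X'"
    and A': "skew_field_of_fractions (A_mult v (mutate k s)) \<iota>A'"
    and hX: "is_X_mutation v s k \<iota>X' \<iota>X hX" and hA: "is_A_mutation s k \<iota>A' \<iota>A hA"
    and eq: "hX (\<iota>X' b) = \<iota>X a"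
  shows "hA (\<iota>A' (monomial_map (p_star (mutate k s)) b)) = \<iota>A (P a)"
proof -
  note ok' = seed_ok_mutate[OF ok k]
  interpret X': quantum_torus v "X_form (mutate k s)" \<iota>X' by (rule X_torus[OF ok' X'])
  interpret A': quantum_torus v "pois (mutate k s)" \<iota>A' by (rule A_torus[OF ok' A'])
  have isoX: "algebra_iso \<iota>X' \<iota>X hX" and isoA: "algebra_iso \<iota>A' \<iota>A hA"
    using hX hA by (simp_all add: is_X_mutation_def is_A_mutation_def)
  note rX = algebra_iso_imp_ring_iso[OF isoX] and rA = algebra_iso_imp_ring_iso[OF isoA]
  have K: "hX (X'.K c) = X.K c" "hA (A'.K c) = A.K c" for c
    using isoX isoA by (simp_all add: algebra_iso_def X'.K_def X.K_def A'.K_def A.K_def)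
  let ?b = "lookup b"
  let ?T = "\<lambda>n. trop_N 1 s k n"
  have 1: "\<iota>X a = (\<Sum>n\<in>keys b. X.K (?b n) * X.mut_elem (?T n))"
    using X_mutation_monomial[OF ok k X_frac X' hX]
    by (simp add: X'.\<iota>_expand[of b] ring_iso_sum[OF rX] ring_iso_mult[OF rX] K X'.Z_def
        flip: eq)
  have "hA (\<iota>A' (monomial_map (p_star (mutate k s)) b)) =
      (\<Sum>n\<in>keys b. A.K (?b n) * hA (A'.Z (p_star (mutate k s) n)))"
    by (simp add: monomial_map_def A'.\<iota>_sum A'.\<iota>_single ring_iso_sum[OF rA]
        ring_iso_mult[OF rA] K)
  moreover have "hA (A'.Z (p_star (mutate k s) n)) = A.mut_elem (p_star s (?T n))" for n
    using A_mutation_monomial[OF ok k A_frac A' hA]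
      lattice_iso_p_star[OF lattice_iso_trop[OF ok _ k, of 1] mult_pos[OF ok_seed[OF ok]]]
    by (simp add: A'.Z_def)
  ultimately have 2: "hA (\<iota>A' (monomial_map (p_star (mutate k s)) b)) =
      (\<Sum>n\<in>keys b. A.K (?b n) * A.mut_elem (p_star s (?T n)))" by simp
  obtain g where g: "g \<in> k_polys" "\<iota>A (P g) \<noteq> 0" "\<And>n. n \<in> keys b \<Longrightarrow>
      related (X.mut_elem (?T n) * \<iota>X g) (A.mut_elem (p_star s (?T n)) * \<iota>A (P g))"
    using clear_denominators[of "?T ` keys b"] by auto
  have "related (\<iota>X a * \<iota>X g) (hA (\<iota>A' (monomial_map (p_star (mutate k s)) b)) * \<iota>A (P g))"
    unfolding 1 2 sum_distrib_right mult.assoc by (intro related_sum related_scale g(3))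
  moreover have "related (\<iota>X a * \<iota>X g) (\<iota>A (P a) * \<iota>A (P g))"
    by (rule related_mult_k_polys[OF _ g(1)]) (auto simp: related_def)
  ultimately show ?thesis using related_unique g(2) by (metis mult_right_cancel)
qed

end

section \<open>Compatibility of the twists with the map between the two sides\<close>

context exponents
begin

text \<open>p^* can be applied to Laurent elements only. Membership in the upper cluster algebra is
  inherited when a mutation is undone, so all intermediate elements are Laurent and the one-step
  statement applies at each seed.\<close>

lemma p_star_mu_star:
  assumes ok: "seed_ok t" and A: "A_realization v t \<iota>A muA" and X: "X_realization v t \<iota>X muX"
  shows "s \<in> mutation_class t \<Longrightarrow> set ks \<subseteq> unfrozen t \<Longrightarrow>
    mu_star muX ks s (\<iota>X (mutates ks s) b) = \<iota>X s a \<Longrightarrow>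
    \<iota>X s a \<in> upper_cluster_algebra \<iota>X muX s \<Longrightarrow>
    mu_star muA ks s (\<iota>A (mutates ks s) (monomial_map (p_star (mutates ks s)) b)) =
      \<iota>A s (monomial_map (p_star s) a)"
proof (induction ks arbitrary: s a)
  case Nil
  interpret S: mutation_system v "unfrozen t" "mutation_class t" X_form
    "\<lambda>s k. frag_of k" bmat_row "trop_N 1" \<iota>X muX
    by (rule X_mutation_system[OF ok X])
  interpret quantum_torus v "X_form s" "\<iota>X s" by (rule S.torus[OF Nil.prems(1)])
  show ?case using Nil.prems(3) by (simp add: \<iota>_eq_iff)
next
  case (Cons k ks)
  interpret S: mutation_system v "unfrozen t" "mutation_class t" X_form
    "\<lambda>s k. frag_of k" bmat_row "trop_N 1" \<iota>X muX
    by (rule X_mutation_system[OF ok X])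
  note s = Cons.prems(1)
  have k: "k \<in> unfrozen t" and ks: "set ks \<subseteq> unfrozen t" using Cons.prems(2) by auto
  let ?s' = "mutate k s"
  have s': "?s' \<in> mutation_class t" by (rule mutate_in_mutation_class[OF s k])
  have fracs: "skew_field_of_fractions (X_mult v r) (\<iota>X r)" "skew_field_of_fractions (A_mult v r) (\<iota>A r)"
    if "r \<in> mutation_class t" for r
    using that A X unfolding mutation_class_def A_realization_def X_realization_def by blast+
  have mus: "is_X_mutation v s k (\<iota>X ?s') (\<iota>X s) (muX s k)"
    "is_A_mutation s k (\<iota>A ?s') (\<iota>A s) (muA s k)"
    using s k A X unfolding mutation_class_def A_realization_def X_realization_def by blast+
  interpret PS: p_star_step v E \<chi> s k "\<iota>X s" "\<iota>A s"
    by unfold_locales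
       (use fracs[OF s] seed_ok_mutation_class[OF ok s] unfrozen_mutation_class[OF s] k in auto)
  let ?x = "mu_star muX ks ?s' (\<iota>X (mutates ks ?s') b)"
  have x: "muX s k ?x = \<iota>X s a" using Cons.prems(3) by simp
  have "\<iota>X s a \<in> muX s k ` upper_cluster_algebra \<iota>X muX ?s'"
    using Cons.prems(4) S.mu_upper_cluster_algebra[OF s k] by simp
  then have x_in: "?x \<in> upper_cluster_algebra \<iota>X muX ?s'"
    using bij_is_inj[OF ring_iso_bij[OF algebra_iso_imp_ring_iso[OF S.mu_iso[OF s k]]]] x
    by (metis inj_image_mem_iff)
  \<comment> \<open>The empty sequence in the intersection says that the intermediate element is
    Laurent at the next seed.\<close>
  then have "?x \<in> mu_star muX [] ?s' ` range (\<iota>X (mutates [] ?s'))"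
    unfolding upper_cluster_algebra_def by (rule INT_D) simp
  then obtain a' where a': "?x = \<iota>X ?s' a'" by auto
  have "mu_star muA ks ?s' (\<iota>A (mutates ks ?s') (monomial_map (p_star (mutates ks ?s')) b)) =
      \<iota>A ?s' (monomial_map (p_star ?s') a')"
    using Cons.IH[OF s' ks a'] x_in a' by simp
  moreover have "muA s k (\<iota>A ?s' (monomial_map (p_star ?s') a')) = \<iota>A s (monomial_map (p_star s) a)"
    using PS.p_star_mutation[OF fracs(1)[OF s'] fracs(2)[OF s'] mus] x a' by simp
  ultimately show ?case by simp
qed

text \<open>Both twists are built from the same pair (\<psi>, \<phi>), which commutes with p^*. The
  third claim then only asks that p^* be compatible with the mutation maps.\<close>

lemma twists_exist:
  fixes t :: "'i::finite seed"
  assumes ok: "seed_ok t" and A: "A_realization v t \<iota>A muA" and X: "X_realization v t \<iota>X muX"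
    and reach: "injective_reachable_via \<iota>X muX t ks \<sigma>" and sim: "similar_seeds \<sigma> t (mutates ks t)"
  shows "\<exists>twA twX. A_twist_automorphism v \<iota>A muA t ks \<sigma> twA \<and>
       X_twist_automorphism v \<iota>X muX t ks \<sigma> twX \<and>
       (\<forall>x \<in> upper_cluster_algebra \<iota>X muX t.
          p_star_alg t (\<iota>X t) (\<iota>A t) (twX x) = twA (p_star_alg t (\<iota>X t) (\<iota>A t) x))"
proof -
  let ?t' = "mutates ks t"
  have ks: "set ks \<subseteq> unfrozen t" and \<sigma>: "\<sigma> permutes unfrozen t"
    using reach by (simp_all add: injective_reachable_via_def)
  obtain \<psi> \<phi> where sim': "seed_similarity t \<sigma> t ?t' \<psi> \<phi>"
    by (rule DT_similarity[OF ok X reach sim])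
  note iso = similarity_iso[OF ok \<sigma> sim']
  note ok' = seed_ok_mutates[OF ok ks]
  interpret VA: variation_system v "unfrozen t" "mutation_class t" pois
    "\<lambda>s k. p_star s (frag_of k)" "\<lambda>s k m. coord m k" "trop_M 1" \<iota>A muA \<sigma>
    "\<lambda>s s' V. \<exists>\<psi>. seed_similarity t \<sigma> s s' \<psi> V"
    by (rule A_variation_system[OF ok A \<sigma>])
  interpret VX: variation_system v "unfrozen t" "mutation_class t" X_form
    "\<lambda>s k. frag_of k" bmat_row "trop_N 1" \<iota>X muX \<sigma>
    "\<lambda>s s' V. \<exists>\<phi>. seed_similarity t \<sigma> s s' V \<phi>"
    by (rule X_variation_system[OF ok X \<sigma>])
  interpret TX: quantum_torus v "X_form t" "\<iota>X t"
    by (rule VX.torus[OF self_in_mutation_class])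
  have exA: "\<exists>\<psi>. seed_similarity t \<sigma> t ?t' \<psi> \<phi>" and exX: "\<exists>\<phi>. seed_similarity t \<sigma> t ?t' \<psi> \<phi>"
    using sim' by blast+
  obtain twA where twA: "\<And>a. twA (\<iota>A t a) = mu_star muA ks t (\<iota>A ?t' (monomial_map \<phi> a))"
    "algebra_automorphism_on (\<iota>A t) (upper_cluster_algebra \<iota>A muA t) twA"
    using VA.twist_exists[OF ks exA] by blast
  obtain twX where twX: "\<And>a. twX (\<iota>X t a) = mu_star muX ks t (\<iota>X ?t' (monomial_map \<psi> a))"
    "algebra_automorphism_on (\<iota>X t) (upper_cluster_algebra \<iota>X muX t) twX"
    using VX.twist_exists[OF ks exX] by blast
  have "A_variation v t ?t' \<sigma> (monomial_map \<phi>)"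
    unfolding A_variation_def A_mult_def
    using similarity_M_variation[OF ok \<sigma> sim' refl]
      monomial_map_twisted_mult[OF lattice_iso_add(2)[OF iso], where v = v and form = "pois t"
        and form' = "pois ?t'"] lattice_iso_pois[OF iso] by auto
  then have 1: "A_twist_automorphism v \<iota>A muA t ks \<sigma> twA"
    unfolding A_twist_automorphism_def
    using twA bij_monomial_map[OF lattice_iso_bij(2)[OF iso]] by blast
  have "X_variation v t ?t' \<sigma> (monomial_map \<psi>)"
    unfolding X_variation_def X_mult_def
    using similarity_N_variation[OF ok \<sigma> sim' refl]
      monomial_map_twisted_mult[OF lattice_iso_add(1)[OF iso], where v = v
        and form = "X_form t" and form' = "X_form ?t'"]
      lattice_iso_omega[OF iso] by auto
  then have 2: "X_twist_automorphism v \<iota>X muX t ks \<sigma> twX"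
    unfolding X_twist_automorphism_def
    using twX bij_monomial_map[OF lattice_iso_bij(1)[OF iso]] by blast
  have Laurent: "\<exists>a. x = \<iota>X t a" if "x \<in> upper_cluster_algebra \<iota>X muX t" for x
  proof -
    have "x \<in> mu_star muX [] t ` range (\<iota>X (mutates [] t))"
      using that unfolding upper_cluster_algebra_def by (rule INT_D) simp
    then show ?thesis by auto
  qed
  have "p_star_alg t (\<iota>X t) (\<iota>A t) (twX x) = twA (p_star_alg t (\<iota>X t) (\<iota>A t) x)"
    if x: "x \<in> upper_cluster_algebra \<iota>X muX t" for x
  proof -
    have tw_x: "twX x \<in> upper_cluster_algebra \<iota>X muX t"
      using twX(2) x by (auto simp: algebra_automorphism_on_def bij_betw_def)
    obtain a a' where a: "x = \<iota>X t a" "twX x = \<iota>X t a'" using Laurent[OF x] Laurent[OF tw_x] by blast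
    have inv: "the_inv (\<iota>X t) (\<iota>X t b) = b" for b by (rule the_inv_f_f[OF TX.inj_\<iota>])
    have "\<phi> \<circ> p_star t = p_star ?t' \<circ> \<psi>"
      using lattice_iso_p_star[OF iso mult_pos[OF ok_seed[OF ok']]] by (simp add: fun_eq_iff)
    then have "twA (p_star_alg t (\<iota>X t) (\<iota>A t) x) =
        mu_star muA ks t (\<iota>A ?t' (monomial_map (p_star ?t') (monomial_map \<psi> a)))"
      by (simp add: p_star_alg_def a(1) inv twA(1) monomial_map_comp)
    also have "\<dots> = \<iota>A t (monomial_map (p_star t) a')"
      using p_star_mu_star[OF ok A X self_in_mutation_class ks] twX(1)[of a] a tw_x by simp
    finally show ?thesis by (simp add: p_star_alg_def a(2) inv)
  qed
  then show ?thesis using 1 2 by blast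
qed

end

section \<open>The classical and the quantum case\<close>

text \<open>With v = 1 every exponent is admissible, and the zero form is compatible for \<chi> = 0.
  The nonvanishing conditions say that 2 and all positive integers are nonzero in the base
  ring.\<close>

lemma classical_exponents:
  fixes t :: "'i::finite seed" and v :: "rat \<Rightarrow> 'k::idom"
  assumes "is_seed t" "classical_case v t"
  shows "exponents v UNIV 0" "exponents.seed_ok UNIV 0 t"
proof -
  have inj: "of_int a = (of_int b :: 'k) \<longleftrightarrow> a = b" for a b
    using assms(2) by (auto simp: classical_case_def bij_is_inj inj_eq)
  have v: "v q = 1" for q using assms(2) by (simp add: classical_case_def)
  show exp: "exponents v UNIV 0"
  proof
    fix d :: int and n :: nat and a :: int
    show "v (of_int 0 / of_int d) = 1" "v (of_int (a + b) / of_int d) =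
      v (of_int a / of_int d) * v (of_int b / of_int d)" for b by (simp_all add: v)
    show "1 + v (of_int a / of_int d) \<noteq> 0" using inj[of 2 0] by (simp add: v)
    show "q_int (\<lambda>n. v (of_int n / of_int d)) n \<noteq> 0" if "n > 0"
      using inj[of "int n" 0] that by (simp add: v q_int_def)
  qed (simp_all add: v)
  show "exponents.seed_ok UNIV 0 t"
    using assms unfolding exponents.seed_ok_def[OF exp] by (simp add: classical_case_def)
qed

text \<open>E is (1/d')\<int>, on which \<open>v\<close> is multiplicative through the group ring.
  Linear independence of distinct group elements yields both nonvanishing conditions.\<close>

lemma quantum_exponents:
  fixes t :: "'i::finite seed" and v :: "rat \<Rightarrow> 'k::idom"
  assumes "is_seed t" "quantum_case d' v t"
  defines "E \<equiv> {e. of_int d' * e \<in> \<int>}"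
  shows "exponents v E 1" "exponents.seed_ok E 1 t"
proof -
  have d': "d' > 0" and dvd: "\<And>i. mult t i dvd d'" and pois: "\<And>m m'. pois t m m' \<in> E"
    and comp: "compatible_poisson t"
    using assms by (auto simp: quantum_case_def)
  obtain h :: "(int \<Rightarrow>\<^sub>0 int) \<Rightarrow> 'k" where h: "bij h" "h 1 = 1" "\<And>x y. h (x + y) = h x + h y"
    "\<And>x y. h (x * y) = h x * h y" "\<And>a. h (single a 1) = v (of_int a / of_int d')"
    using assms(2) by (auto simp: quantum_case_def quantum_base_def)
  have h_0: "h 0 = 0" by (rule additive_minus(1)[of h, OF h(3)])
  have h_eq_0: "h x = 0 \<longleftrightarrow> x = 0" for x
    using inj_eq[OF bij_is_inj[OF h(1)], of x 0] by (simp add: h_0)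
  have h_sum: "h (sum f B) = (\<Sum>x\<in>B. h (f x))" for f and B :: "nat set"
    by (induction B rule: infinite_finite_induct) (simp_all add: h_0 h)
  have E_iff: "e \<in> E \<longleftrightarrow> (\<exists>a. e = of_int a / of_int d')" for e
    using d' unfolding E_def Ints_def by (auto simp: field_simps)
  have v_add: "v (e + e') = v e * v e'" if e: "e \<in> E" "e' \<in> E" for e e'
  proof -
    obtain a a' where "e = of_int a / of_int d'" "e' = of_int a' / of_int d'" using e E_iff by blast
    then show ?thesis
      using h(5)[of a] h(5)[of a'] h(5)[of "a + a'"] h(4)[of "single a 1" "single a' 1"]
      by (simp add: mult_single add_divide_distrib)
  qed
  have v_0: "v 0 = 1" using h(5)[of 0] h(2) by simp
  show exp: "exponents v E 1"
  proof
    show "0 \<in> E" by (simp add: E_def)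
    show "a + b \<in> E" if "a \<in> E" "b \<in> E" for a b using that by (simp add: E_def distrib_left)
    show "- a \<in> E" if "a \<in> E" for a using that by (simp add: E_def)
    show "v 0 = 1" by (rule v_0)
    show "v (a + b) = v a * v b" if "a \<in> E" "b \<in> E" for a b using v_add[OF that] .
    show "v (1 * a) = v a" for a by simp
    fix d :: int assume d: "d > 0" "1 / of_int d \<in> E"
    then obtain z where z: "1 / (of_int d :: rat) = of_int z / of_int d'" using E_iff by blast
    have "z \<noteq> 0" using z d(1) by auto
    have q: "v (of_int n / of_int d) = h (single (n * z) 1)" for n
    proof -
      have "of_int n / (of_int d :: rat) = of_int (n * z) / of_int d'"
        using z by (metis (no_types, lifting) mult.right_neutral of_int_mult times_divide_eq_right)
      then show ?thesis by (simp add: h(5))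
    qed
    show "v (of_int 0 / of_int d) = 1" by (simp add: v_0)
    show "v (of_int (a + b) / of_int d) = v (of_int a / of_int d) * v (of_int b / of_int d)" for a b
      unfolding q by (simp add: mult_single distrib_right flip: h(4))
    show "1 + v (of_int a / of_int d) \<noteq> 0" for a
    proof -
      \<comment> \<open>The constant coefficient is 1, or 2 if a = 0.\<close>
      have "lookup (1 + single (a * z) 1) 0 \<noteq> (0 :: int)"
        by (auto simp: lookup_add lookup_one lookup_single when_def)
      then have "h (1 + single (a * z) 1) \<noteq> 0" by (auto simp: h_eq_0)
      then show ?thesis by (simp add: h(2,3) q)
    qed
    show "q_int (\<lambda>n. v (of_int n / of_int d)) n \<noteq> 0" if n: "n > 0" for n
    proof -
      let ?x = "\<Sum>r<n. single ((int n - 1 - 2 * int r) * z) (1 :: int)"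
      \<comment> \<open>As z \<noteq> 0, the exponents are pairwise distinct, and the one for r = 0
        occurs exactly once.\<close>
      have "lookup ?x ((int n - 1) * z) = (\<Sum>r<n. if r = 0 then 1 else 0)"
        unfolding lookup_sum using \<open>z \<noteq> 0\<close>
        by (intro sum.cong refl) (auto simp: lookup_single when_def)
      also have "\<dots> = 1" using n by simp
      finally have "?x \<noteq> 0" by auto
      then have "h ?x \<noteq> 0" using h_eq_0 by blast
      then show ?thesis by (simp add: q_int_def q h_sum)
    qed
  qed
  have add: "pois t (a + b) c = pois t a c + pois t b c" and swap: "pois t a b = - pois t b a" for a b c
    using comp unfolding compatible_poisson_def by blast+
  have "pois t m (p_star t (frag_of k)) = - 1 * (of_int (coord m k) / of_int (mult t k))"
    if k: "k \<in> unfrozen t" for m k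
  proof (induction m rule: frag_all_induct)
    case zero
    show ?case using additive_minus(1)[of "\<lambda>a. pois t a (p_star t (frag_of k))", OF add] by simp
  next
    case (one i)
    have "pois t (frag_of i) (p_star t (frag_of k)) = (if i = k then - (1 / of_int (mult t k)) else 0)"
      using comp k unfolding compatible_poisson_def by blast
    then show ?case by simp
  next
    case (diff a b)
    then show ?case
      using additive_minus(3)[of "\<lambda>a. pois t a (p_star t (frag_of k))", OF add]
      by (simp add: lookup_minus diff_divide_distrib)
  qed
  moreover have "1 / of_int (mult t i) \<in> E" for i
  proof -
    have "(of_int d' :: rat) / of_int (mult t i) = of_int (d' div mult t i)"
      using dvd[of i] by (simp add: real_of_int_div of_int_div)
    then show ?thesis by (simp add: E_def)
  qed
  ultimately show "exponents.seed_ok E 1 t"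
    using assms(1) pois add swap unfolding exponents.seed_ok_def[OF exp] by blast
qed

theorem theorem5p2:
  fixes t :: "'i::finite seed"
    and v :: "rat \<Rightarrow> 'k::idom" and d' :: int
    and \<iota>A :: "'i seed \<Rightarrow> ('i, 'k) LP \<Rightarrow> 'a::division_ring"
    and muA :: "'i seed \<Rightarrow> 'i \<Rightarrow> 'a \<Rightarrow> 'a"
    and \<iota>X :: "'i seed \<Rightarrow> ('i, 'k) LP \<Rightarrow> 'x::division_ring"
    and muX :: "'i seed \<Rightarrow> 'i \<Rightarrow> 'x \<Rightarrow> 'x"
    and ks :: "'i list" and \<sigma> :: "'i \<Rightarrow> 'i"
  assumes "is_seed t"
    and "classical_case v t \<or> quantum_case d' v t"
    and "A_realization v t \<iota>A muA"
    and "X_realization v t \<iota>X muX"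
    and "injective_reachable_via \<iota>X muX t ks \<sigma>"
    and "similar_seeds \<sigma> t (mutates ks t)"
  shows "(\<exists>twA. A_twist_automorphism v \<iota>A muA t ks \<sigma> twA) \<and>
    (\<exists>twX. X_twist_automorphism v \<iota>X muX t ks \<sigma> twX) \<and>
    (\<exists>twA twX. A_twist_automorphism v \<iota>A muA t ks \<sigma> twA \<and>
       X_twist_automorphism v \<iota>X muX t ks \<sigma> twX \<and>
       (\<forall>x \<in> upper_cluster_algebra \<iota>X muX t.
          p_star_alg t (\<iota>X t) (\<iota>A t) (twX x) = twA (p_star_alg t (\<iota>X t) (\<iota>A t) x)))"
proof -
  obtain E \<chi> where "exponents v E \<chi>" "exponents.seed_ok E \<chi> t"
    using classical_exponents quantum_exponents assms(1,2) by blast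
  from exponents.twists_exist[OF this assms(3-6)] show ?thesis by blast
qed

end
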